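(* Let $(N,M)$ be a pair of connected CW-complexes ($M$ a subcomplex of $N$) such that the inclusion of $M$ in $N$ is a homotopy equivalence. Let $M^1$ and $N^1$ be the $1$-skeletons of $M$ and $N$. Suppose that $M$ has a unique $0$-cell, which is taken to be the base point $*$ of $M$ and $N$. Let $\{d_1,\ldots,d_m\}$ be the (finite) set of $1$-cells of $M$, so that $\pi_1(M^1,* )$ is the free group on $\{d_1,\ldots,d_m\}$, and let $c_1,\ldots,c_n\in\pi_1(N^1,* )$ be such that $\pi_1(N^1,* )$ is the free group on the set $\{d_1,\ldots,d_m,c_1,\ldots,c_n\}$. Then there exists a homotopy equivalence of based pairs $$(N,N^1,* )\cong(M,M^1,* )\vee(D^2,S^1,* )^{\vee n}.$$
   Context: Here $(D^2,S^1,* )$ is the 2-disk with its boundary circle and a base point $*\in S^1$; $(D^2,S^1,* )^{\vee n}$ is the wedge of $n$ copies, and the wedge of based pairs is $(A,A',* )\vee(B,B',* )=(A\vee B,A'\vee B',* )$. *)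

theory Defs
  imports "HOL-Analysis.Analysis" "HOL-Algebra.Group"
begin

section \<open>CW-complexes\<close>

definition disk :: "nat \<Rightarrow> (nat \<Rightarrow> real) topology" where
  "disk n = subtopology (Euclidean_space n) {x. (\<Sum>i<n. (x i)\<^sup>2) \<le> 1}"

definition open_disk :: "nat \<Rightarrow> (nat \<Rightarrow> real) set" where
  "open_disk n = {x \<in> topspace (Euclidean_space n). (\<Sum>i<n. (x i)\<^sup>2) < 1}"

definition boundary_sphere :: "nat \<Rightarrow> (nat \<Rightarrow> real) set" where
  "boundary_sphere n = {x \<in> topspace (Euclidean_space n). (\<Sum>i<n. (x i)\<^sup>2) = 1}"

text \<open>Cells are named by indices of type \<open>'c\<close>; each comes with a characteristic map, of which
  only the values on the disk of the appropriate dimension are relevant.\<close>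

record ('a, 'c) cw =
  cw_space :: "'a topology"
  cw_cells :: "'c set"
  cw_dim :: "'c \<Rightarrow> nat"
  cw_char :: "'c \<Rightarrow> (nat \<Rightarrow> real) \<Rightarrow> 'a"

definition closed_cell :: "('a, 'c) cw \<Rightarrow> 'c \<Rightarrow> 'a set" where
  "closed_cell X e = cw_char X e ` topspace (disk (cw_dim X e))"

definition open_cell :: "('a, 'c) cw \<Rightarrow> 'c \<Rightarrow> 'a set" where
  "open_cell X e = cw_char X e ` open_disk (cw_dim X e)"

definition cw_complex :: "('a, 'c) cw \<Rightarrow> bool" where
  "cw_complex X \<longleftrightarrow>
     Hausdorff_space (cw_space X) \<and>
     (\<forall>e\<in>cw_cells X.
        continuous_map (disk (cw_dim X e)) (cw_space X) (cw_char X e) \<and>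
        embedding_map (subtopology (disk (cw_dim X e)) (open_disk (cw_dim X e)))
          (cw_space X) (cw_char X e)) \<and>
     disjoint_family_on (open_cell X) (cw_cells X) \<and>
     topspace (cw_space X) = (\<Union>e\<in>cw_cells X. open_cell X e) \<and>
     (\<forall>e\<in>cw_cells X. \<exists>F. finite F \<and> F \<subseteq> {f \<in> cw_cells X. cw_dim X f < cw_dim X e} \<and>
        cw_char X e ` boundary_sphere (cw_dim X e) \<subseteq> (\<Union>f\<in>F. open_cell X f)) \<and>
     (\<forall>S. S \<subseteq> topspace (cw_space X) \<longrightarrow>
        (closedin (cw_space X) S \<longleftrightarrow>
          (\<forall>e\<in>cw_cells X. closedin (cw_space X) (S \<inter> closed_cell X e))))"

definition subcomplex :: "('a, 'c) cw \<Rightarrow> ('a, 'c) cw \<Rightarrow> bool" where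
  "subcomplex A X \<longleftrightarrow>
     cw_cells A \<subseteq> cw_cells X \<and>
     (\<forall>e\<in>cw_cells A. cw_dim A e = cw_dim X e \<and>
        (\<forall>x\<in>topspace (disk (cw_dim X e)). cw_char A e x = cw_char X e x)) \<and>
     (\<forall>e\<in>cw_cells A. closed_cell X e \<subseteq> (\<Union>f\<in>cw_cells A. open_cell X f)) \<and>
     cw_space A = subtopology (cw_space X) (\<Union>e\<in>cw_cells A. open_cell X e)"

definition cells_of_dim :: "('a, 'c) cw \<Rightarrow> nat \<Rightarrow> 'c set" where
  "cells_of_dim X k = {e \<in> cw_cells X. cw_dim X e = k}"

definition skeleton :: "('a, 'c) cw \<Rightarrow> nat \<Rightarrow> 'a set" where
  "skeleton X k = (\<Union>e\<in>{e \<in> cw_cells X. cw_dim X e \<le> k}. open_cell X e)"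

definition homotopy_equivalence_map :: "'a topology \<Rightarrow> 'b topology \<Rightarrow> ('a \<Rightarrow> 'b) \<Rightarrow> bool" where
  "homotopy_equivalence_map X Y f \<longleftrightarrow>
     continuous_map X Y f \<and>
     (\<exists>g. continuous_map Y X g \<and>
        homotopic_with (\<lambda>h. True) X X (g \<circ> f) id \<and>
        homotopic_with (\<lambda>h. True) Y Y (f \<circ> g) id)"


section \<open>The fundamental group\<close>

definition loop_at :: "'a topology \<Rightarrow> 'a \<Rightarrow> (real \<Rightarrow> 'a) \<Rightarrow> bool" where
  "loop_at X x p \<longleftrightarrow> pathin X p \<and> p 0 = x \<and> p 1 = x"

definition loop_homotopic :: "'a topology \<Rightarrow> 'a \<Rightarrow> (real \<Rightarrow> 'a) \<Rightarrow> (real \<Rightarrow> 'a) \<Rightarrow> bool" where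
  "loop_homotopic X x = homotopic_with (\<lambda>r. r 0 = x \<and> r 1 = x) (top_of_set {0..1}) X"

definition loop_class :: "'a topology \<Rightarrow> 'a \<Rightarrow> (real \<Rightarrow> 'a) \<Rightarrow> (real \<Rightarrow> 'a) set" where
  "loop_class X x p = {q. loop_homotopic X x p q}"

text \<open>The library's \<open>+++\<close> needs a topological type class on the codomain.\<close>

definition loop_join :: "(real \<Rightarrow> 'a) \<Rightarrow> (real \<Rightarrow> 'a) \<Rightarrow> real \<Rightarrow> 'a" where
  "loop_join p q t = (if t \<le> 1/2 then p (2 * t) else q (2 * t - 1))"

definition fundamental_group :: "'a topology \<Rightarrow> 'a \<Rightarrow> (real \<Rightarrow> 'a) set monoid" where
  "fundamental_group X x =
     \<lparr>carrier = loop_class X x ` {p. loop_at X x p},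
      mult = (\<lambda>P Q. \<Union>p\<in>P. \<Union>q\<in>Q. loop_class X x (loop_join p q)),
      one = loop_class X x (\<lambda>t. x)\<rparr>"

text \<open>The path traversing a 1-cell, the 1-disk \<open>[-1,1]\<close> being parametrised from \<open>-1\<close> to \<open>1\<close>.\<close>

definition edge_path :: "('a, 'c) cw \<Rightarrow> 'c \<Rightarrow> real \<Rightarrow> 'a" where
  "edge_path X e t = cw_char X e (\<lambda>i. if i = 0 then 2 * t - 1 else 0)"


section \<open>Free groups\<close>

text \<open>A letter \<open>(True, s)\<close> stands for the generator \<open>s\<close> and \<open>(False, s)\<close> for its inverse.\<close>

type_synonym 's word = "(bool \<times> 's) list"

fun cancels :: "bool \<times> 's \<Rightarrow> bool \<times> 's \<Rightarrow> bool" where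
  "cancels (a, s) (b, t) \<longleftrightarrow> s = t \<and> a \<noteq> b"

definition reduced_word :: "'s word \<Rightarrow> bool" where
  "reduced_word = successively (\<lambda>x y. \<not> cancels x y)"

fun push_letter :: "bool \<times> 's \<Rightarrow> 's word \<Rightarrow> 's word" where
  "push_letter x [] = [x]"
| "push_letter x (y # w) = (if cancels x y then w else x # y # w)"

definition reduce_word :: "'s word \<Rightarrow> 's word" where
  "reduce_word w = foldr push_letter w []"

definition free_group :: "'s set \<Rightarrow> 's word monoid" where
  "free_group S =
     \<lparr>carrier = {w \<in> lists (UNIV \<times> S). reduced_word w},
      mult = (\<lambda>u v. reduce_word (u @ v)),
      one = []\<rparr>"

definition letter_value :: "('g, 'm) monoid_scheme \<Rightarrow> ('s \<Rightarrow> 'g) \<Rightarrow> bool \<times> 's \<Rightarrow> 'g" where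
  "letter_value G b x = (if fst x then b (snd x) else inv\<^bsub>G\<^esub> b (snd x))"

definition word_value :: "('g, 'm) monoid_scheme \<Rightarrow> ('s \<Rightarrow> 'g) \<Rightarrow> 's word \<Rightarrow> 'g" where
  "word_value G b w = foldr (\<lambda>x g. letter_value G b x \<otimes>\<^bsub>G\<^esub> g) w \<one>\<^bsub>G\<^esub>"

text \<open>\<open>G\<close> is the free group on the family \<open>b\<close> indexed by \<open>S\<close>: the homomorphism from the free group
  on \<open>S\<close> induced by \<open>b\<close> is an isomorphism. In particular the members of the family are distinct.\<close>

definition free_group_on :: "('g, 'm) monoid_scheme \<Rightarrow> 's set \<Rightarrow> ('s \<Rightarrow> 'g) \<Rightarrow> bool" where
  "free_group_on G S b \<longleftrightarrow>
     group G \<and> b \<in> S \<rightarrow> carrier G \<and> word_value G b \<in> iso (free_group S) G"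


section \<open>Based pairs and their wedges\<close>

text \<open>A based pair \<open>(X, A, x)\<close> consists of a space \<open>X\<close>, a subset \<open>A\<close> and a base point \<open>x\<close>
  in \<open>A\<close>.\<close>

type_synonym 'a based_pair = "'a topology \<times> 'a set \<times> 'a"

definition based_pair_map :: "'a based_pair \<Rightarrow> 'b based_pair \<Rightarrow> ('a \<Rightarrow> 'b) \<Rightarrow> bool" where
  "based_pair_map = (\<lambda>(X, A, x) (Y, B, y) f. continuous_map X Y f \<and> f ` A \<subseteq> B \<and> f x = y)"

definition based_pair_homotopic ::
    "'a based_pair \<Rightarrow> 'b based_pair \<Rightarrow> ('a \<Rightarrow> 'b) \<Rightarrow> ('a \<Rightarrow> 'b) \<Rightarrow> bool" where
  "based_pair_homotopic P Q = homotopic_with (based_pair_map P Q) (fst P) (fst Q)"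

definition based_pair_homotopy_equivalent :: "'a based_pair \<Rightarrow> 'b based_pair \<Rightarrow> bool" where
  "based_pair_homotopy_equivalent P Q \<longleftrightarrow>
     (\<exists>f g. based_pair_map P Q f \<and> based_pair_map Q P g \<and>
        based_pair_homotopic P P (g \<circ> f) id \<and>
        based_pair_homotopic Q Q (f \<circ> g) id)"

text \<open>The quotient of \<open>X\<close> by a subset \<open>K\<close> collapsed to the point \<open>None\<close>. For empty \<open>K\<close>, this adds
  an isolated point, as usual; so the wedge of the empty family will be a point.\<close>

definition collapse_map :: "'a set \<Rightarrow> 'a \<Rightarrow> 'a option" where
  "collapse_map K x = (if x \<in> K then None else Some x)"

definition collapse :: "'a topology \<Rightarrow> 'a set \<Rightarrow> 'a option topology" where
  "collapse X K = topology (\<lambda>U. U \<subseteq> insert None (collapse_map K ` topspace X) \<and>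
     openin X {x \<in> topspace X. collapse_map K x \<in> U})"

lemma openin_collapse:
  "openin (collapse X K) U \<longleftrightarrow>
     U \<subseteq> insert None (collapse_map K ` topspace X) \<and>
     openin X {x \<in> topspace X. collapse_map K x \<in> U}"
proof -
  let ?pre = "\<lambda>U. {x \<in> topspace X. collapse_map K x \<in> U}"
  have 1: "?pre (S \<inter> T) = ?pre S \<inter> ?pre T" for S T
    by auto
  have 2: "?pre (\<Union>\<K>) = (\<Union>S\<in>\<K>. ?pre S)" for \<K>
    by auto
  have "istopology (\<lambda>U. U \<subseteq> insert None (collapse_map K ` topspace X) \<and> openin X (?pre U))"
    unfolding istopology_def 1 2 by blast
  then show ?thesis
    by (simp add: collapse_def)
qed

definition collapse_pair :: "'a topology \<Rightarrow> 'a set \<Rightarrow> 'a set \<Rightarrow> 'a option based_pair" where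
  "collapse_pair X A K = (collapse X K, insert None (collapse_map K ` A), None)"

definition disjoint_sum :: "'a topology \<Rightarrow> 'b topology \<Rightarrow> ('a + 'b) topology" where
  "disjoint_sum X Y = topology (\<lambda>U. openin X (Inl -` U) \<and> openin Y (Inr -` U))"

lemma openin_disjoint_sum:
  "openin (disjoint_sum X Y) U \<longleftrightarrow> openin X (Inl -` U) \<and> openin Y (Inr -` U)"
proof -
  have "istopology (\<lambda>U :: ('a + 'b) set. openin X (Inl -` U) \<and> openin Y (Inr -` U))"
    unfolding istopology_def vimage_Int vimage_Union by blast
  then show ?thesis
    by (simp add: disjoint_sum_def)
qed

definition wedge :: "'a based_pair \<Rightarrow> 'b based_pair \<Rightarrow> ('a + 'b) option based_pair" where
  "wedge = (\<lambda>(X, A, x) (Y, B, y). collapse_pair (disjoint_sum X Y) (A <+> B) {Inl x, Inr y})"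

definition wedge_power :: "nat \<Rightarrow> 'a based_pair \<Rightarrow> (nat \<times> 'a) option based_pair" where
  "wedge_power n = (\<lambda>(X, A, x).
     collapse_pair (sum_topology (\<lambda>i. X) {..<n}) ({..<n} \<times> A) ({..<n} \<times> {x}))"

definition based_2_disk :: "(nat \<Rightarrow> real) based_pair" where
  "based_2_disk = (disk 2, boundary_sphere 2, (\<lambda>i. if i = 0 then 1 else 0))"

end

theory Submission
  imports Defs
begin

text \<open>Write \<open>M\<close> and \<open>N\<close> for the given complexes, \<open>W\<close> for the wedge of \<open>M\<close> with \<open>n\<close> disks, and
  \<open>K\<close> for the wedge of the 1-skeleton of \<open>M\<close> with \<open>n\<close> circles. Since \<open>M\<close> is a deformation retract
  of \<open>N\<close> and loops in \<open>M\<close> can be pushed into its 1-skeleton, each \<open>c\<^sub>j\<close> equals in \<open>N\<close> some loop \<open>w\<^sub>j\<close> in the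
  1-skeleton of \<open>M\<close>. Then \<open>c\<^sub>j w\<^sub>j\<^sup>-\<^sup>1\<close> is null-homotopic in \<open>N\<close>, which gives a map \<open>f : W \<rightarrow> N\<close> that is the
  identity on \<open>M\<close> and sends the \<open>j\<close>-th circle to \<open>c\<^sub>j w\<^sub>j\<^sup>-\<^sup>1\<close>.

  Conversely, freeness provides a homomorphism from the fundamental group of the 1-skeleton of \<open>N\<close> to that of \<open>K\<close>
  that is right inverse to \<open>f\<close>; realising it edge by edge yields a map of the 1-skeleton of \<open>N\<close> to \<open>K\<close>, inverse to
  \<open>f\<close> up to homotopy. It extends over \<open>N\<close> to a map \<open>g\<close> with \<open>f g \<simeq> 1\<close>, because \<open>M\<close> is a strong deformation retract
  of both \<open>N\<close> and \<open>W\<close>, so that maps can be lifted through \<open>f\<close> relative to a cofibration.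
  Lifting through \<open>g\<close> in the same way gives \<open>f'\<close> with \<open>g f' \<simeq> 1\<close>. All homotopies respect the
  1-skeleta and the base points, so \<open>f\<close> and \<open>g\<close> are mutually inverse.\<close>

text \<open>A homotopy equivalence of pairs is more than a homotopy equivalence of the spaces and
  one of the subspaces: all maps and homotopies have to respect the 1-skeleta at once. So everything
  is prescribed on a subspace first (\<open>M\<close> with the 1-skeleton of \<open>N\<close>,
  respectively \<open>M\<close> with the circles), and the liftings keep the prescribed map and, up
  to a change of time, the prescribed homotopy. The fundamental group of \<open>K\<close> is never
  computed. The homomorphism sends each edge of \<open>M\<close> to itself and the class of
  \<open>c j\<close> to circle \<open>j\<close> followed by \<open>w j\<close>. Hence it sends the
  corrected generator to circle \<open>j\<close> itself, and this is exactly what the second lifting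
  needs. \<open>N\<close> may have many vertices and infinitely many edges. Instead of contracting a
  maximal tree, every vertex is sent to the base point, and the homotopy to the identity drags it
  along a chosen path. Cellular approximation is needed for paths only. An induction principle,
  \<open>path_predicate\<close>, takes its place: a property that is invariant under homotopy,
  concatenation and reversal has to be checked on constants and edges only.\<close>

abbreviation UI :: "real topology" where "UI \<equiv> top_of_set {0..1}"

abbreviation cyl :: "'a topology \<Rightarrow> (real \<times> 'a) topology" where "cyl X \<equiv> prod_topology UI X"

lemma continuous_map_composeI:
  assumes "continuous_map Y Z h" "continuous_map X Y g"
  shows "continuous_map X Z (\<lambda>x. h (g x))"
  using continuous_map_compose[OF assms(2,1)] by (simp add: o_def)

lemma continuous_map_UI:
  assumes "continuous_map X euclideanreal s" "\<And>x. x \<in> topspace X \<Longrightarrow> 0 \<le> s x \<and> s x \<le> 1"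
  shows "continuous_map X UI s"
  using assms by (auto simp: continuous_map_in_subtopology)

lemma continuous_map_cyl:
  assumes "continuous_map Z euclideanreal s" "\<And>z. z \<in> topspace Z \<Longrightarrow> 0 \<le> s z \<and> s z \<le> 1"
    and "continuous_map Z X f"
  shows "continuous_map Z (cyl X) (\<lambda>z. (s z, f z))"
  using assms by (intro continuous_map_pairedI continuous_map_UI)

lemma continuous_map_real_of_UI [simp, continuous_intros]: "continuous_map UI euclideanreal (\<lambda>t. t)"
  by (simp add: continuous_map_from_subtopology)

lemma continuous_map_fst_cyl [continuous_intros]: "continuous_map (cyl X) euclideanreal fst"
  using continuous_map_fst[of UI X] continuous_map_in_subtopology by blast

lemma continuous_map_snd_cyl_UI: "continuous_map (cyl UI) euclideanreal snd"
  using continuous_map_snd[of UI UI] continuous_map_in_subtopology by blast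

lemma continuous_map_ident [continuous_intros]: "continuous_map X X (\<lambda>x. x)"
  using continuous_map_id[of X] by (simp add: id_def)

subsection \<open>Spaces generated by families of maps\<close>

text \<open>The final topology of a family of maps: the disjoint sum of the \<open>Y i\<close> maps
  onto \<open>X\<close> by a quotient map. CW-complexes, wedges and quotients of compact spaces all
  have this form, so continuity of maps and homotopies on them is checked piece by piece.\<close>

definition generated_by ::
  "'a topology \<Rightarrow> 'i set \<Rightarrow> ('i \<Rightarrow> 'b topology) \<Rightarrow> ('i \<Rightarrow> 'b \<Rightarrow> 'a) \<Rightarrow> bool" where
  "generated_by X I Y \<phi> \<longleftrightarrow>
     (\<forall>i\<in>I. continuous_map (Y i) X (\<phi> i)) \<and>
     topspace X = (\<Union>i\<in>I. \<phi> i ` topspace (Y i)) \<and>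
     (\<forall>U \<subseteq> topspace X. (\<forall>i\<in>I. openin (Y i) {y \<in> topspace (Y i). \<phi> i y \<in> U}) \<longrightarrow> openin X U)"

lemma generated_by_openin:
  assumes "generated_by X I Y \<phi>" "U \<subseteq> topspace X"
    and "\<And>i. i \<in> I \<Longrightarrow> openin (Y i) {y \<in> topspace (Y i). \<phi> i y \<in> U}"
  shows "openin X U"
  using assms unfolding generated_by_def by blast

lemma generated_by_continuous_map:
  assumes gen: "generated_by X I Y \<phi>"
    and h: "\<And>i. i \<in> I \<Longrightarrow> continuous_map (Y i) Z (\<lambda>y. h (\<phi> i y))"
  shows "continuous_map X Z h"
  unfolding continuous_map_def
proof (intro conjI allI impI)
  show "h \<in> topspace X \<rightarrow> topspace Z"
    using gen h unfolding generated_by_def continuous_map_def by fastforce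
  fix U assume U: "openin Z U"
  have "openin (Y i) {y \<in> topspace (Y i). \<phi> i y \<in> {x \<in> topspace X. h x \<in> U}}" if "i \<in> I" for i
  proof -
    have "{y \<in> topspace (Y i). \<phi> i y \<in> {x \<in> topspace X. h x \<in> U}} = {y \<in> topspace (Y i). h (\<phi> i y) \<in> U}"
      using gen that unfolding generated_by_def by blast
    then show ?thesis
      using h[OF that] U by (simp add: continuous_map_def)
  qed
  then show "openin X {x \<in> topspace X. h x \<in> U}"
    by (intro generated_by_openin[OF gen]) simp_all
qed

text \<open>Multiplication by the unit interval preserves quotient maps because the interval is
  locally compact: over a compact interval \<open>J\<close> of times, the tube lemma yields an open
  set of positions.\<close>

lemma generated_by_cyl:
  assumes gen: "generated_by X I Y \<phi>"
  shows "generated_by (cyl X) I (\<lambda>i. cyl (Y i)) (\<lambda>i z. (fst z, \<phi> i (snd z)))"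
  unfolding generated_by_def
proof (intro conjI ballI allI impI)
  have cont: "continuous_map (Y i) X (\<phi> i)" if "i \<in> I" for i
    using gen that by (simp add: generated_by_def)
  have top: "topspace X = (\<Union>i\<in>I. \<phi> i ` topspace (Y i))"
    using gen by (simp add: generated_by_def)
  show cont': "continuous_map (cyl (Y i)) (cyl X) (\<lambda>z. (fst z, \<phi> i (snd z)))" if "i \<in> I" for i
    by (intro continuous_map_pairedI continuous_map_fst continuous_map_composeI[OF cont[OF that]] continuous_map_snd)
  show "topspace (cyl X) = (\<Union>i\<in>I. (\<lambda>z. (fst z, \<phi> i (snd z))) ` topspace (cyl (Y i)))"
    unfolding topspace_prod_topology top by (auto simp: image_iff; blast)
  fix U assume sub: "U \<subseteq> topspace (cyl X)"
    and op: "\<forall>i\<in>I. openin (cyl (Y i)) {z \<in> topspace (cyl (Y i)). (fst z, \<phi> i (snd z)) \<in> U}"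
  show "openin (cyl X) U"
  proof (subst openin_subopen, intro ballI)
    fix p assume p: "p \<in> U"
    obtain t0 x0 where px: "p = (t0, x0)" by fastforce
    have t0: "t0 \<in> {0..1}" and x0: "x0 \<in> topspace X" using p px sub by auto
    obtain i0 y0 where i0: "i0 \<in> I" "y0 \<in> topspace (Y i0)" "\<phi> i0 y0 = x0"
      using x0 top by auto
    have "continuous_map UI (cyl (Y i0)) (\<lambda>t. (t, y0))"
      using i0 by (intro continuous_map_pairedI) (auto simp: continuous_map_ident)
    then have "openin UI {t \<in> topspace UI. (t, y0) \<in> {z \<in> topspace (cyl (Y i0)). (fst z, \<phi> i0 (snd z)) \<in> U}}"
      using op i0(1) unfolding continuous_map_def by blast
    moreover have "{t \<in> topspace UI. (t, y0) \<in> {z \<in> topspace (cyl (Y i0)). (fst z, \<phi> i0 (snd z)) \<in> U}}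
      = {t \<in> {0..1}. (t, x0) \<in> U}" using i0 by auto
    ultimately have "openin UI {t \<in> {0..1}. (t, x0) \<in> U}" by simp
    moreover have "t0 \<in> {t \<in> {0..1}. (t, x0) \<in> U}" using p px t0 by simp
    ultimately obtain e where e: "e > 0" "ball t0 e \<inter> {0..1} \<subseteq> {t \<in> {0..1}. (t, x0) \<in> U}"
      unfolding openin_contains_ball by blast
    \<comment> \<open>Half the radius, so that the closed interval \<open>J\<close> is compact and
      still inside the ball.\<close>
    define J where "J = cball t0 (e/2) \<inter> {0..1}"
    have J: "compact J" "J \<subseteq> {0..1}" "t0 \<in> J" "\<And>t. t \<in> J \<Longrightarrow> (t, x0) \<in> U"
      using e t0 by (auto simp: J_def compact_Int subset_iff)
    \<comment> \<open>The points whose whole slab over \<open>J\<close> lies in \<open>U\<close>.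
      Its preimage in each \<open>Y i\<close> is open by the tube lemma.\<close>
    define V where "V = {x \<in> topspace X. \<forall>t\<in>J. (t, x) \<in> U}"
    have "openin (Y i) {y \<in> topspace (Y i). \<phi> i y \<in> V}" if i: "i \<in> I" for i
    proof (subst openin_subopen, intro ballI)
      fix y assume y: "y \<in> {y \<in> topspace (Y i). \<phi> i y \<in> V}"
      let ?W = "{z \<in> topspace (cyl (Y i)). (fst z, \<phi> i (snd z)) \<in> U}"
      have "J \<times> {y} \<subseteq> ?W" using y J by (auto simp: V_def)
      moreover have "compactin UI J" using J by (simp add: compactin_subtopology)
      ultimately obtain A B where AB: "openin UI A" "openin (Y i) B" "J \<subseteq> A" "y \<in> B" "A \<times> B \<subseteq> ?W"
        using tube_lemma_left[of UI "Y i" ?W J y] op i y by auto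
      have "B \<subseteq> {y \<in> topspace (Y i). \<phi> i y \<in> V}"
      proof
        fix b assume b: "b \<in> B"
        then have bY: "b \<in> topspace (Y i)" using AB(2) openin_subset by blast
        moreover have "\<phi> i b \<in> topspace X" using bY top i by auto
        moreover have "(t, \<phi> i b) \<in> U" if "t \<in> J" for t
          using AB(3,5) b that by fastforce
        ultimately show "b \<in> {y \<in> topspace (Y i). \<phi> i y \<in> V}" by (simp add: V_def)
      qed
      then show "\<exists>T. openin (Y i) T \<and> y \<in> T \<and> T \<subseteq> {y \<in> topspace (Y i). \<phi> i y \<in> V}"
        using AB by blast
    qed
    then have V: "openin X V"
      by (intro generated_by_openin[OF gen]) (simp_all add: V_def)
    have B: "openin UI ({0..1} \<inter> ball t0 (e/2))"
      by (simp add: openin_open_Int)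
    have "openin (cyl X) (({0..1} \<inter> ball t0 (e/2)) \<times> V)"
      using V B by (simp add: openin_prod_Times_iff)
    moreover have "p \<in> ({0..1} \<inter> ball t0 (e/2)) \<times> V"
      using p px t0 x0 e J by (auto simp: V_def)
    moreover have "({0..1} \<inter> ball t0 (e/2)) \<times> V \<subseteq> U"
      by (auto simp: V_def J_def)
    ultimately show "\<exists>T. openin (cyl X) T \<and> p \<in> T \<and> T \<subseteq> U" by blast
  qed
qed

lemma generated_by_continuous_cyl:
  assumes gen: "generated_by X I Y \<phi>"
    and h: "\<And>i. i \<in> I \<Longrightarrow> continuous_map (cyl (Y i)) Z (\<lambda>z. h (fst z, \<phi> i (snd z)))"
  shows "continuous_map (cyl X) Z h"
  by (rule generated_by_continuous_map[OF generated_by_cyl[OF gen]]) (use h in auto)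

lemma generated_by_quotient:
  assumes "continuous_map Y X q" "compact_space Y" "Hausdorff_space X" "q ` topspace Y = topspace X"
  shows "generated_by X {()} (\<lambda>_. Y) (\<lambda>_. q)"
  using continuous_imp_quotient_map[OF assms] assms(1,4)
  by (auto simp: generated_by_def quotient_map_def)

lemma generated_by_glue:
  assumes gen: "generated_by X I Y \<phi>"
    and cont: "\<And>i. i \<in> I \<Longrightarrow> continuous_map (Y i) Z (u i)"
    and compat: "\<And>i j y z. \<lbrakk>i \<in> I; j \<in> I; y \<in> topspace (Y i); z \<in> topspace (Y j); \<phi> i y = \<phi> j z\<rbrakk> \<Longrightarrow> u i y = u j z"
  obtains h where "continuous_map X Z h" "\<And>i y. i \<in> I \<Longrightarrow> y \<in> topspace (Y i) \<Longrightarrow> h (\<phi> i y) = u i y"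
proof -
  \<comment> \<open>Any preimage serves, since compatibility makes the value independent of the
    choice.\<close>
  define w where "w x = (SOME p. fst p \<in> I \<and> snd p \<in> topspace (Y (fst p)) \<and> \<phi> (fst p) (snd p) = x)" for x
  define h where "h x = u (fst (w x)) (snd (w x))" for x
  have h: "h (\<phi> i y) = u i y" if iy: "i \<in> I" "y \<in> topspace (Y i)" for i y
  proof -
    have "fst (w (\<phi> i y)) \<in> I \<and> snd (w (\<phi> i y)) \<in> topspace (Y (fst (w (\<phi> i y)))) \<and>
      \<phi> (fst (w (\<phi> i y))) (snd (w (\<phi> i y))) = \<phi> i y"
      unfolding w_def by (rule someI[of _ "(i, y)"]) (simp add: iy)
    then show ?thesis
      unfolding h_def by (intro compat iy) auto
  qed
  moreover have "continuous_map X Z h"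
    by (intro generated_by_continuous_map[OF gen] continuous_map_eq[OF cont]) (simp_all add: h)
  ultimately show ?thesis using that by blast
qed

subsection \<open>Concatenation of homotopies\<close>

definition hcat :: "(real \<times> 'a \<Rightarrow> 'b) \<Rightarrow> (real \<times> 'a \<Rightarrow> 'b) \<Rightarrow> real \<times> 'a \<Rightarrow> 'b" where
  "hcat h k z = (if fst z \<le> 1/2 then h (2 * fst z, snd z) else k (2 * fst z - 1, snd z))"

lemma continuous_map_hcat:
  assumes "continuous_map (cyl X) Y h" "continuous_map (cyl X) Y k"
    and "\<And>x. x \<in> topspace X \<Longrightarrow> h (1, x) = k (0, x)"
  shows "continuous_map (cyl X) Y (hcat h k)"
  unfolding hcat_def
proof (rule continuous_map_cases_le)
  show "continuous_map (cyl X) euclideanreal fst" by (rule continuous_map_fst_cyl)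
  show "continuous_map (subtopology (cyl X) {x \<in> topspace (cyl X). fst x \<le> 1/2}) Y (\<lambda>x. h (2 * fst x, snd x))"
    by (intro continuous_map_composeI[OF assms(1)] continuous_map_cyl)
      (auto intro!: continuous_intros continuous_map_from_subtopology)
  show "continuous_map (subtopology (cyl X) {x \<in> topspace (cyl X). 1/2 \<le> fst x}) Y (\<lambda>x. k (2 * fst x - 1, snd x))"
    by (intro continuous_map_composeI[OF assms(2)] continuous_map_cyl)
      (auto intro!: continuous_intros continuous_map_from_subtopology)
  show "continuous_map (cyl X) euclideanreal (\<lambda>z. 1/2)" by simp
  show "h (2 * fst z, snd z) = k (2 * fst z - 1, snd z)" if "z \<in> topspace (cyl X)" "fst z = 1/2" for z
  proof -
    have z: "2 * fst z = 1" and "snd z \<in> topspace X" using that by auto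
    then show ?thesis using assms(3)[of "snd z"] unfolding z by simp
  qed
qed

lemma hcat_0 [simp]: "hcat h k (0, x) = h (0, x)"
  and hcat_1 [simp]: "hcat h k (1, x) = k (1, x)"
  by (auto simp: hcat_def)

lemma continuous_map_reverse:
  assumes "continuous_map (cyl X) Y h"
  shows "continuous_map (cyl X) Y (\<lambda>z. h (1 - fst z, snd z))"
  by (intro continuous_map_composeI[OF assms] continuous_map_cyl) (auto intro!: continuous_intros)

subsection \<open>Paths up to homotopy\<close>

definition joins :: "'a topology \<Rightarrow> 'a \<Rightarrow> 'a \<Rightarrow> (real \<Rightarrow> 'a) \<Rightarrow> bool" where
  "joins X a b p \<longleftrightarrow> pathin X p \<and> p 0 = a \<and> p 1 = b"

text \<open>Homotopy relative to two possibly different end points. Loops alone do not suffice: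
  \<open>N\<close> has many vertices, and paths to arbitrary points of cells occur in the path
  induction.\<close>

definition path_hom :: "'a topology \<Rightarrow> 'a \<Rightarrow> 'a \<Rightarrow> (real \<Rightarrow> 'a) \<Rightarrow> (real \<Rightarrow> 'a) \<Rightarrow> bool" where
  "path_hom X a b = homotopic_with (\<lambda>r. r 0 = a \<and> r 1 = b) UI X"

abbreviation (input) rev_path :: "(real \<Rightarrow> 'a) \<Rightarrow> real \<Rightarrow> 'a" where "rev_path p \<equiv> \<lambda>t. p (1 - t)"

lemma path_homI:
  assumes "continuous_map (cyl UI) X K"
    and "\<And>t. t \<in> {0..1} \<Longrightarrow> K (0, t) = p t" "\<And>t. t \<in> {0..1} \<Longrightarrow> K (1, t) = q t"
    and "\<And>s. s \<in> {0..1} \<Longrightarrow> K (s, 0) = a" "\<And>s. s \<in> {0..1} \<Longrightarrow> K (s, 1) = b"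
  shows "path_hom X a b p q"
  unfolding path_hom_def
  by (subst homotopic_with) (use assms in auto)

lemma path_homE:
  assumes "path_hom X a b p q"
  obtains K where "continuous_map (cyl UI) X K"
    "\<And>t. K (0, t) = p t" "\<And>t. K (1, t) = q t"
    "\<And>s. s \<in> {0..1} \<Longrightarrow> K (s, 0) = a" "\<And>s. s \<in> {0..1} \<Longrightarrow> K (s, 1) = b"
  using assms unfolding path_hom_def homotopic_with_def by auto

lemma path_hom_refl: "joins X a b p \<Longrightarrow> path_hom X a b p p"
  by (simp add: path_hom_def joins_def pathin_def)

lemma path_hom_joins: "path_hom X a b p q \<Longrightarrow> joins X a b p" "path_hom X a b p q \<Longrightarrow> joins X a b q"
  using homotopic_with_imp_continuous_maps homotopic_with_imp_property
  unfolding path_hom_def joins_def pathin_def by blast+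

lemma path_hom_sym: "path_hom X a b p q \<Longrightarrow> path_hom X a b q p"
  by (simp add: path_hom_def homotopic_with_symD)

lemma path_hom_trans [trans]: "path_hom X a b p q \<Longrightarrow> path_hom X a b q r \<Longrightarrow> path_hom X a b p r"
  unfolding path_hom_def by (rule homotopic_with_trans)

text \<open>Paths are total functions of which only the values on \<open>{0..1}\<close> matter; this
  absorbs differences elsewhere.\<close>

lemma path_hom_eq:
  assumes "joins X a b p" "\<And>t. t \<in> {0..1} \<Longrightarrow> p t = q t"
  shows "path_hom X a b p q"
proof -
  have "continuous_map UI X p" using assms(1) by (simp add: joins_def pathin_def)
  then have "continuous_map (cyl UI) X (\<lambda>z. p (snd z))"
    by (rule continuous_map_composeI) (rule continuous_map_snd)
  then show ?thesis
  proof (rule path_homI)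
    show "p (snd (1::real, t)) = q t" if "t \<in> {0..1}" for t
      using assms(2)[OF that] by simp
    show "p (snd (s::real, 0)) = a" "p (snd (s::real, 1)) = b" for s
      using assms(1) by (simp_all add: joins_def)
  qed simp
qed

lemma joins_in_topspace: "joins X a b p \<Longrightarrow> t \<in> {0..1} \<Longrightarrow> p t \<in> topspace X"
  unfolding joins_def pathin_def continuous_map_def by auto

lemma joins_endpoints: "joins X a b p \<Longrightarrow> a \<in> topspace X" "joins X a b p \<Longrightarrow> b \<in> topspace X"
  using joins_in_topspace[of X a b p 0] joins_in_topspace[of X a b p 1] by (auto simp: joins_def)

lemma joins_image: "joins X a b p \<Longrightarrow> continuous_map X Y f \<Longrightarrow> joins Y (f a) (f b) (\<lambda>t. f (p t))"
  by (auto simp: joins_def pathin_def intro: continuous_map_composeI)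

lemma path_hom_image:
  assumes "path_hom X a b p q" "continuous_map X Y f"
  shows "path_hom Y (f a) (f b) (\<lambda>t. f (p t)) (\<lambda>t. f (q t))"
proof -
  obtain K where K: "continuous_map (cyl UI) X K"
    "\<And>t. K (0, t) = p t" "\<And>t. K (1, t) = q t"
    "\<And>s. s \<in> {0..1} \<Longrightarrow> K (s, 0) = a" "\<And>s. s \<in> {0..1} \<Longrightarrow> K (s, 1) = b"
    using path_homE[OF assms(1)] by metis
  show ?thesis
    by (rule path_homI[where K = "\<lambda>z. f (K z)"]) (use K assms(2) in \<open>auto intro: continuous_map_composeI\<close>)
qed

lemma joins_const: "a \<in> topspace X \<Longrightarrow> joins X a a (\<lambda>t. a)"
  by (simp add: joins_def pathin_def)

lemma continuous_map_loop_join: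
  assumes u: "continuous_map (cyl UI) X u" and v: "continuous_map (cyl UI) X v"
    and uv: "\<And>s. s \<in> {0..1} \<Longrightarrow> u (s, 1) = v (s, 0)"
  shows "continuous_map (cyl UI) X (\<lambda>z. loop_join (\<lambda>t. u (fst z, t)) (\<lambda>t. v (fst z, t)) (snd z))"
  unfolding loop_join_def
proof (rule continuous_map_cases_le)
  show "continuous_map (cyl UI) euclideanreal snd" by (rule continuous_map_snd_cyl_UI)
  show "continuous_map (subtopology (cyl UI) {x \<in> topspace (cyl UI). snd x \<le> 1/2}) X (\<lambda>z. u (fst z, 2 * snd z))"
    by (intro continuous_map_composeI[OF u] continuous_map_cyl continuous_map_UI)
      (auto intro!: continuous_intros continuous_map_from_subtopology continuous_map_snd_cyl_UI)
  show "continuous_map (subtopology (cyl UI) {x \<in> topspace (cyl UI). 1/2 \<le> snd x}) X (\<lambda>z. v (fst z, 2 * snd z - 1))"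
    by (intro continuous_map_composeI[OF v] continuous_map_cyl continuous_map_UI)
      (auto intro!: continuous_intros continuous_map_from_subtopology continuous_map_snd_cyl_UI)
  show "continuous_map (cyl UI) euclideanreal (\<lambda>z. 1/2)" by simp
  show "u (fst z, 2 * snd z) = v (fst z, 2 * snd z - 1)" if "z \<in> topspace (cyl UI)" "snd z = 1/2" for z
  proof -
    have z: "2 * snd z = 1" and "fst z \<in> {0..1}" using that by auto
    then show ?thesis using uv[of "fst z"] unfolding z by simp
  qed
qed

lemma path_hom_join:
  assumes "path_hom X a b p p'" "path_hom X b c q q'"
  shows "path_hom X a c (loop_join p q) (loop_join p' q')"
proof -
  obtain K where K: "continuous_map (cyl UI) X K"
    "\<And>t. K (0, t) = p t" "\<And>t. K (1, t) = p' t"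
    "\<And>s. s \<in> {0..1} \<Longrightarrow> K (s, 0) = a" "\<And>s. s \<in> {0..1} \<Longrightarrow> K (s, 1) = b"
    using path_homE[OF assms(1)] by metis
  obtain L where L: "continuous_map (cyl UI) X L"
    "\<And>t. L (0, t) = q t" "\<And>t. L (1, t) = q' t"
    "\<And>s. s \<in> {0..1} \<Longrightarrow> L (s, 0) = b" "\<And>s. s \<in> {0..1} \<Longrightarrow> L (s, 1) = c"
    using path_homE[OF assms(2)] by metis
  show ?thesis
    by (rule path_homI[OF continuous_map_loop_join[OF K(1) L(1)]])
      (use K L in \<open>auto simp: loop_join_def\<close>)
qed

lemma joins_loop_join: "joins X a b p \<Longrightarrow> joins X b c q \<Longrightarrow> joins X a c (loop_join p q)"
  using path_hom_join path_hom_refl path_hom_joins by metis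

lemma path_hom_rev:
  assumes "path_hom X a b p q"
  shows "path_hom X b a (rev_path p) (rev_path q)"
proof -
  obtain K where K: "continuous_map (cyl UI) X K"
    "\<And>t. K (0, t) = p t" "\<And>t. K (1, t) = q t"
    "\<And>s. s \<in> {0..1} \<Longrightarrow> K (s, 0) = a" "\<And>s. s \<in> {0..1} \<Longrightarrow> K (s, 1) = b"
    using path_homE[OF assms(1)] by metis
  have "continuous_map (cyl UI) X (\<lambda>z. K (fst z, 1 - snd z))"
    by (intro continuous_map_composeI[OF K(1)] continuous_map_cyl continuous_map_UI)
      (auto intro!: continuous_intros continuous_map_snd_cyl_UI)
  then show ?thesis
    by (rule path_homI) (use K in auto)
qed

lemma joins_rev: "joins X a b p \<Longrightarrow> joins X b a (rev_path p)"
  using path_hom_rev path_hom_refl path_hom_joins by metis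

text \<open>Straight-line homotopy in the parameter set. The unit laws, inverses and associativity
  of \<open>loop_join\<close> all come from it by writing both sides as one path after two
  reparametrisations.\<close>

lemma path_hom_convex:
  fixes \<sigma> \<tau> :: "real \<Rightarrow> 'v::real_normed_vector"
  assumes u: "continuous_map (top_of_set S) X u" and S: "convex S"
    and \<sigma>: "continuous_on {0..1} \<sigma>" "\<sigma> \<in> {0..1} \<rightarrow> S" and \<tau>: "continuous_on {0..1} \<tau>" "\<tau> \<in> {0..1} \<rightarrow> S"
    and e: "\<sigma> 0 = \<tau> 0" "\<sigma> 1 = \<tau> 1"
    and p: "\<And>t. t \<in> {0..1} \<Longrightarrow> p t = u (\<sigma> t)" and q: "\<And>t. t \<in> {0..1} \<Longrightarrow> q t = u (\<tau> t)"
  shows "path_hom X (p 0) (p 1) p q"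
proof -
  define g where "g = (\<lambda>z. (1 - fst z) *\<^sub>R \<sigma> (snd z) + fst z *\<^sub>R \<tau> (snd z))"
  have *: "continuous_on ({0..1} \<times> {0..1}) g"
    unfolding g_def
    by (intro continuous_intros continuous_on_compose2[OF \<sigma>(1)] continuous_on_compose2[OF \<tau>(1)]) auto
  have "g \<in> {0..1} \<times> {0..1} \<rightarrow> S"
    using S \<sigma>(2) \<tau>(2) by (auto simp: g_def Pi_iff convex_def)
  then have "continuous_map (cyl UI) (top_of_set S) g"
    using * by (simp add: continuous_map_in_subtopology flip: subtopology_Times)
  then have "continuous_map (cyl UI) X (\<lambda>z. u (g z))"
    by (rule continuous_map_composeI[OF u])
  then show ?thesis
    by (rule path_homI) (auto simp: g_def p q e simp flip: scaleR_left_distrib)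
qed

lemma path_hom_reparam:
  fixes \<sigma> \<tau> :: "real \<Rightarrow> real"
  assumes "joins X a b r"
    and "continuous_on {0..1} \<sigma>" "\<sigma> \<in> {0..1} \<rightarrow> {0..1}" "continuous_on {0..1} \<tau>" "\<tau> \<in> {0..1} \<rightarrow> {0..1}"
    and "\<sigma> 0 = \<tau> 0" "\<sigma> 1 = \<tau> 1"
    and "\<And>t. t \<in> {0..1} \<Longrightarrow> p t = r (\<sigma> t)" "\<And>t. t \<in> {0..1} \<Longrightarrow> q t = r (\<tau> t)"
  shows "path_hom X (p 0) (p 1) p q"
  by (rule path_hom_convex[of "{0..1}" X r \<sigma> \<tau>]) (use assms in \<open>auto simp: joins_def pathin_def\<close>)

lemma path_hom_const_left:
  assumes "joins X a b p" shows "path_hom X a b (loop_join (\<lambda>t. a) p) p"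
proof -
  have "loop_join (\<lambda>t. a) p t = p (max 0 (2*t - 1))" for t
    using assms by (cases "t \<le> 1/2") (simp_all add: loop_join_def joins_def max_absorb1 max_absorb2)
  then have "path_hom X (loop_join (\<lambda>t. a) p 0) (p 1) (loop_join (\<lambda>t. a) p) p"
    using path_hom_reparam[OF assms, where \<sigma> = "\<lambda>t. max 0 (2*t - 1)" and \<tau> = "\<lambda>t. t"
        and p = "loop_join (\<lambda>t. a) p" and q = p]
    by (force intro!: continuous_intros)
  then show ?thesis using assms by (simp add: loop_join_def joins_def)
qed

lemma path_hom_const_right:
  assumes "joins X a b p" shows "path_hom X a b (loop_join p (\<lambda>t. b)) p"
proof -
  have "loop_join p (\<lambda>t. b) t = p (min 1 (2*t))" for t
    using assms by (cases "t \<le> 1/2") (simp_all add: loop_join_def joins_def min_absorb1 min_absorb2)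
  then have "path_hom X (loop_join p (\<lambda>t. b) 0) (p 1) (loop_join p (\<lambda>t. b)) p"
    using path_hom_reparam[OF assms, where \<sigma> = "\<lambda>t. min 1 (2*t)" and \<tau> = "\<lambda>t. t"
        and p = "loop_join p (\<lambda>t. b)" and q = p]
    by (force intro!: continuous_intros)
  then show ?thesis using assms by (simp add: loop_join_def joins_def)
qed

text \<open>A path followed by its reverse is the path after the tent function, which contracts
  linearly to the constant 0.\<close>

lemma path_hom_inverse_right:
  assumes "joins X a b p" shows "path_hom X a a (loop_join p (rev_path p)) (\<lambda>t. a)"
proof -
  have "loop_join p (rev_path p) t = p (min (2*t) (2 - 2*t))" for t
    by (cases "t \<le> 1/2") (simp_all add: loop_join_def min_absorb1 min_absorb2)
  moreover have "min (2*t) (2 - 2*t) \<in> {0..1}" if "t \<in> {0..1}" for t :: real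
    using that by (auto simp: min_def)
  ultimately have "path_hom X (loop_join p (rev_path p) 0) a (loop_join p (rev_path p)) (\<lambda>t. a)"
    using path_hom_reparam[OF assms, where \<sigma> = "\<lambda>t. min (2*t) (2 - 2*t)" and \<tau> = "\<lambda>t. 0"
        and p = "loop_join p (rev_path p)" and q = "\<lambda>t. a"] assms
    by (force intro!: continuous_intros simp: joins_def)
  then show ?thesis using assms by (simp add: loop_join_def joins_def)
qed

lemma path_hom_inverse_left:
  assumes "joins X a b p" shows "path_hom X b b (loop_join (rev_path p) p) (\<lambda>t. b)"
  using path_hom_inverse_right[OF joins_rev[OF assms]] by simp

lemma path_hom_assoc:
  assumes "joins X a b p" "joins X b c q" "joins X c d r"
  shows "path_hom X a d (loop_join (loop_join p q) r) (loop_join p (loop_join q r))"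
proof -
  \<comment> \<open>The change of parameter has slopes 1/2, 1 and 2 with breaks at 1/2 and 3/4.
    Being convex, it is the maximum of its three linear pieces.\<close>
  define \<sigma> :: "real \<Rightarrow> real" where "\<sigma> t = max (max (t/2) (t - 1/4)) (2*t - 1)" for t
  let ?u = "loop_join (loop_join p q) r"
  have u: "joins X a d ?u" using assms by (meson joins_loop_join)
  have "loop_join p (loop_join q r) t = ?u (\<sigma> t)" for t
  proof -
    consider "t \<le> 1/2" | "1/2 < t" "t \<le> 3/4" | "3/4 < t" by linarith
    then show ?thesis
    proof cases
      case 1
      then have s: "\<sigma> t = t/2" by (simp add: \<sigma>_def)
      show ?thesis unfolding s using 1 by (simp add: loop_join_def)
    next
      case 2
      then have s: "\<sigma> t = t - 1/4" by (simp add: \<sigma>_def)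
      show ?thesis unfolding s using 2 by (simp add: loop_join_def algebra_simps)
    next
      case 3
      then have s: "\<sigma> t = 2*t - 1" by (simp add: \<sigma>_def)
      show ?thesis unfolding s using 3 by (simp add: loop_join_def)
    qed
  qed
  moreover have "\<sigma> t \<in> {0..1}" if "t \<in> {0..1}" for t
    using that by (simp add: \<sigma>_def max_def)
  moreover have "continuous_on {0..1} \<sigma>"
    unfolding \<sigma>_def by (intro continuous_intros) auto
  moreover have "\<sigma> 0 = 0" "\<sigma> 1 = 1" by (simp_all add: \<sigma>_def)
  ultimately have "path_hom X (?u 0) (?u 1) ?u (loop_join p (loop_join q r))"
    by (intro path_hom_reparam[OF u, where \<sigma> = "\<lambda>t. t" and \<tau> = \<sigma>]) auto
  then show ?thesis using u by (simp add: joins_def)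
qed

subsection \<open>The fundamental group\<close>

lemma loop_at_joins: "loop_at X x p \<longleftrightarrow> joins X x x p"
  by (simp add: loop_at_def joins_def)

lemma loop_class_mem: "q \<in> loop_class X x p \<longleftrightarrow> path_hom X x x p q"
  by (simp add: loop_class_def loop_homotopic_def path_hom_def)

lemma loop_class_eqI: "path_hom X x x p q \<Longrightarrow> loop_class X x p = loop_class X x q"
  by (auto simp: loop_class_mem) (metis path_hom_trans path_hom_sym)+

text \<open>The class of a map that is not a loop is empty; the second premise excludes this, and
  then \<open>q\<close> itself lies in the common class.\<close>

lemma loop_class_eqD:
  assumes "loop_class X x p = loop_class X x q" "joins X x x q"
  shows "path_hom X x x p q"
  using assms path_hom_refl[OF assms(2)] by (auto simp flip: loop_class_mem)

lemma carrier_fundamental_group: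
  "carrier (fundamental_group X x) = loop_class X x ` {p. joins X x x p}"
  by (simp add: fundamental_group_def loop_at_joins)

lemma loop_class_in_carrier: "joins X x x p \<Longrightarrow> loop_class X x p \<in> carrier (fundamental_group X x)"
  by (simp add: carrier_fundamental_group)

lemma one_fundamental_group: "\<one>\<^bsub>fundamental_group X x\<^esub> = loop_class X x (\<lambda>t. x)"
  by (simp add: fundamental_group_def)

text \<open>The product is a union over all representatives. It collapses to one class because
  concatenation respects homotopy and neither class is empty.\<close>

lemma mult_fundamental_group:
  assumes "joins X x x p" "joins X x x q"
  shows "loop_class X x p \<otimes>\<^bsub>fundamental_group X x\<^esub> loop_class X x q = loop_class X x (loop_join p q)"
proof -
  have "loop_class X x (loop_join p' q') = loop_class X x (loop_join p q)"
    if "p' \<in> loop_class X x p" "q' \<in> loop_class X x q" for p' q'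
    using that by (metis loop_class_eqI loop_class_mem path_hom_join)
  moreover have ne: "loop_class X x p \<noteq> {}" "loop_class X x q \<noteq> {}"
    using path_hom_refl[OF assms(1)] path_hom_refl[OF assms(2)] by (auto simp flip: loop_class_mem)
  ultimately have "(\<Union>p'\<in>loop_class X x p. \<Union>q'\<in>loop_class X x q. loop_class X x (loop_join p' q'))
      = (\<Union>p'\<in>loop_class X x p. \<Union>q'\<in>loop_class X x q. loop_class X x (loop_join p q))"
    by (intro SUP_cong refl)
  also have "\<dots> = loop_class X x (loop_join p q)"
    using ne by (auto simp only: UN_constant if_False empty_iff)
  finally show ?thesis
    by (simp add: fundamental_group_def)
qed

lemma group_fundamental_group:
  assumes x: "x \<in> topspace X"
  shows "group (fundamental_group X x)"
proof (rule groupI)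
  fix P Q R assume "P \<in> carrier (fundamental_group X x)" "Q \<in> carrier (fundamental_group X x)"
    "R \<in> carrier (fundamental_group X x)"
  then obtain p q r where p: "joins X x x p" "joins X x x q" "joins X x x r"
    and eq: "P = loop_class X x p" "Q = loop_class X x q" "R = loop_class X x r"
    by (auto simp: carrier_fundamental_group)
  show "P \<otimes>\<^bsub>fundamental_group X x\<^esub> Q \<otimes>\<^bsub>fundamental_group X x\<^esub> R = P \<otimes>\<^bsub>fundamental_group X x\<^esub> (Q \<otimes>\<^bsub>fundamental_group X x\<^esub> R)"
    using p by (simp add: eq mult_fundamental_group joins_loop_join[of X x x] loop_class_eqI[OF path_hom_assoc])
next
  fix P Q assume "P \<in> carrier (fundamental_group X x)" "Q \<in> carrier (fundamental_group X x)"
  then show "P \<otimes>\<^bsub>fundamental_group X x\<^esub> Q \<in> carrier (fundamental_group X x)"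
    by (auto simp: carrier_fundamental_group mult_fundamental_group intro!: imageI joins_loop_join)
next
  show "\<one>\<^bsub>fundamental_group X x\<^esub> \<in> carrier (fundamental_group X x)"
    using x by (simp add: one_fundamental_group loop_class_in_carrier joins_const)
next
  fix P assume "P \<in> carrier (fundamental_group X x)"
  then obtain p where p: "joins X x x p" "P = loop_class X x p"
    by (auto simp: carrier_fundamental_group)
  show "\<one>\<^bsub>fundamental_group X x\<^esub> \<otimes>\<^bsub>fundamental_group X x\<^esub> P = P"
    using p x by (simp add: one_fundamental_group mult_fundamental_group joins_const
        loop_class_eqI[OF path_hom_const_left])
  show "\<exists>Q\<in>carrier (fundamental_group X x). Q \<otimes>\<^bsub>fundamental_group X x\<^esub> P = \<one>\<^bsub>fundamental_group X x\<^esub>"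
    using p by (intro bexI[of _ "loop_class X x (rev_path p)"])
      (simp_all add: one_fundamental_group mult_fundamental_group joins_rev loop_class_in_carrier
        loop_class_eqI[OF path_hom_inverse_left])
qed

lemma inv_fundamental_group:
  assumes "joins X x x p"
  shows "inv\<^bsub>fundamental_group X x\<^esub> loop_class X x p = loop_class X x (rev_path p)"
proof -
  interpret group "fundamental_group X x"
    by (rule group_fundamental_group[OF joins_endpoints(1)[OF assms]])
  show ?thesis
    using assms by (intro inv_equality) (simp_all add: one_fundamental_group mult_fundamental_group joins_rev
        loop_class_in_carrier loop_class_eqI[OF path_hom_inverse_left])
qed

subsection \<open>Free groups\<close>

lemma reduced_word_push_letter: "reduced_word w \<Longrightarrow> reduced_word (push_letter x w)"
  by (cases w; cases "tl w") (auto simp: reduced_word_def)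

lemma push_letter_in_lists: "w \<in> lists A \<Longrightarrow> x \<in> A \<Longrightarrow> push_letter x w \<in> lists A"
  by (cases w) auto

lemma reduce_word_in_carrier:
  assumes "w \<in> lists (UNIV \<times> S)"
  shows "reduce_word w \<in> carrier (free_group S)"
proof -
  have "foldr push_letter w [] \<in> lists (UNIV \<times> S) \<and> reduced_word (foldr push_letter w [])"
    using assms
  proof (induction w)
    case Nil
    then show ?case by (simp add: reduced_word_def)
  next
    case (Cons x w)
    then show ?case by (simp add: reduced_word_push_letter push_letter_in_lists del: in_lists_conv_set)
  qed
  then show ?thesis by (simp add: free_group_def reduce_word_def)
qed

lemma (in group) word_value_closed:
  assumes "w \<in> lists (UNIV \<times> S)" "b \<in> S \<rightarrow> carrier G"
  shows "word_value G b w \<in> carrier G"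
  using assms by (induction w) (auto simp: word_value_def letter_value_def Pi_iff)

lemma (in group) word_value_push_letter:
  assumes "w \<in> lists (UNIV \<times> S)" "x \<in> UNIV \<times> S" "b \<in> S \<rightarrow> carrier G"
  shows "word_value G b (push_letter x w) = letter_value G b x \<otimes> word_value G b w"
proof (cases w)
  case (Cons y v)
  have v: "word_value G b v \<in> carrier G"
    using word_value_closed[of v S b] assms Cons by simp
  show ?thesis
  proof (cases "cancels x y")
    case True
    then obtain a s where xy: "x = (a, s)" "y = (\<not> a, s)"
      by (cases x; cases y) auto
    have s: "b s \<in> carrier G" using xy assms by auto
    have "letter_value G b x \<otimes> (letter_value G b y \<otimes> word_value G b v) = word_value G b v"
      using s v by (cases a) (simp_all add: xy letter_value_def flip: m_assoc)
    then show ?thesis using True Cons by (simp add: word_value_def)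
  qed (simp add: Cons word_value_def)
qed (simp add: word_value_def)

lemma (in group) word_value_reduce_append:
  assumes "u \<in> lists (UNIV \<times> S)" "v \<in> lists (UNIV \<times> S)" "b \<in> S \<rightarrow> carrier G"
  shows "word_value G b (reduce_word (u @ v)) = word_value G b u \<otimes> word_value G b v"
proof -
  have *: "word_value G b (reduce_word w) = word_value G b w" if "w \<in> lists (UNIV \<times> S)" for w
    using that
  proof (induction w)
    case (Cons x w)
    have "reduce_word w \<in> lists (UNIV \<times> S)"
      using reduce_word_in_carrier[of w S] Cons.hyps by (simp add: free_group_def)
    then have "word_value G b (push_letter x (reduce_word w)) = letter_value G b x \<otimes> word_value G b w"
      using word_value_push_letter[OF _ Cons.hyps(1) assms(3)] Cons.IH by simp
    then show ?case by (simp add: reduce_word_def word_value_def)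
  qed (simp add: reduce_word_def)
  have "word_value G b (u @ v) = word_value G b u \<otimes> word_value G b v"
    using assms(1)
  proof (induction u)
    case Nil
    then show ?case using word_value_closed[OF assms(2,3)] by (simp add: word_value_def)
  next
    case (Cons x u)
    have "letter_value G b x \<in> carrier G"
      using Cons.hyps assms(3) by (auto simp: letter_value_def Pi_iff)
    then show ?case
      using Cons.IH word_value_closed[OF assms(2,3)] word_value_closed[OF Cons.hyps(2) assms(3)]
      by (simp add: word_value_def m_assoc)
  qed
  then show ?thesis
    using *[of "u @ v"] assms(1,2) by (simp del: in_lists_conv_set)
qed

text \<open>The universal property: an element of \<open>G\<close> is read as its reduced word, and
  that word is evaluated in \<open>H\<close>. Products correspond to concatenated words up to
  reduction, which does not change values.\<close>

lemma free_group_on_hom: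
  assumes free: "free_group_on G S b" and H: "group H" and b': "b' \<in> S \<rightarrow> carrier H"
  obtains \<theta> where "\<theta> \<in> hom G H" "\<And>s. s \<in> S \<Longrightarrow> \<theta> (b s) = b' s"
proof
  interpret H: group H by (rule H)
  define F where "F = carrier (free_group S)"
  let ?i = "inv_into F (word_value G b)"
  have G: "group G" and b: "b \<in> S \<rightarrow> carrier G" and iso: "word_value G b \<in> iso (free_group S) G"
    using free by (auto simp: free_group_on_def)
  have inj: "inj_on (word_value G b) F" and img: "word_value G b ` F = carrier G"
    using iso by (auto simp: F_def iso_def bij_betw_def)
  have F: "F \<subseteq> lists (UNIV \<times> S)" by (auto simp: F_def free_group_def)
  have i: "?i x \<in> F" "word_value G b (?i x) = x" if "x \<in> carrier G" for x
    using that img by (auto intro: inv_into_into f_inv_into_f)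
  have mult: "?i (x \<otimes>\<^bsub>G\<^esub> y) = reduce_word (?i x @ ?i y)" if "x \<in> carrier G" "y \<in> carrier G" for x y
  proof -
    have l: "?i x \<in> lists (UNIV \<times> S)" "?i y \<in> lists (UNIV \<times> S)" using i F that by blast+
    then have "reduce_word (?i x @ ?i y) \<in> F"
      using reduce_word_in_carrier[of "?i x @ ?i y" S] by (simp add: F_def)
    moreover have "word_value G b (reduce_word (?i x @ ?i y)) = x \<otimes>\<^bsub>G\<^esub> y"
      using group.word_value_reduce_append[OF G l b] i that by simp
    ultimately show ?thesis using inj by (metis inv_into_f_f)
  qed
  show "(\<lambda>x. word_value H b' (?i x)) \<in> hom G H"
  proof (rule homI)
    fix x y assume xy: "x \<in> carrier G" "y \<in> carrier G"
    have l: "?i x \<in> lists (UNIV \<times> S)" "?i y \<in> lists (UNIV \<times> S)" using i F xy by blast+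
    show "word_value H b' (?i x) \<in> carrier H" using H.word_value_closed[OF l(1) b'] .
    show "word_value H b' (?i (x \<otimes>\<^bsub>G\<^esub> y)) = word_value H b' (?i x) \<otimes>\<^bsub>H\<^esub> word_value H b' (?i y)"
      using mult[OF xy] H.word_value_reduce_append[OF l b'] by simp
  qed
  fix s assume s: "s \<in> S"
  interpret G: group G by (rule G)
  have "b s \<in> carrier G" "b' s \<in> carrier H" using s b b' by auto
  then have v: "word_value G b [(True, s)] = b s" "word_value H b' [(True, s)] = b' s"
    by (simp_all add: word_value_def letter_value_def)
  moreover have "[(True, s)] \<in> F" using s by (simp add: F_def free_group_def reduced_word_def)
  ultimately have "?i (b s) = [(True, s)]" using inj by (metis inv_into_f_f)
  then show "word_value H b' (?i (b s)) = b' s" using v by simp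
qed

text \<open>Every element is the value of a word, so this is induction on words. It serves to check
  on generators that \<open>f\<close> undoes the homomorphism between the fundamental
  groups.\<close>

lemma free_group_on_induct [consumes 2, case_names one gen inv mult]:
  assumes free: "free_group_on G S b" and x: "x \<in> carrier G"
    and one: "R \<one>\<^bsub>G\<^esub>" and gen: "\<And>s. s \<in> S \<Longrightarrow> R (b s)"
    and inv: "\<And>x. x \<in> carrier G \<Longrightarrow> R x \<Longrightarrow> R (inv\<^bsub>G\<^esub> x)"
    and mult: "\<And>x y. x \<in> carrier G \<Longrightarrow> y \<in> carrier G \<Longrightarrow> R x \<Longrightarrow> R y \<Longrightarrow> R (x \<otimes>\<^bsub>G\<^esub> y)"
  shows "R x"
proof -
  have G: "group G" and b: "b \<in> S \<rightarrow> carrier G" and iso: "word_value G b \<in> iso (free_group S) G"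
    using free by (auto simp: free_group_on_def)
  interpret G: group G by (rule G)
  have "x \<in> word_value G b ` carrier (free_group S)"
    using iso x by (auto simp: iso_def bij_betw_def)
  then obtain w where w: "w \<in> lists (UNIV \<times> S)" "x = word_value G b w"
    by (auto simp: free_group_def)
  have "R (word_value G b w)" using w(1)
  proof (induction w)
    case (Cons y w)
    have "snd y \<in> S" using Cons.hyps by auto
    then have "letter_value G b y \<in> carrier G" "R (letter_value G b y)"
      using b gen inv by (auto simp: letter_value_def Pi_iff)
    then show ?case
      using Cons mult G.word_value_closed[OF Cons.hyps(2) b] by (simp add: word_value_def)
  qed (simp add: word_value_def one)
  then show ?thesis using w by simp
qed

subsection \<open>Squares\<close>

text \<open>Row 0 runs from \<open>(0, 0)\<close> along first coordinate 0 and then along second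
  coordinate 1 to \<open>(1, 1)\<close>; row 1 takes the other two sides. The rows in between
  interpolate linearly, so a map on the square becomes a homotopy between the two ways around its
  boundary.\<close>

definition square_map :: "real \<times> real \<Rightarrow> real \<times> real" where
  "square_map z = ((1 - fst z) * max 0 (2 * snd z - 1) + fst z * min 1 (2 * snd z),
     (1 - fst z) * min 1 (2 * snd z) + fst z * max 0 (2 * snd z - 1))"

lemma square_map_simps:
  "t \<in> {0..1} \<Longrightarrow> square_map (0, t/2) = (0, t)"
  "t \<in> {0..1} \<Longrightarrow> square_map (1, (1 + t)/2) = (1, t)"
  "t \<in> {0..1} \<Longrightarrow> square_map (1, t/2) = (t, 0)"
  "t \<in> {0..1} \<Longrightarrow> square_map (0, (1 + t)/2) = (t, 1)"
  "square_map (t, 0) = (0, 0)" "square_map (t, 1) = (1, 1)"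
  by (auto simp: square_map_def add_divide_distrib)

lemma continuous_map_square_map: "continuous_map (cyl UI) (cyl UI) square_map"
proof -
  have conv: "0 \<le> (1 - s) * a + s * b \<and> (1 - s) * a + s * b \<le> 1"
    if "s \<in> {0..1}" "a \<in> {0..1}" "b \<in> {0..1}" for s a b :: real
    using that by (auto intro!: add_nonneg_nonneg convex_bound_le)
  have "continuous_on ({0..1} \<times> {0..1}) square_map"
    unfolding square_map_def by (intro continuous_intros)
  moreover have "square_map z \<in> {0..1} \<times> {0..1}" if "z \<in> {0..1} \<times> {0..1}" for z
    unfolding square_map_def mem_Times_iff fst_conv snd_conv
    using conv[of "fst z" "max 0 (2 * snd z - 1)" "min 1 (2 * snd z)"]
      conv[of "fst z" "min 1 (2 * snd z)" "max 0 (2 * snd z - 1)"] that by (auto simp: mem_Times_iff)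
  ultimately show ?thesis
    by (simp add: continuous_map_in_subtopology Pi_iff flip: subtopology_Times)
qed

lemma square_imp_path_hom:
  assumes "continuous_map (cyl UI) X H"
  shows "path_hom X (H (0, 0)) (H (1, 1)) (loop_join (\<lambda>t. H (0, t)) (\<lambda>s. H (s, 1)))
           (loop_join (\<lambda>s. H (s, 0)) (\<lambda>t. H (1, t)))"
proof (rule path_homI)
  show "continuous_map (cyl UI) X (\<lambda>z. H (square_map z))"
    by (rule continuous_map_composeI[OF assms continuous_map_square_map])
  fix t :: real assume t: "t \<in> {0..1}"
  show "H (square_map (0, t)) = loop_join (\<lambda>t. H (0, t)) (\<lambda>s. H (s, 1)) t"
    using t square_map_simps(1)[of "2*t"] square_map_simps(4)[of "2*t - 1"] by (auto simp: loop_join_def)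
  show "H (square_map (1, t)) = loop_join (\<lambda>s. H (s, 0)) (\<lambda>t. H (1, t)) t"
    using t square_map_simps(3)[of "2*t"] square_map_simps(2)[of "2*t - 1"] by (auto simp: loop_join_def)
qed (simp_all add: square_map_simps)

lemma square_map_surj: "square_map ` ({0..1} \<times> {0..1}) = {0..1} \<times> {0..1}"
proof (intro equalityI subsetI)
  fix z assume "z \<in> square_map ` ({0..1} \<times> {0..1})"
  then show "z \<in> {0..1} \<times> {0..1}"
    using continuous_map_image_subset_topspace[OF continuous_map_square_map] by auto
next
  fix z :: "real \<times> real" assume "z \<in> {0..1} \<times> {0..1}"
  then obtain s t where z: "z = (s, t)" "0 \<le> s" "s \<le> 1" "0 \<le> t" "t \<le> 1" by auto
  \<comment> \<open>All rows cross the antidiagonal through \<open>z\<close> at time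
    \<open>(s + t)/2\<close>; \<open>m\<close> and \<open>M\<close> are the extreme first
    coordinates on it, and \<open>l\<close> is the relative position of \<open>z\<close>. At a
    corner the two coincide and \<open>l\<close> defaults to 0.\<close>
  define m M where "m = max 0 (s + t - 1)" and "M = min 1 (s + t)"
  have mM: "m \<le> s" "s \<le> M" "m + M = s + t" using z by (auto simp: m_def M_def)
  define l where "l = (if M = m then 0 else (s - m) / (M - m))"
  have l: "0 \<le> l" "l \<le> 1" using mM by (auto simp: l_def divide_simps)
  have "l * (M - m) = s - m" using mM by (auto simp: l_def)
  then have "(1 - l) * m + l * M = s" "(1 - l) * M + l * m = t" using mM by (auto simp: algebra_simps)
  then have "square_map (l, (s + t)/2) = z"
    unfolding square_map_def z m_def M_def fst_conv snd_conv mult_2 field_sum_of_halves by simp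
  then show "z \<in> square_map ` ({0..1} \<times> {0..1})"
    using z l by (intro image_eqI[of _ _ "(l, (s + t)/2)"]) auto
qed

text \<open>The two coordinates add up to twice the time, which recovers \<open>m\<close>. On the
  antidiagonal reached then, the position determines \<open>l\<close> unless the antidiagonal has
  shrunk to a corner.\<close>

lemma square_map_eq:
  assumes "square_map (l, m) = square_map (l', m')" "0 \<le> m" "m \<le> 1"
  shows "m' = m \<and> (l' = l \<or> m = 0 \<or> m = 1)"
proof -
  have e: "(1 - l) * max 0 (2*m - 1) + l * min 1 (2*m) = (1 - l') * max 0 (2*m' - 1) + l' * min 1 (2*m')"
    "(1 - l) * min 1 (2*m) + l * max 0 (2*m - 1) = (1 - l') * min 1 (2*m') + l' * max 0 (2*m' - 1)"
    using assms(1) by (simp_all add: square_map_def)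
  have s: "max 0 (2*m - 1) + min 1 (2*m) = 2 * m" for m :: real by (auto simp: max_def min_def)
  have "2 * m = 2 * m'"
    using e s[of m] s[of m'] by (simp add: algebra_simps)
  then have m: "m' = m" by simp
  have "(l - l') * (min 1 (2*m) - max 0 (2*m - 1)) = 0"
    using e(1) unfolding m by (simp add: algebra_simps)
  moreover have "min 1 (2*m) - max 0 (2*m - 1) \<noteq> 0" if "m \<noteq> 0" "m \<noteq> 1"
    using that assms(2,3) by (auto simp: max_def min_def)
  ultimately show ?thesis using m by auto
qed

text \<open>A homotopy rel endpoints between the two ways around the boundary of the square fills it,
  because \<open>square_map\<close> is a quotient map collapsing two sides.\<close>

lemma square_fill:
  assumes "path_hom X a d (loop_join p r) (loop_join l q)"
    and p: "joins X a b p" and r: "joins X b d r" and l: "joins X a c l" and q: "joins X c d q"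
  obtains H where "continuous_map (cyl UI) X H"
    "\<And>t. t \<in> {0..1} \<Longrightarrow> H (0, t) = p t" "\<And>t. t \<in> {0..1} \<Longrightarrow> H (1, t) = q t"
    "\<And>s. s \<in> {0..1} \<Longrightarrow> H (s, 0) = l s" "\<And>s. s \<in> {0..1} \<Longrightarrow> H (s, 1) = r s"
proof -
  obtain K where K: "continuous_map (cyl UI) X K"
    "\<And>t. K (0, t) = loop_join p r t" "\<And>t. K (1, t) = loop_join l q t"
    "\<And>s. s \<in> {0..1} \<Longrightarrow> K (s, 0) = a" "\<And>s. s \<in> {0..1} \<Longrightarrow> K (s, 1) = d"
    using path_homE[OF assms(1)] by metis
  have "compact_space UI" "Hausdorff_space UI"
    by (simp_all add: compact_space_subtopology Hausdorff_space_subtopology)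
  then have comp: "compact_space (cyl UI)" "Hausdorff_space (cyl UI)"
    by (metis compact_space_prod_topology) (metis Hausdorff_space_prod_topology \<open>Hausdorff_space UI\<close>)
  have gen: "generated_by (cyl UI) {()} (\<lambda>_. cyl UI) (\<lambda>_. square_map)"
    using square_map_surj by (intro generated_by_quotient continuous_map_square_map comp) simp
  obtain H where H: "continuous_map (cyl UI) X H" "\<And>z. z \<in> {0..1} \<times> {0..1} \<Longrightarrow> H (square_map z) = K z"
  proof (rule generated_by_glue[OF gen, where u = "\<lambda>_. K" and Z = X])
    fix y z :: "real \<times> real" assume yz: "y \<in> topspace (cyl UI)" "z \<in> topspace (cyl UI)" "square_map y = square_map z"
    obtain s t s' t' where e: "y = (s, t)" "z = (s', t')" by fastforce
    show "K y = K z"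
      using square_map_eq[of s t s' t'] yz K(4,5) by (auto simp: e)
  qed (use K(1) in auto)
  show ?thesis
  proof
    show "continuous_map (cyl UI) X H" by fact
    fix t :: real assume t: "t \<in> {0..1}"
    show "H (0, t) = p t"
      using H(2)[of "(0, t/2)"] t K by (auto simp: square_map_simps loop_join_def)
    show "H (t, 0) = l t"
      using H(2)[of "(1, t/2)"] t K by (auto simp: square_map_simps loop_join_def)
    \<comment> \<open>At \<open>t = 0\<close> the argument is the seam, where
      \<open>loop_join\<close> still takes its value from the first path.\<close>
    have half: "loop_join f g ((1 + t) / 2) = g t" if "f 1 = g 0" for f g :: "real \<Rightarrow> 'a"
    proof (cases "t = 0")
      case False
      have "2 * ((1 + t) / 2) - 1 = t" by argo
      then show ?thesis using False t unfolding loop_join_def by simp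
    qed (use that in \<open>simp add: loop_join_def\<close>)
    have m: "(1 + t) / 2 \<in> {0..1}" using t by simp
    show "H (1, t) = q t"
      using H(2)[of "(1, (1 + t)/2)"] half[of l q] m l q
      by (simp only: square_map_simps(2)[OF t] K(3)) (simp add: joins_def)
    show "H (t, 1) = r t"
      using H(2)[of "(0, (1 + t)/2)"] half[of p r] m p r
      by (simp only: square_map_simps(4)[OF t] K(2)) (simp add: joins_def)
  qed
qed

subsection \<open>Disks\<close>

abbreviation dnorm :: "nat \<Rightarrow> (nat \<Rightarrow> real) \<Rightarrow> real" where "dnorm n y \<equiv> L2_set y {..<n}"

lemma dnorm_le_1: "(\<Sum>i<n. (y i)\<^sup>2) \<le> 1 \<longleftrightarrow> dnorm n y \<le> 1"
  by (simp add: L2_set_def)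

lemma topspace_disk: "topspace (disk n) = {y. (\<forall>i\<ge>n. y i = 0) \<and> dnorm n y \<le> 1}"
  by (auto simp: disk_def topspace_Euclidean_space dnorm_le_1)

lemma open_disk_eq: "open_disk n = {y. (\<forall>i\<ge>n. y i = 0) \<and> dnorm n y < 1}"
  by (auto simp: open_disk_def topspace_Euclidean_space L2_set_def)

lemma boundary_sphere_eq: "boundary_sphere n = {y. (\<forall>i\<ge>n. y i = 0) \<and> dnorm n y = 1}"
  by (auto simp: boundary_sphere_def topspace_Euclidean_space L2_set_def)

lemma topspace_disk_Un: "topspace (disk n) = open_disk n \<union> boundary_sphere n"
  by (auto simp: topspace_disk open_disk_eq boundary_sphere_eq)

lemma disk_0: "topspace (disk 0) = {\<lambda>i. 0}" "open_disk 0 = {\<lambda>i. 0}" "boundary_sphere 0 = {}"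
  by (auto simp: topspace_disk open_disk_eq boundary_sphere_eq)

lemma dnorm_scale: "dnorm n (\<lambda>i. c * y i) = \<bar>c\<bar> * dnorm n y"
  using L2_set_right_distrib[of "\<bar>c\<bar>" y "{..<n}"] by (simp add: L2_set_def power_mult_distrib)

lemma dnorm_divide: "dnorm n (\<lambda>i. y i / c) = dnorm n y / \<bar>c\<bar>"
  using dnorm_scale[where c = "1/c"] by simp

lemma continuous_map_into_disk:
  assumes "\<And>i. continuous_map X euclideanreal (\<lambda>x. f x i)"
    and "\<And>x. x \<in> topspace X \<Longrightarrow> f x \<in> topspace (disk n)"
  shows "continuous_map X (disk n) f"
proof -
  have "continuous_map X (powertop_real UNIV) f"
    using assms(1) by (simp add: continuous_map_componentwise_UNIV)
  then show ?thesis
    using assms(2) unfolding disk_def Euclidean_space_def subtopology_subtopology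
    by (auto simp: continuous_map_in_subtopology)
qed

lemma continuous_map_disk_coord: "continuous_map (disk n) euclideanreal (\<lambda>y. y i)"
  unfolding disk_def Euclidean_space_def
  by (intro continuous_map_from_subtopology continuous_map_product_projection) simp

lemma continuous_map_coord:
  assumes "continuous_map X (disk n) f" shows "continuous_map X euclideanreal (\<lambda>x. f x i)"
  by (rule continuous_map_composeI[OF continuous_map_disk_coord assms])

lemma continuous_map_dnorm:
  assumes "continuous_map X (disk n) f" shows "continuous_map X euclideanreal (\<lambda>x. dnorm n (f x))"
  unfolding L2_set_def
  by (intro continuous_intros continuous_map_coord[OF assms]) auto

lemma Hausdorff_disk: "Hausdorff_space (disk n)"
  unfolding disk_def by (intro Hausdorff_space_subtopology Hausdorff_Euclidean_space)

lemma compact_disk: "compact_space (disk n)"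
proof -
  let ?K = "PiE UNIV (\<lambda>i::nat. {-1..1::real})"
  have "topspace (disk n) \<subseteq> ?K"
  proof
    fix y assume y: "y \<in> topspace (disk n)"
    have "\<bar>y i\<bar> \<le> 1" for i
    proof (cases "i < n")
      case True
      then have "\<bar>y i\<bar> \<le> dnorm n (\<lambda>i. \<bar>y i\<bar>)" by (intro member_le_L2_set) auto
      moreover have "dnorm n (\<lambda>i. \<bar>y i\<bar>) = dnorm n y" by (simp add: L2_set_def)
      ultimately show ?thesis using y by (simp add: topspace_disk)
    qed (use y in \<open>simp add: topspace_disk\<close>)
    then show "y \<in> ?K" by (auto simp: abs_le_iff minus_le_iff)
  qed
  moreover have "compactin (powertop_real UNIV) ?K"
    by (simp add: compactin_PiE)
  moreover have "closedin (powertop_real UNIV) (topspace (disk n))"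
  proof -
    have "topspace (disk n) = topspace (Euclidean_space n) \<inter>
        {y \<in> topspace (powertop_real UNIV). (\<Sum>i<n. (y i)\<^sup>2) \<in> {..1}}"
      by (auto simp: disk_def)
    moreover have "closedin (powertop_real UNIV) {y \<in> topspace (powertop_real UNIV). (\<Sum>i<n. (y i)\<^sup>2) \<in> {..1}}"
      by (rule closedin_continuous_map_preimage[of _ euclideanreal]) (auto intro!: continuous_intros)
    ultimately show ?thesis
      by (simp only: closedin_Int closedin_Euclidean_space)
  qed
  ultimately have "compactin (powertop_real UNIV) (topspace (disk n))"
    by (metis closed_compactin)
  moreover have "disk n = subtopology (powertop_real UNIV) (topspace (disk n))"
    by (simp add: disk_def Euclidean_space_def subtopology_subtopology)
  ultimately show ?thesis
    by (metis compact_space_subtopology)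
qed

lemma disk_convex:
  assumes "y \<in> topspace (disk n)" "z \<in> topspace (disk n)" "s \<in> {0..1}"
  shows "(\<lambda>i. (1 - s) * y i + s * z i) \<in> topspace (disk n)"
proof -
  have "dnorm n (\<lambda>i. (1 - s) * y i + s * z i) \<le> (1 - s) * dnorm n y + s * dnorm n z"
    using L2_set_triangle_ineq[of "\<lambda>i. (1 - s) * y i" "\<lambda>i. s * z i" "{..<n}"] assms(3)
    by (simp add: dnorm_scale)
  also have "\<dots> \<le> 1"
    using assms by (intro convex_bound_le) (auto simp: topspace_disk)
  finally show ?thesis using assms by (simp add: topspace_disk)
qed

text \<open>Straight-line homotopy again, but coordinatewise, since points of disks are functions.
  It makes any two paths in a disk with common ends interchangeable, whatever the characteristic map
  does to the boundary.\<close>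

lemma disk_path_hom:
  assumes \<phi>: "continuous_map (disk n) X \<phi>"
    and \<sigma>: "continuous_map UI (disk n) \<sigma>" and \<tau>: "continuous_map UI (disk n) \<tau>"
    and e: "\<sigma> 0 = \<tau> 0" "\<sigma> 1 = \<tau> 1"
  shows "path_hom X (\<phi> (\<sigma> 0)) (\<phi> (\<sigma> 1)) (\<lambda>t. \<phi> (\<sigma> t)) (\<lambda>t. \<phi> (\<tau> t))"
proof -
  let ?g = "\<lambda>z i. (1 - fst z) * \<sigma> (snd z) i + fst z * \<tau> (snd z) i"
  have c: "continuous_map (cyl UI) (disk n) (\<lambda>z. \<sigma> (snd z))" "continuous_map (cyl UI) (disk n) (\<lambda>z. \<tau> (snd z))"
    by (rule continuous_map_composeI[OF \<sigma> continuous_map_snd], rule continuous_map_composeI[OF \<tau> continuous_map_snd])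
  have "continuous_map (cyl UI) (disk n) ?g"
  proof (rule continuous_map_into_disk)
    show "continuous_map (cyl UI) euclideanreal (\<lambda>z. ?g z i)" for i
      by (intro continuous_intros c[THEN continuous_map_coord])
    fix z assume z: "z \<in> topspace (cyl UI)"
    then have "\<sigma> (snd z) \<in> topspace (disk n)" "\<tau> (snd z) \<in> topspace (disk n)" "fst z \<in> {0..1}"
      using \<sigma> \<tau> by (auto simp: continuous_map_def Pi_iff)
    then show "?g z \<in> topspace (disk n)" by (rule disk_convex)
  qed
  then have "continuous_map (cyl UI) X (\<lambda>z. \<phi> (?g z))"
    by (rule continuous_map_composeI[OF \<phi>])
  then show ?thesis
    by (rule path_homI) (simp_all add: e flip: distrib_right)
qed

text \<open>Radial projection of the cylinder over the disk from the point at height 2 on its axis.\<close>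

definition disk_retract :: "nat \<Rightarrow> real \<times> (nat \<Rightarrow> real) \<Rightarrow> real \<times> (nat \<Rightarrow> real)" where
  "disk_retract n z = (let c = max (dnorm n (snd z)) ((2 - fst z) / 2)
     in (2 - (2 - fst z) / c, \<lambda>i. snd z i / c))"

lemma disk_retract_cases:
  assumes "t \<in> {0..1}" "y \<in> topspace (disk n)"
  shows "fst (disk_retract n (t, y)) \<in> {0..1}" "snd (disk_retract n (t, y)) \<in> topspace (disk n)"
    "fst (disk_retract n (t, y)) = 0 \<or> snd (disk_retract n (t, y)) \<in> boundary_sphere n"
proof -
  \<comment> \<open>The ray from the centre of projection through \<open>(t, y)\<close> is scaled by
    \<open>1 / c\<close>. It meets the wall for \<open>c = dnorm n y\<close> and the base for
    \<open>c = (2 - t) / 2\<close>, and the first hit belongs to the larger value. That value is at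
    least 1/2, so the division is harmless.\<close>
  define c where "c = max (dnorm n y) ((2 - t) / 2)"
  have c: "c \<le> 1" "1/2 \<le> c" "dnorm n y \<le> c" "(2 - t) / 2 \<le> c" "c = dnorm n y \<or> c = (2 - t)/2"
    using assms by (auto simp: c_def topspace_disk max_def)
  have f: "fst (disk_retract n (t, y)) = 2 - (2 - t) / c" and s: "snd (disk_retract n (t, y)) = (\<lambda>i. y i / c)"
    by (simp_all add: disk_retract_def c_def Let_def)
  have "(2 - t) / c \<le> 2" using c by (simp add: divide_simps)
  moreover have "1 \<le> (2 - t) / c" using c assms by (simp add: divide_simps)
  ultimately show "fst (disk_retract n (t, y)) \<in> {0..1}" by (simp add: f)
  show "snd (disk_retract n (t, y)) \<in> topspace (disk n)"
    using assms c by (auto simp: s topspace_disk dnorm_divide divide_simps)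
  show "fst (disk_retract n (t, y)) = 0 \<or> snd (disk_retract n (t, y)) \<in> boundary_sphere n"
    using c(5)
  proof
    assume "c = dnorm n y"
    then show ?thesis using assms c by (auto simp: s boundary_sphere_eq topspace_disk dnorm_divide)
  next
    assume "c = (2 - t)/2"
    then have "2 - t = 2 * c" by simp
    then show ?thesis using c(2) by (simp add: f)
  qed
qed

lemma disk_retract_0: "y \<in> topspace (disk n) \<Longrightarrow> disk_retract n (0, y) = (0, y)"
  by (simp add: disk_retract_def topspace_disk max_absorb2)

lemma disk_retract_boundary: "t \<in> {0..1} \<Longrightarrow> y \<in> boundary_sphere n \<Longrightarrow> disk_retract n (t, y) = (t, y)"
  by (simp add: disk_retract_def boundary_sphere_eq max_absorb1)

lemma continuous_map_disk_retract: "continuous_map (cyl (disk n)) (cyl (disk n)) (disk_retract n)"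
proof -
  have sn: "continuous_map (cyl (disk n)) (disk n) (\<lambda>z. snd z)" by (rule continuous_map_snd)
  have f: "continuous_map (cyl (disk n)) euclideanreal (\<lambda>z. fst z)" by (rule continuous_map_fst_cyl)
  define c where "c z = max (dnorm n (snd z)) ((2 - fst z) / 2)" for z :: "real \<times> (nat \<Rightarrow> real)"
  have c: "continuous_map (cyl (disk n)) euclideanreal c"
    unfolding c_def by (intro continuous_intros continuous_map_dnorm[OF sn] f) auto
  have c0: "c z \<noteq> 0" if "z \<in> topspace (cyl (disk n))" for z
    using that by (auto simp: c_def max_def)
  have "continuous_map (cyl (disk n)) (cyl (disk n)) (\<lambda>z. (2 - (2 - fst z) / c z, \<lambda>i. snd z i / c z))"
  proof (intro continuous_map_cyl continuous_map_into_disk)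
    fix z assume z: "z \<in> topspace (cyl (disk n))"
    then have "fst z \<in> {0..1}" "snd z \<in> topspace (disk n)" by auto
    from disk_retract_cases[OF this]
    show "0 \<le> 2 - (2 - fst z) / c z \<and> 2 - (2 - fst z) / c z \<le> 1" "(\<lambda>i. snd z i / c z) \<in> topspace (disk n)"
      by (simp_all add: disk_retract_def Let_def c_def)
  qed (intro continuous_intros c0 c f continuous_map_coord[OF sn]; assumption)+
  moreover have "disk_retract n = (\<lambda>z. (2 - (2 - fst z) / c z, \<lambda>i. snd z i / c z))"
    by (simp add: fun_eq_iff disk_retract_def Let_def c_def)
  ultimately show ?thesis by simp
qed

text \<open>A normalised chord joins its ends unless it passes through the centre, that is, unless
  they are antipodal. Antipodal points are joined through one of the first two unit vectors, chosen
  different from both; this is where dimension 2 enters.\<close>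

lemma boundary_sphere_path:
  assumes n: "n \<ge> 2" and u: "u \<in> boundary_sphere n" and v: "v \<in> boundary_sphere n"
  obtains g where "continuous_map UI (disk n) g" "g ` {0..1} \<subseteq> boundary_sphere n" "g 0 = u" "g 1 = v"
proof -
  let ?T = "subtopology (disk n) (boundary_sphere n)"
  have *: "\<exists>g. joins ?T a b g"
    if a: "a \<in> boundary_sphere n" and b: "b \<in> boundary_sphere n" and ne: "b \<noteq> (\<lambda>i. - a i)" for a b :: "nat \<Rightarrow> real"
  proof -
    define w where "w t = (\<lambda>i. (1 - t) * a i + t * b i)" for t :: real
    have w: "dnorm n (w t) \<noteq> 0" if t: "t \<in> {0..1}" for t
    proof
      assume "dnorm n (w t) = 0"
      then have 0: "(1 - t) * a i = - (t * b i)" for i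
        using a b by (cases "i < n") (auto simp: L2_set_eq_0_iff w_def boundary_sphere_eq add_eq_0_iff2)
      then have "dnorm n (\<lambda>i. (1 - t) * a i) = dnorm n (\<lambda>i. (- t) * b i)" by simp
      \<comment> \<open>Both ends have norm 1, so the weights \<open>1 - t\<close> and
        \<open>t\<close> must be equal.\<close>
      then have th: "t = 1/2" using a b t unfolding dnorm_scale by (simp add: boundary_sphere_eq)
      have "b i = - a i" for i using 0[of i] unfolding th by simp
      then have "b = (\<lambda>i. - a i)" by (simp add: fun_eq_iff)
      with ne show False ..
    qed
    have cw: "continuous_map UI euclideanreal (\<lambda>t. w t i)" for i
      unfolding w_def by (intro continuous_intros) auto
    have "(\<lambda>i. w t i / dnorm n (w t)) \<in> boundary_sphere n" if "t \<in> {0..1}" for t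
      using a b w[OF that] by (auto simp: boundary_sphere_eq dnorm_divide w_def)
    moreover have "continuous_map UI (disk n) (\<lambda>t i. w t i / dnorm n (w t))"
      using calculation w unfolding L2_set_def
      by (intro continuous_map_into_disk continuous_intros cw) (auto simp: topspace_disk_Un)
    ultimately have "joins ?T a b (\<lambda>t i. w t i / dnorm n (w t))"
      using a b by (auto simp: joins_def pathin_def continuous_map_in_subtopology w_def boundary_sphere_eq)
    then show "\<exists>g. joins ?T a b g" by blast
  qed
  have "\<exists>g. joins ?T u v g"
  proof (cases "v = (\<lambda>i. - u i)")
    case False
    then show ?thesis using * u v by blast
  next
    case True
    define e :: "nat \<Rightarrow> nat \<Rightarrow> real" where "e k = (\<lambda>i. if i = k then 1 else 0)" for k
    have e: "e k \<in> boundary_sphere n" if "k < n" for k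
    proof -
      have "(\<Sum>i<n. (e k i)\<^sup>2) = (\<Sum>i<n. if i = k then 1 else 0)"
        by (rule sum.cong) (auto simp: e_def)
      then show ?thesis using that by (auto simp: boundary_sphere_eq L2_set_def e_def)
    qed
    obtain k where k: "k < n" "e k \<noteq> (\<lambda>i. - u i)" "v \<noteq> (\<lambda>i. - e k i)"
    proof (cases "u 0 = 0")
      case True
      then have "e 0 0 \<noteq> - u 0" "v 0 \<noteq> - e 0 0" using \<open>v = _\<close> by (simp_all add: e_def)
      then show ?thesis using that[of 0] n by fastforce
    next
      case False
      then have "e 1 0 \<noteq> - u 0" "v 0 \<noteq> - e 1 0" using \<open>v = _\<close> by (simp_all add: e_def)
      then show ?thesis using that[of 1] n by fastforce
    qed
    then obtain g h where gh: "joins ?T u (e k) g" "joins ?T (e k) v h"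
      using *[OF u e] *[OF e v] by blast
    show ?thesis using joins_loop_join[OF gh] by (rule exI[of "joins ?T u v"])
  qed
  then obtain g where g: "joins ?T u v g" ..
  then show ?thesis
    by (intro that[of g]) (auto simp: joins_def pathin_def continuous_map_in_subtopology Pi_iff)
qed

subsection \<open>CW-complexes\<close>

locale cw_complex_space =
  fixes X :: "('a, 'c) cw"
  assumes cw: "cw_complex X"
begin

abbreviation "T \<equiv> cw_space X"
abbreviation "C \<equiv> cw_cells X"
abbreviation "dm \<equiv> cw_dim X"
abbreviation "\<phi> \<equiv> cw_char X"
abbreviation "D e \<equiv> disk (dm e)"

lemma Hausdorff: "Hausdorff_space T"
  using cw by (simp add: cw_complex_def)

lemma continuous_char: "e \<in> C \<Longrightarrow> continuous_map (D e) T (\<phi> e)"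
  using cw by (simp add: cw_complex_def)

lemma embedding_char: "e \<in> C \<Longrightarrow> embedding_map (subtopology (D e) (open_disk (dm e))) T (\<phi> e)"
  using cw by (simp add: cw_complex_def)

lemma char_inj:
  assumes "e \<in> C" "y \<in> open_disk (dm e)" "z \<in> open_disk (dm e)" "\<phi> e y = \<phi> e z"
  shows "y = z"
proof -
  have "inj_on (\<phi> e) (topspace (subtopology (D e) (open_disk (dm e))))"
    using embedding_char[OF assms(1)] by (simp add: embedding_map_def homeomorphic_eq_everything_map)
  moreover have "open_disk (dm e) \<subseteq> topspace (D e)" by (auto simp: topspace_disk_Un)
  ultimately show ?thesis
    using assms(2-4) by (auto simp: inj_on_def)
qed

lemma open_cell_disjoint:
  "e \<in> C \<Longrightarrow> f \<in> C \<Longrightarrow> x \<in> open_cell X e \<Longrightarrow> x \<in> open_cell X f \<Longrightarrow> e = f"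
  using cw unfolding cw_complex_def disjoint_family_on_def by blast

lemma char_eqD:
  assumes "e \<in> C" "f \<in> C" "y \<in> open_disk (dm e)" "z \<in> open_disk (dm f)" "\<phi> e y = \<phi> f z"
  shows "e = f \<and> y = z"
proof -
  have "\<phi> e y \<in> open_cell X e" using assms(3) by (auto simp: open_cell_def)
  moreover have "\<phi> e y \<in> open_cell X f" unfolding assms(5) using assms(4) by (auto simp: open_cell_def)
  ultimately have "e = f" using open_cell_disjoint assms(1,2) by blast
  then show ?thesis using char_inj assms by blast
qed

lemma topspace_cells: "topspace T = (\<Union>e\<in>C. open_cell X e)"
  using cw by (simp add: cw_complex_def)

lemma boundary_finite:
  assumes "e \<in> C"
  obtains F where "finite F" "F \<subseteq> {f \<in> C. dm f < dm e}"
    "\<phi> e ` boundary_sphere (dm e) \<subseteq> (\<Union>f\<in>F. open_cell X f)"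
proof -
  have "\<exists>F. finite F \<and> F \<subseteq> {f \<in> C. dm f < dm e} \<and>
        \<phi> e ` boundary_sphere (dm e) \<subseteq> (\<Union>f\<in>F. open_cell X f)"
    using cw assms unfolding cw_complex_def by blast
  then show ?thesis using that by blast
qed

lemma weak_topology:
  "S \<subseteq> topspace T \<Longrightarrow> (\<And>e. e \<in> C \<Longrightarrow> closedin T (S \<inter> closed_cell X e)) \<Longrightarrow> closedin T S"
  using cw unfolding cw_complex_def by blast

lemma closed_cell_Un: "closed_cell X e = open_cell X e \<union> \<phi> e ` boundary_sphere (dm e)"
  by (simp add: closed_cell_def open_cell_def topspace_disk_Un image_Un)

lemma compactin_char_image: "e \<in> C \<Longrightarrow> closedin (D e) S \<Longrightarrow> compactin T (\<phi> e ` S)"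
  using image_compactin[OF closedin_compact_space[OF compact_disk] continuous_char] .

lemma compactin_closed_cell: "e \<in> C \<Longrightarrow> compactin T (closed_cell X e)"
  unfolding closed_cell_def by (intro compactin_char_image) auto

lemma closedin_closed_cell: "e \<in> C \<Longrightarrow> closedin T (closed_cell X e)"
  by (intro compactin_imp_closedin Hausdorff compactin_closed_cell)

lemma closed_cell_finite:
  assumes "e \<in> C"
  obtains F where "finite F" "F \<subseteq> C" "closed_cell X e \<subseteq> (\<Union>f\<in>F. open_cell X f)"
proof -
  obtain F where F: "finite F" "F \<subseteq> {f \<in> C. dm f < dm e}"
    "\<phi> e ` boundary_sphere (dm e) \<subseteq> (\<Union>f\<in>F. open_cell X f)"
    by (rule boundary_finite[OF assms])
  show ?thesis
    by (rule that[of "insert e F"]) (use F assms closed_cell_Un in auto)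
qed

subsubsection \<open>Unions of cells\<close>

definition cells_union :: "'c set \<Rightarrow> 'a set" where
  "cells_union B = (\<Union>e\<in>B. open_cell X e)"

text \<open>The sets of cells that carry a subcomplex. Working with sets of cells rather than
  subspaces lets skeleta, unions and the removal of a cell be treated combinatorially.\<close>

definition cell_closed :: "'c set \<Rightarrow> bool" where
  "cell_closed B \<longleftrightarrow> B \<subseteq> C \<and> (\<forall>e\<in>B. closed_cell X e \<subseteq> cells_union B)"

abbreviation "TB B \<equiv> subtopology T (cells_union B)"

lemma cells_unionI: "e \<in> B \<Longrightarrow> y \<in> open_disk (dm e) \<Longrightarrow> \<phi> e y \<in> cells_union B"
  by (auto simp: cells_union_def open_cell_def)

lemma cells_unionE:
  assumes "x \<in> cells_union B"
  obtains e y where "e \<in> B" "y \<in> open_disk (dm e)" "x = \<phi> e y"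
  using assms by (auto simp: cells_union_def open_cell_def)

lemma cell_closed_subset: "cell_closed B \<Longrightarrow> B \<subseteq> C"
  by (simp add: cell_closed_def)

lemma cells_union_subset: "B \<subseteq> C \<Longrightarrow> cells_union B \<subseteq> topspace T"
  by (auto simp: cells_union_def topspace_cells)

lemma topspace_TB: "B \<subseteq> C \<Longrightarrow> topspace (TB B) = cells_union B"
  using cells_union_subset by (simp add: inf.absorb2)

lemma cells_union_mem:
  assumes "B \<subseteq> C" "e \<in> C" "y \<in> open_disk (dm e)" "\<phi> e y \<in> cells_union B"
  shows "e \<in> B"
  using assms char_eqD by (metis cells_unionE subsetD)

lemma char_in_cells_union: "cell_closed B \<Longrightarrow> e \<in> B \<Longrightarrow> y \<in> topspace (D e) \<Longrightarrow> \<phi> e y \<in> cells_union B"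
  unfolding cell_closed_def closed_cell_def by blast

text \<open>Closure finiteness provides a lower open cell through the boundary point, and
  disjointness of open cells forces it to belong to \<open>B\<close>. All inductions on dimension
  rest on this.\<close>

lemma boundary_lower:
  assumes B: "cell_closed B" and e: "e \<in> B" and y: "y \<in> boundary_sphere (dm e)"
  obtains f z where "f \<in> B" "dm f < dm e" "z \<in> open_disk (dm f)" "\<phi> e y = \<phi> f z"
proof -
  have eC: "e \<in> C" using B e cell_closed_subset by blast
  obtain F where F: "F \<subseteq> {f \<in> C. dm f < dm e}" "\<phi> e ` boundary_sphere (dm e) \<subseteq> (\<Union>f\<in>F. open_cell X f)"
    by (rule boundary_finite[OF eC])
  then obtain f z where f: "f \<in> F" "z \<in> open_disk (dm f)" "\<phi> e y = \<phi> f z"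
    using y unfolding open_cell_def by blast
  moreover have "\<phi> f z \<in> cells_union B"
    using char_in_cells_union[OF B e, of y] y f by (simp add: topspace_disk_Un)
  ultimately show ?thesis
    using that[of f z] F cells_union_mem[OF cell_closed_subset[OF B], of f z] by auto
qed

lemma cell_closedI:
  assumes "B \<subseteq> C" "\<And>e y. e \<in> B \<Longrightarrow> y \<in> boundary_sphere (dm e) \<Longrightarrow> \<phi> e y \<in> cells_union B"
  shows "cell_closed B"
  using assms by (auto simp: cell_closed_def closed_cell_Un cells_union_def)

lemma cell_closed_all: "cell_closed C"
proof (rule cell_closedI)
  fix e y assume "e \<in> C" "y \<in> boundary_sphere (dm e)"
  then have "\<phi> e y \<in> topspace T"
    using continuous_char[of e] by (auto simp: continuous_map_def topspace_disk_Un)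
  then show "\<phi> e y \<in> cells_union C" by (simp add: topspace_cells cells_union_def)
qed simp

lemma cells_union_all: "cells_union C = topspace T"
  by (simp add: topspace_cells cells_union_def)

lemma cell_closed_Un: "cell_closed A \<Longrightarrow> cell_closed B \<Longrightarrow> cell_closed (A \<union> B)"
  unfolding cell_closed_def cells_union_def by blast

lemma cells_union_Un: "cells_union (A \<union> B) = cells_union A \<union> cells_union B"
  by (auto simp: cells_union_def)

lemma cell_closed_skeleton:
  assumes "cell_closed B" shows "cell_closed {e \<in> B. dm e \<le> k}"
proof (rule cell_closedI)
  fix e y assume e: "e \<in> {e \<in> B. dm e \<le> k}" "y \<in> boundary_sphere (dm e)"
  then obtain f z where "f \<in> B" "dm f < dm e" "z \<in> open_disk (dm f)" "\<phi> e y = \<phi> f z"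
    using boundary_lower[OF assms] by blast
  then show "\<phi> e y \<in> cells_union {e \<in> B. dm e \<le> k}"
    using e cells_unionI[of f "{e \<in> B. dm e \<le> k}" z] by auto
qed (use assms cell_closed_subset in auto)

text \<open>Testing on the cells of \<open>B\<close> suffices: a closed cell outside
  \<open>B\<close> meets only finitely many open cells, so its intersection with \<open>S\<close> is
  a finite union of sets already known to be closed.\<close>

lemma closedin_cells:
  assumes B: "cell_closed B" and S: "S \<subseteq> cells_union B"
    and clo: "\<And>e. e \<in> B \<Longrightarrow> closedin T (S \<inter> closed_cell X e)"
  shows "closedin T S"
proof (rule weak_topology)
  have BC: "B \<subseteq> C" using B cell_closed_subset by blast
  show "S \<subseteq> topspace T" using S cells_union_subset[OF BC] by blast
  fix e assume e: "e \<in> C"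
  show "closedin T (S \<inter> closed_cell X e)"
  proof (cases "e \<in> B")
    case False
    obtain F where F: "finite F" "F \<subseteq> C" "closed_cell X e \<subseteq> (\<Union>f\<in>F. open_cell X f)"
      by (rule closed_cell_finite[OF e])
    have "S \<inter> closed_cell X e = (\<Union>f\<in>F \<inter> B. S \<inter> closed_cell X f \<inter> closed_cell X e)"
    proof (intro equalityI subsetI)
      fix x assume x: "x \<in> S \<inter> closed_cell X e"
      then obtain f where f: "f \<in> F" "x \<in> open_cell X f" using F by blast
      obtain g where g: "g \<in> B" "x \<in> open_cell X g" using x S by (auto simp: cells_union_def)
      have "f = g" using f g F(2) BC open_cell_disjoint by blast
      then show "x \<in> (\<Union>f\<in>F \<inter> B. S \<inter> closed_cell X f \<inter> closed_cell X e)"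
        using x f g closed_cell_Un by blast
    qed auto
    moreover have "closedin T (\<Union>f\<in>F \<inter> B. S \<inter> closed_cell X f \<inter> closed_cell X e)"
    proof (rule closedin_Union)
      fix R assume "R \<in> (\<lambda>f. S \<inter> closed_cell X f \<inter> closed_cell X e) ` (F \<inter> B)"
      then show "closedin T R"
        using closedin_Int[OF clo closedin_closed_cell[OF e]] by blast
    qed (use F(1) in simp)
    ultimately show ?thesis by simp
  qed (use clo in auto)
qed

lemma closedin_cells_union: "cell_closed B \<Longrightarrow> closedin T (cells_union B)"
  by (rule closedin_cells) (auto simp: cell_closed_def Int_absorb1 intro!: closedin_closed_cell)

text \<open>The weak topology as a quotient of the disks: a closed subset of a disk is compact, so
  its image in the Hausdorff space \<open>T\<close> is closed.\<close>

lemma generated_cells: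
  assumes B: "cell_closed B"
  shows "generated_by (TB B) B D \<phi>"
  unfolding generated_by_def
proof (intro conjI ballI allI impI)
  have BC: "B \<subseteq> C" using B cell_closed_subset by blast
  show "continuous_map (D e) (TB B) (\<phi> e)" if "e \<in> B" for e
    using that BC char_in_cells_union[OF B that] continuous_char[of e]
    by (auto simp: continuous_map_in_subtopology)
  show "topspace (TB B) = (\<Union>i\<in>B. \<phi> i ` topspace (D i))"
    unfolding topspace_TB[OF BC]
  proof (intro equalityI subsetI)
    fix x assume "x \<in> cells_union B"
    then show "x \<in> (\<Union>i\<in>B. \<phi> i ` topspace (D i))"
      by (elim cells_unionE) (auto simp: topspace_disk_Un)
  qed (use char_in_cells_union[OF B] in auto)
  fix U assume U: "U \<subseteq> topspace (TB B)" "\<forall>e\<in>B. openin (D e) {y \<in> topspace (D e). \<phi> e y \<in> U}"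
  have "closedin T (cells_union B - U)"
  proof (rule closedin_cells[OF B])
    fix e assume e: "e \<in> B"
    let ?S = "topspace (D e) - {y \<in> topspace (D e). \<phi> e y \<in> U}"
    have "compactin T (\<phi> e ` ?S)"
      using e U BC by (intro compactin_char_image closedin_diff) auto
    moreover have "\<phi> e ` ?S = (cells_union B - U) \<inter> closed_cell X e"
      using char_in_cells_union[OF B e] by (auto simp: closed_cell_def)
    ultimately show "closedin T ((cells_union B - U) \<inter> closed_cell X e)"
      using compactin_imp_closedin[OF Hausdorff] by simp
  qed auto
  then have "closedin (TB B) (cells_union B - U)"
    by (simp add: closedin_subset_topspace)
  then have "openin (TB B) (topspace (TB B) - (cells_union B - U))" by blast
  moreover have "topspace (TB B) - (cells_union B - U) = U" using U(1) topspace_TB[OF BC] by blast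
  ultimately show "openin (TB B) U" by simp
qed

text \<open>Each point lies in exactly one open cell, so compatibility is an issue only where a
  boundary point meets a lower open cell. The values carry no topology on purpose: below they are
  often whole tracks of a homotopy, functions of time restricted to \<open>{0..1}\<close> so that
  they can be compared by equality.\<close>

lemma cells_glue:
  assumes B: "cell_closed B"
    and compat: "\<And>e y f z. \<lbrakk>e \<in> B; f \<in> B; y \<in> boundary_sphere (dm e); z \<in> open_disk (dm f); dm f < dm e; \<phi> e y = \<phi> f z\<rbrakk> \<Longrightarrow> u e y = u f z"
  obtains h where "\<And>e y. e \<in> B \<Longrightarrow> y \<in> topspace (D e) \<Longrightarrow> h (\<phi> e y) = u e y"
proof -
  define w where "w x = (SOME p. fst p \<in> B \<and> snd p \<in> open_disk (dm (fst p)) \<and> \<phi> (fst p) (snd p) = x)" for x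
  define h where "h x = u (fst (w x)) (snd (w x))" for x
  have BC: "B \<subseteq> C" using B cell_closed_subset by blast
  have o: "h (\<phi> e y) = u e y" if e: "e \<in> B" "y \<in> open_disk (dm e)" for e y
  proof -
    have "fst (w (\<phi> e y)) \<in> B \<and> snd (w (\<phi> e y)) \<in> open_disk (dm (fst (w (\<phi> e y)))) \<and>
      \<phi> (fst (w (\<phi> e y))) (snd (w (\<phi> e y))) = \<phi> e y"
      unfolding w_def by (rule someI[of _ "(e, y)"]) (simp add: e)
    then have "fst (w (\<phi> e y)) = e \<and> snd (w (\<phi> e y)) = y"
      using e BC by (intro char_eqD) auto
    then show ?thesis by (simp add: h_def)
  qed
  have "h (\<phi> e y) = u e y" if e: "e \<in> B" "y \<in> topspace (D e)" for e y
  proof (cases "y \<in> open_disk (dm e)")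
    case False
    then have y: "y \<in> boundary_sphere (dm e)" using e by (simp add: topspace_disk_Un)
    obtain f z where "f \<in> B" "dm f < dm e" "z \<in> open_disk (dm f)" "\<phi> e y = \<phi> f z"
      by (rule boundary_lower[OF B e(1) y])
    then show ?thesis using o[of f z] compat[OF e(1) _ y] by simp
  qed (use o e in auto)
  then show ?thesis using that by blast
qed

text \<open>Induction on dimension: the boundary of a cell meets finitely many lower open cells,
  each contained in a finite subcomplex already.\<close>

lemma finite_cell_closed:
  assumes B: "cell_closed B"
  shows "e \<in> B \<Longrightarrow> \<exists>F. finite F \<and> cell_closed F \<and> e \<in> F \<and> F \<subseteq> B"
proof (induction "dm e" arbitrary: e rule: less_induct)
  case less
  have BC: "B \<subseteq> C" using B cell_closed_subset by blast
  obtain F where F: "finite F" "F \<subseteq> {f \<in> C. dm f < dm e}"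
    "\<phi> e ` boundary_sphere (dm e) \<subseteq> (\<Union>f\<in>F. open_cell X f)"
    by (rule boundary_finite[OF subsetD[OF BC less.prems]])
  have "\<forall>f\<in>F \<inter> B. \<exists>G. finite G \<and> cell_closed G \<and> f \<in> G \<and> G \<subseteq> B"
    using less.hyps F(2) by auto
  then obtain G where G: "\<And>f. f \<in> F \<inter> B \<Longrightarrow> finite (G f) \<and> cell_closed (G f) \<and> f \<in> G f \<and> G f \<subseteq> B"
    by metis
  let ?H = "insert e (\<Union>f\<in>F \<inter> B. G f)"
  have "cell_closed ?H"
  proof (rule cell_closedI)
    show "?H \<subseteq> C" using G BC less by blast
    fix g y assume g: "g \<in> ?H" "y \<in> boundary_sphere (dm g)"
    show "\<phi> g y \<in> cells_union ?H"
    proof (cases "g = e")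
      case True
      obtain f z where f: "f \<in> B" "z \<in> open_disk (dm f)" "\<phi> e y = \<phi> f z"
        using boundary_lower[OF B less.prems] g True by metis
      obtain f' where f': "f' \<in> F" "\<phi> e y \<in> open_cell X f'" using F(3) g True by blast
      have "f' = f" using f' f F(2) BC open_cell_disjoint[of f' f "\<phi> e y"] by (auto simp: open_cell_def)
      then have "f \<in> ?H" using f(1) f'(1) G[of f] by blast
      then show ?thesis unfolding True f(3) using f(2) by (rule cells_unionI)
    next
      case False
      then obtain f where f: "f \<in> F \<inter> B" "g \<in> G f" using g by blast
      then have "\<phi> g y \<in> cells_union (G f)"
        using char_in_cells_union[of "G f" g y] G[OF f(1)] g by (simp add: topspace_disk_Un)
      then show ?thesis using f by (auto simp: cells_union_def)
    qed
  qed
  then show ?case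
    using F(1) G less.prems by (intro exI[of _ ?H]) auto
qed

lemma finite_closedin: "finite S \<Longrightarrow> S \<subseteq> topspace T \<Longrightarrow> closedin T S"
  using Hausdorff_imp_t1_space[OF Hausdorff] t1_space_closedin_finite by blast

text \<open>One point is chosen in every open cell that meets \<open>K\<close>. Every set of chosen
  points is closed, because a closed cell meets only finitely many open cells; so the chosen points
  accumulate nowhere, and compactness leaves finitely many.\<close>

lemma compact_finite_cells:
  assumes B: "cell_closed B" and K: "compactin T K" "K \<subseteq> cells_union B"
  obtains F where "finite F" "cell_closed F" "F \<subseteq> B" "K \<subseteq> cells_union F"
proof -
  have BC: "B \<subseteq> C" using B cell_closed_subset by blast
  define J where "J = {e \<in> B. K \<inter> open_cell X e \<noteq> {}}"
  have "\<forall>e\<in>J. \<exists>x. x \<in> K \<inter> open_cell X e" by (auto simp: J_def)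
  then obtain s where s: "\<And>e. e \<in> J \<Longrightarrow> s e \<in> K \<inter> open_cell X e"
    by metis
  have inj: "inj_on s J"
  proof (rule inj_onI)
    fix e f assume "e \<in> J" "f \<in> J" "s e = s f"
    then show "e = f" using s[of e] s[of f] BC by (intro open_cell_disjoint[of e f "s e"]) (auto simp: J_def)
  qed
  have clo: "closedin T Q" if Q: "Q \<subseteq> s ` J" for Q
  proof (rule weak_topology)
    show sub: "Q \<subseteq> topspace T" using Q s compactin_subset_topspace[OF K(1)] by blast
    fix e assume e: "e \<in> C"
    obtain F where F: "finite F" "F \<subseteq> C" "closed_cell X e \<subseteq> (\<Union>f\<in>F. open_cell X f)"
      by (rule closed_cell_finite[OF e])
    have "Q \<inter> closed_cell X e \<subseteq> s ` F"
    proof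
      fix x assume x: "x \<in> Q \<inter> closed_cell X e"
      then obtain f where f: "f \<in> F" "x \<in> open_cell X f" using F by blast
      obtain j where j: "j \<in> J" "x = s j" using x Q by blast
      have "j = f" using j f s[OF j(1)] F(2) BC by (intro open_cell_disjoint[of j f x]) (auto simp: J_def)
      then show "x \<in> s ` F" using f j by blast
    qed
    then show "closedin T (Q \<inter> closed_cell X e)"
      using F(1) sub by (intro finite_closedin) (auto intro: finite_subset)
  qed
  have "finite (s ` J)"
  proof (rule ccontr)
    assume "infinite (s ` J)"
    moreover have "s ` J \<subseteq> K" using s by blast
    ultimately obtain x where x: "x \<in> T derived_set_of (s ` J)"
      using compactin_imp_Bolzano_Weierstrass[OF K(1), of "s ` J"] by blast
    have "openin T (topspace T - (s ` J - {x}))" by (intro openin_diff openin_topspace clo) blast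
    moreover have "x \<in> topspace T - (s ` J - {x})" using x by (simp add: in_derived_set_of)
    ultimately obtain y where "y \<noteq> x" "y \<in> s ` J" "y \<in> topspace T - (s ` J - {x})"
      using x unfolding in_derived_set_of by metis
    then show False by blast
  qed
  then have J: "finite J" using inj finite_imageD by blast
  have "\<forall>e\<in>J. \<exists>F. finite F \<and> cell_closed F \<and> e \<in> F \<and> F \<subseteq> B"
    using finite_cell_closed[OF B] by (auto simp: J_def)
  then obtain G where G: "\<And>e. e \<in> J \<Longrightarrow> finite (G e) \<and> cell_closed (G e) \<and> e \<in> G e \<and> G e \<subseteq> B"
    by metis
  show ?thesis
  proof (rule that[of "\<Union>e\<in>J. G e"])
    show "finite (\<Union>e\<in>J. G e)" "(\<Union>e\<in>J. G e) \<subseteq> B" using J G by auto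
    show "cell_closed (\<Union>e\<in>J. G e)"
    proof (rule cell_closedI)
      show "(\<Union>e\<in>J. G e) \<subseteq> C" using G BC by blast
      fix f y assume f: "f \<in> (\<Union>e\<in>J. G e)" "y \<in> boundary_sphere (dm f)"
      then obtain e where e: "e \<in> J" "f \<in> G e" by blast
      then have "\<phi> f y \<in> cells_union (G e)"
        using char_in_cells_union[of "G e" f y] G[OF e(1)] f(2) by (simp add: topspace_disk_Un)
      then show "\<phi> f y \<in> cells_union (\<Union>e\<in>J. G e)" using e(1) by (auto simp: cells_union_def)
    qed
    show "K \<subseteq> cells_union (\<Union>e\<in>J. G e)"
    proof
      fix x assume x: "x \<in> K"
      then obtain e where e: "e \<in> B" "x \<in> open_cell X e" using K(2) by (auto simp: cells_union_def)
      then have "e \<in> J" using x by (auto simp: J_def)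
      then show "x \<in> cells_union (\<Union>e\<in>J. G e)" using e G[of e] by (auto simp: cells_union_def)
    qed
  qed
qed

end

subsection \<open>Paths in CW-complexes are generated by edges\<close>

lemma joins_subtopology:
  "joins (subtopology X S) a b p \<longleftrightarrow> joins X a b p \<and> (\<forall>t\<in>{0..1}. p t \<in> S)"
  by (auto simp: joins_def pathin_def continuous_map_in_subtopology)

lemma joins_continuous: "joins X a b p \<Longrightarrow> continuous_map UI X p"
  by (simp add: joins_def pathin_def)

text \<open>The tail \<open>b\<close> at the common end point cancels against its reverse.
  Conjugation is therefore multiplicative, which lets a property of paths between vertices be
  extended to all paths.\<close>

lemma path_hom_conjugate_join:
  assumes a: "joins Y v x a" and b: "joins Y w y b" and c: "joins Y u z c"
    and p: "joins Y x y p" and q: "joins Y y z q"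
  shows "path_hom Y v u
      (loop_join (loop_join (loop_join a p) (rev_path b)) (loop_join (loop_join b q) (rev_path c)))
      (loop_join (loop_join a (loop_join p q)) (rev_path c))"
proof -
  note j = joins_loop_join joins_rev
  have ap: "joins Y v y (loop_join a p)" and bq: "joins Y w z (loop_join b q)" 
    and b': "joins Y y w (rev_path b)" and c': "joins Y z u (rev_path c)"
    using assms by (auto intro: j)
  have "path_hom Y v u
      (loop_join (loop_join (loop_join a p) (rev_path b)) (loop_join (loop_join b q) (rev_path c)))
      (loop_join (loop_join a p) (loop_join (rev_path b) (loop_join (loop_join b q) (rev_path c))))"
    by (rule path_hom_assoc[OF ap b' joins_loop_join[OF bq c']])
  also have "path_hom Y v u \<dots> (loop_join (loop_join a p) (loop_join q (rev_path c)))"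
  proof (rule path_hom_join[OF path_hom_refl[OF ap]])
    have "path_hom Y y u (loop_join (rev_path b) (loop_join (loop_join b q) (rev_path c)))
        (loop_join (loop_join (rev_path b) (loop_join b q)) (rev_path c))"
      by (rule path_hom_sym[OF path_hom_assoc[OF b' bq c']])
    also have "path_hom Y y u \<dots> (loop_join q (rev_path c))"
    proof (rule path_hom_join[OF _ path_hom_refl[OF c']])
      have "path_hom Y y z (loop_join (rev_path b) (loop_join b q)) (loop_join (loop_join (rev_path b) b) q)"
        by (rule path_hom_sym[OF path_hom_assoc[OF b' b q]])
      also have "path_hom Y y z \<dots> (loop_join (\<lambda>t. y) q)"
        by (rule path_hom_join[OF path_hom_inverse_left[OF b] path_hom_refl[OF q]])
      also have "path_hom Y y z \<dots> q" by (rule path_hom_const_left[OF q])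
      finally show "path_hom Y y z (loop_join (rev_path b) (loop_join b q)) q" .
    qed
    finally show "path_hom Y y u (loop_join (rev_path b) (loop_join (loop_join b q) (rev_path c))) (loop_join q (rev_path c))" .
  qed
  also have "path_hom Y v u \<dots> (loop_join (loop_join (loop_join a p) q) (rev_path c))"
    by (rule path_hom_sym[OF path_hom_assoc[OF ap q c']])
  also have "path_hom Y v u \<dots> (loop_join (loop_join a (loop_join p q)) (rev_path c))"
    by (rule path_hom_join[OF path_hom_assoc[OF a p q] path_hom_refl[OF c']])
  finally show ?thesis .
qed

lemma loop_join_rev:
  assumes "p 1 = q 0"
  shows "rev_path (loop_join p q) = loop_join (rev_path q) (rev_path p)"
proof
  fix t :: real
  consider "t < 1/2" | "t = 1/2" | "t > 1/2" by linarith
  then show "loop_join p q (1 - t) = loop_join (rev_path q) (rev_path p) t"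
  proof cases
    case 3
    have "1 - (2 * t - 1) = 2 * (1 - t)" by argo
    then show ?thesis using 3 by (simp add: loop_join_def)
  next
    case 2
    show ?thesis unfolding 2 using assms by (simp add: loop_join_def)
  qed (simp add: loop_join_def)
qed

lemma joins_conjugate:
  "joins Y v x a \<Longrightarrow> joins Y w y b \<Longrightarrow> joins Y x y p \<Longrightarrow> joins Y v w (loop_join (loop_join a p) (rev_path b))"
  by (rule joins_loop_join[OF joins_loop_join joins_rev])

lemma path_hom_conjugate_rev:
  assumes a: "joins Y v x a" and b: "joins Y w y b" and p: "joins Y x y p"
  shows "path_hom Y w v (rev_path (loop_join (loop_join a p) (rev_path b)))
      (loop_join (loop_join b (rev_path p)) (rev_path a))"
proof -
  have "rev_path (loop_join (loop_join a p) (rev_path b)) = loop_join (\<lambda>t. b (1 - (1 - t))) (rev_path (loop_join a p))"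
    using joins_loop_join[OF a p] b by (intro loop_join_rev) (simp add: joins_def)
  moreover have "rev_path (loop_join a p) = loop_join (rev_path p) (rev_path a)"
    using a p by (intro loop_join_rev) (simp add: joins_def)
  ultimately have "rev_path (loop_join (loop_join a p) (rev_path b)) = loop_join b (loop_join (rev_path p) (rev_path a))"
    by simp
  then show ?thesis
    using path_hom_sym[OF path_hom_assoc[OF b joins_rev[OF p] joins_rev[OF a]]] by simp
qed

lemma path_hom_conjugate_const:
  assumes a: "joins Y v x a"
  shows "path_hom Y v v (loop_join (loop_join a (\<lambda>t. x)) (rev_path a)) (\<lambda>t. v)"
  by (rule path_hom_trans[OF path_hom_join[OF path_hom_const_right[OF a] path_hom_refl[OF joins_rev[OF a]]]
        path_hom_inverse_right[OF a]])

lemma path_hom_cancel_right: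
  assumes "path_hom Y x z (loop_join p q) r" and p: "joins Y x y p" and q: "joins Y y z q"
  shows "path_hom Y x y p (loop_join r (rev_path q))"
proof -
  have "path_hom Y x y p (loop_join p (\<lambda>t. y))"
    by (rule path_hom_sym[OF path_hom_const_right[OF p]])
  also have "path_hom Y x y \<dots> (loop_join p (loop_join q (rev_path q)))"
    by (rule path_hom_join[OF path_hom_refl[OF p] path_hom_sym[OF path_hom_inverse_right[OF q]]])
  also have "path_hom Y x y \<dots> (loop_join (loop_join p q) (rev_path q))"
    by (rule path_hom_sym[OF path_hom_assoc[OF p q joins_rev[OF q]]])
  also have "path_hom Y x y \<dots> (loop_join r (rev_path q))"
    by (rule path_hom_join[OF assms(1) path_hom_refl[OF joins_rev[OF q]]])
  finally show ?thesis .
qed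

section \<open>Vertices and paths in unions of cells\<close>

context cw_complex_space
begin

definition vertices :: "'c set \<Rightarrow> 'a set" where
  "vertices B = {\<phi> e (\<lambda>i. 0) | e. e \<in> B \<and> dm e = 0}"

lemma joins_TB_mono: "joins (TB B) x y p \<Longrightarrow> B \<subseteq> B' \<Longrightarrow> joins (TB B') x y p"
  unfolding joins_subtopology cells_union_def by blast

lemma path_hom_TB_mono:
  assumes "path_hom (TB A) x y p q" "A \<subseteq> A'" shows "path_hom (TB A') x y p q"
proof -
  have "continuous_map (TB A) (TB A') (\<lambda>x. x)"
    using assms(2) by (auto simp: continuous_map_in_subtopology cells_union_def continuous_map_ident continuous_map_from_subtopology)
  from path_hom_image[OF assms(1) this] show ?thesis by simp
qed

lemma path_hom_TB:
  assumes "path_hom (TB A) x y p q" shows "path_hom T x y p q"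
proof -
  have "continuous_map (TB A) T (\<lambda>x. x)"
    by (intro continuous_map_from_subtopology continuous_map_ident)
  from path_hom_image[OF assms(1) this] show ?thesis by simp
qed

lemma vertices_subset: "vertices B \<subseteq> cells_union B"
  by (auto simp: vertices_def disk_0 intro!: cells_unionI)

lemma boundary_1: "boundary_sphere (Suc 0) = {\<lambda>i. if i = 0 then 1 else 0, \<lambda>i. if i = 0 then - 1 else 0}"
proof -
  have "y = (\<lambda>i. if i = 0 then 1 else 0) \<or> y = (\<lambda>i. if i = 0 then - 1 else 0)"
    if "\<forall>i\<ge>Suc 0. y i = 0" "\<bar>y 0\<bar> = 1" for y :: "nat \<Rightarrow> real"
    using that by (auto simp: fun_eq_iff Suc_le_eq abs_if split: if_splits)
  then show ?thesis by (auto simp: boundary_sphere_eq L2_set_def)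
qed

lemma boundary_vertex:
  assumes "cell_closed B" "e \<in> B" "dm e = 1" "y \<in> boundary_sphere (dm e)"
  shows "\<phi> e y \<in> vertices B"
proof -
  obtain f z where "f \<in> B" "dm f < dm e" "z \<in> open_disk (dm f)" "\<phi> e y = \<phi> f z"
    by (rule boundary_lower[OF assms(1,2,4)])
  then show ?thesis using assms(3) by (auto simp: vertices_def disk_0)
qed

end

text \<open>Scaling by the factor \<open>1 + s\<close>, cut off at the unit sphere. At
  \<open>s = 1\<close> all points of norm at least 1/2 have reached the sphere; this is the origin
  of the radius 1/2 below.\<close>

definition stretch :: "nat \<Rightarrow> real \<Rightarrow> (nat \<Rightarrow> real) \<Rightarrow> nat \<Rightarrow> real" where
  "stretch n s y = (\<lambda>i. (1 + s) * y i / max ((1 + s) * dnorm n y) 1)"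

lemma stretch_in_disk:
  assumes "y \<in> topspace (disk n)" "s \<in> {0..1}"
  shows "stretch n s y \<in> topspace (disk n)"
proof -
  have "dnorm n (stretch n s y) = (1 + s) * dnorm n y / max ((1 + s) * dnorm n y) 1"
    using assms by (simp add: stretch_def dnorm_divide dnorm_scale)
  also have "\<dots> \<le> 1" by (simp add: divide_simps)
  finally show ?thesis using assms by (simp add: topspace_disk stretch_def)
qed

lemma stretch_boundary: "y \<in> boundary_sphere n \<Longrightarrow> s \<in> {0..1} \<Longrightarrow> stretch n s y = y"
  by (simp add: stretch_def boundary_sphere_eq max_absorb1)

lemma stretch_0: "y \<in> topspace (disk n) \<Longrightarrow> stretch n 0 y = y"
  by (simp add: stretch_def topspace_disk max_absorb2)

lemma stretch_1: "dnorm n y \<ge> 1/2 \<Longrightarrow> stretch n 1 y = (\<lambda>i. y i / dnorm n y)"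
  by (simp add: stretch_def max_absorb1)

lemma continuous_map_stretch:
  assumes "continuous_map Z UI s" "continuous_map Z (disk n) f"
  shows "continuous_map Z (disk n) (\<lambda>z. stretch n (s z) (f z))"
proof (rule continuous_map_into_disk)
  have s: "continuous_map Z euclideanreal s" and "s \<in> topspace Z \<rightarrow> {0..1}"
    using assms(1) by (simp_all add: continuous_map_in_subtopology)
  show "continuous_map Z euclideanreal (\<lambda>z. stretch n (s z) (f z) i)" for i
    unfolding stretch_def
    by (intro continuous_intros s continuous_map_dnorm[OF assms(2)] continuous_map_coord[OF assms(2)]) auto
  show "stretch n (s z) (f z) \<in> topspace (disk n)" if "z \<in> topspace Z" for z
    using that assms by (intro stretch_in_disk) (auto simp: continuous_map_def Pi_iff)
qed

text \<open>Radial projection to the sphere, with an arbitrary boundary point assigned to the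
  centre. The discontinuity there is harmless, since only single radii are ever used.\<close>

definition radius_end :: "nat \<Rightarrow> (nat \<Rightarrow> real) \<Rightarrow> nat \<Rightarrow> real" where
  "radius_end n y = (if dnorm n y = 0 then (\<lambda>i. if i = 0 then 1 else 0) else (\<lambda>i. y i / dnorm n y))"

definition radius :: "nat \<Rightarrow> (nat \<Rightarrow> real) \<Rightarrow> real \<Rightarrow> nat \<Rightarrow> real" where
  "radius n y t = (\<lambda>i. (1 - t) * radius_end n y i + t * y i)"

lemma first_unit_vector: "n > 0 \<Longrightarrow> (\<lambda>i. if i = 0 then 1 else 0) \<in> boundary_sphere n"
proof -
  assume n: "n > 0"
  have "(\<Sum>i<n. (if i = 0 then 1 else 0 :: real)\<^sup>2) = (\<Sum>i<n. if i = 0 then 1 else 0)"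
    by (rule sum.cong) auto
  then show ?thesis using n by (auto simp: boundary_sphere_eq L2_set_def)
qed

lemma radius_end_boundary:
  assumes "n > 0" "y \<in> topspace (disk n)" shows "radius_end n y \<in> boundary_sphere n"
  using first_unit_vector[OF assms(1)] assms(2)
  by (auto simp: radius_end_def boundary_sphere_eq dnorm_divide topspace_disk)

lemma radius_joins:
  assumes "n > 0" "y \<in> topspace (disk n)"
  shows "joins (disk n) (radius_end n y) y (radius n y)"
  unfolding joins_def pathin_def
proof (intro conjI continuous_map_into_disk)
  show "continuous_map UI euclideanreal (\<lambda>t. radius n y t i)" for i
    unfolding radius_def by (intro continuous_intros) auto
  show "radius n y t \<in> topspace (disk n)" if "t \<in> topspace UI" for t
    unfolding radius_def using that assms radius_end_boundary[OF assms]
    by (intro disk_convex) (auto simp: topspace_disk_Un)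
qed (simp_all add: radius_def)

lemma loop_join_image: "(\<lambda>t. f (loop_join p q t)) = loop_join (\<lambda>t. f (p t)) (\<lambda>t. f (q t))"
  by (auto simp: loop_join_def)

text \<open>An induction principle expressing that edges generate all paths between vertices up to
  homotopy. Its instances yield connectedness of the 1-skeleton of \<open>N\<close>, loops of
  \<open>M\<close> pushed into its 1-skeleton, the homomorphism on all loops of that skeleton, and
  the effect of the inverse map on loops of the 1-skeleton of \<open>N\<close>.\<close>

locale path_predicate = cw_complex_space X for X :: "('a, 'c) cw" +
  fixes B :: "'c set" and Q :: "(real \<Rightarrow> 'a) \<Rightarrow> bool"
  assumes closed: "cell_closed B"
    and Q_hom: "\<And>v w p q. \<lbrakk>v \<in> vertices B; w \<in> vertices B; path_hom (TB B) v w p q; Q p\<rbrakk> \<Longrightarrow> Q q"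
    and Q_const: "\<And>v. v \<in> vertices B \<Longrightarrow> Q (\<lambda>t. v)"
    and Q_edge: "\<And>e. e \<in> B \<Longrightarrow> dm e = 1 \<Longrightarrow> Q (edge_path X e)"
    and Q_rev: "\<And>v w p. \<lbrakk>v \<in> vertices B; w \<in> vertices B; joins (TB B) v w p; Q p\<rbrakk> \<Longrightarrow> Q (rev_path p)"
    and Q_join: "\<And>u v w p q. \<lbrakk>u \<in> vertices B; v \<in> vertices B; w \<in> vertices B;
       joins (TB B) u v p; joins (TB B) v w q; Q p; Q q\<rbrakk> \<Longrightarrow> Q (loop_join p q)"
begin

text \<open>To prove \<open>Q\<close> for all paths between vertices, choose for every point a tail, that is, a path
  from some vertex to that point; \<open>conj_Q\<close> extends \<open>Q\<close> to paths with arbitrary end points by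
  conjugation with the tails. Finite unions of cells are then treated by induction, removing
  a cell of top dimension.\<close>

definition conj_Q :: "('a \<Rightarrow> real \<Rightarrow> 'a) \<Rightarrow> 'a \<Rightarrow> 'a \<Rightarrow> (real \<Rightarrow> 'a) \<Rightarrow> bool" where
  "conj_Q \<tau> x y p \<longleftrightarrow> Q (loop_join (loop_join (\<tau> x) p) (rev_path (\<tau> y)))"

definition tail_at :: "('a \<Rightarrow> real \<Rightarrow> 'a) \<Rightarrow> 'a \<Rightarrow> bool" where
  "tail_at \<tau> x \<longleftrightarrow> (\<exists>v\<in>vertices B. joins (TB B) v x (\<tau> x))"

lemma conj_Q_hom:
  assumes "tail_at \<tau> x" "tail_at \<tau> y" "path_hom (TB B) x y p q" "conj_Q \<tau> x y p"
  shows "conj_Q \<tau> x y q"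
proof -
  obtain v w where v: "v \<in> vertices B" "joins (TB B) v x (\<tau> x)" "w \<in> vertices B" "joins (TB B) w y (\<tau> y)"
    using assms(1,2) by (auto simp: tail_at_def)
  have "path_hom (TB B) v w (loop_join (loop_join (\<tau> x) p) (rev_path (\<tau> y)))
      (loop_join (loop_join (\<tau> x) q) (rev_path (\<tau> y)))"
    by (rule path_hom_join[OF path_hom_join[OF path_hom_refl[OF v(2)] assms(3)] path_hom_refl[OF joins_rev[OF v(4)]]])
  then show ?thesis using Q_hom[OF v(1,3)] assms(4) unfolding conj_Q_def by blast
qed

lemma conj_Q_join:
  assumes "tail_at \<tau> x" "tail_at \<tau> y" "tail_at \<tau> z" "joins (TB B) x y p" "joins (TB B) y z q"
    "conj_Q \<tau> x y p" "conj_Q \<tau> y z q"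
  shows "conj_Q \<tau> x z (loop_join p q)"
proof -
  obtain v w u where v: "v \<in> vertices B" "w \<in> vertices B" "u \<in> vertices B"
    and j: "joins (TB B) v x (\<tau> x)" "joins (TB B) w y (\<tau> y)" "joins (TB B) u z (\<tau> z)"
    using assms(1-3) by (auto simp: tail_at_def)
  have jj: "joins (TB B) v w (loop_join (loop_join (\<tau> x) p) (rev_path (\<tau> y)))"
    "joins (TB B) w u (loop_join (loop_join (\<tau> y) q) (rev_path (\<tau> z)))"
    by (rule joins_conjugate[OF j(1,2) assms(4)], rule joins_conjugate[OF j(2,3) assms(5)])
  then have "Q (loop_join (loop_join (loop_join (\<tau> x) p) (rev_path (\<tau> y))) (loop_join (loop_join (\<tau> y) q) (rev_path (\<tau> z))))"
    using Q_join[OF v jj] assms(6,7) by (simp add: conj_Q_def)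
  then show ?thesis
    unfolding conj_Q_def by (rule Q_hom[OF v(1,3) path_hom_conjugate_join[OF j assms(4,5)]])
qed

lemma conj_Q_rev:
  assumes "tail_at \<tau> x" "tail_at \<tau> y" "joins (TB B) x y p" "conj_Q \<tau> x y p"
  shows "conj_Q \<tau> y x (rev_path p)"
proof -
  obtain v w where v: "v \<in> vertices B" "w \<in> vertices B"
    and j: "joins (TB B) v x (\<tau> x)" "joins (TB B) w y (\<tau> y)"
    using assms(1,2) by (auto simp: tail_at_def)
  have "joins (TB B) v w (loop_join (loop_join (\<tau> x) p) (rev_path (\<tau> y)))"
    by (rule joins_conjugate[OF j assms(3)])
  then have "Q (rev_path (loop_join (loop_join (\<tau> x) p) (rev_path (\<tau> y))))"
    using Q_rev[OF v] assms(4) by (simp add: conj_Q_def)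
  then show ?thesis
    unfolding conj_Q_def by (rule Q_hom[OF v(2,1) path_hom_conjugate_rev[OF j assms(3)]])
qed

lemma conj_Q_const: "tail_at \<tau> x \<Longrightarrow> conj_Q \<tau> x x (\<lambda>t. x)"
  unfolding conj_Q_def tail_at_def
  by (metis Q_const Q_hom path_hom_conjugate_const path_hom_sym)

text \<open>Tails at vertices have to be constant, so that for a path between vertices
  \<open>conj_Q\<close> gives back \<open>Q\<close> up to homotopy.\<close>

definition good_tails :: "'c set \<Rightarrow> ('a \<Rightarrow> real \<Rightarrow> 'a) \<Rightarrow> bool" where
  "good_tails A \<tau> \<longleftrightarrow> (\<forall>x\<in>cells_union A. tail_at \<tau> x) \<and>
     (\<forall>v\<in>vertices B \<inter> cells_union A. \<tau> v = (\<lambda>t. v)) \<and>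
     (\<forall>x y p. joins (TB A) x y p \<longrightarrow> conj_Q \<tau> x y p)"

end

section \<open>Subdivision of paths\<close>

definition path_segment :: "(real \<Rightarrow> 'a) \<Rightarrow> real \<Rightarrow> real \<Rightarrow> real \<Rightarrow> 'a" where
  "path_segment p a b t = p (a + (b - a) * t)"

lemma path_segment_range:
  fixes a b t :: real
  shows "0 \<le> a \<Longrightarrow> a \<le> b \<Longrightarrow> b \<le> 1 \<Longrightarrow> t \<in> {0..1} \<Longrightarrow> a + (b - a) * t \<in> {a..b}"
  using mult_left_le[of t "b - a"] by auto

lemma joins_path_segment:
  assumes "joins X x y p" "0 \<le> a" "a \<le> b" "b \<le> 1"
  shows "joins X (p a) (p b) (path_segment p a b)"
proof -
  have "continuous_map UI UI (\<lambda>t. a + (b - a) * t)"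
  proof (rule continuous_map_UI)
    show "continuous_map UI euclideanreal (\<lambda>t. a + (b - a) * t)"
      by (intro continuous_intros) auto
    show "0 \<le> a + (b - a) * t \<and> a + (b - a) * t \<le> 1" if "t \<in> topspace UI" for t
      using path_segment_range[of a b t] assms that by auto
  qed
  then have "continuous_map UI X (\<lambda>t. p (a + (b - a) * t))"
    by (rule continuous_map_composeI[OF joins_continuous[OF assms(1)]])
  then show ?thesis by (simp add: joins_def pathin_def path_segment_def[abs_def])
qed

lemma path_segment_join:
  assumes p: "joins X x y p" and a: "0 \<le> a" "a \<le> b" "b \<le> c" "c \<le> 1"
  shows "path_hom X (p a) (p c) (loop_join (path_segment p a b) (path_segment p b c)) (path_segment p a c)"
proof -
  \<comment> \<open>Traverses \<open>[a, b]\<close> in the first half of the time and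
    \<open>[b, c]\<close> in the second; with \<open>min\<close> and \<open>max\<close> it is a
    single continuous expression.\<close>
  let ?\<sigma> = "\<lambda>t. a + (b - a) * min (2*t) 1 + (c - b) * max 0 (2*t - 1)"
  have "path_hom X (loop_join (path_segment p a b) (path_segment p b c) 0) (path_segment p a c 1)
      (loop_join (path_segment p a b) (path_segment p b c)) (path_segment p a c)"
  proof -
    have eq: "loop_join (path_segment p a b) (path_segment p b c) t = p (?\<sigma> t)" for t
    proof (cases "t \<le> 1/2")
      case True
      then have "min (2*t) 1 = 2*t" "max 0 (2*t - 1) = 0" by simp_all
      then show ?thesis using True by (simp add: loop_join_def path_segment_def)
    next
      case False
      then have "min (2*t) 1 = 1" "max 0 (2*t - 1) = 2*t - 1" by simp_all
      then show ?thesis using False by (simp add: loop_join_def path_segment_def)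
    qed
    have r: "?\<sigma> t \<in> {0..1}" if t: "t \<in> {0..1}" for t
    proof (cases "t \<le> 1/2")
      case True
      then show ?thesis using path_segment_range[of a b "2*t"] a t by auto
    next
      case False
      then show ?thesis using path_segment_range[of b c "2*t - 1"] a t by auto
    qed
    have r': "a + (c - a) * t \<in> {0..1}" if "t \<in> {0..1}" for t
      using path_segment_range[of a c t] a that by auto
    have "path_hom X (loop_join (path_segment p a b) (path_segment p b c) 0) (loop_join (path_segment p a b) (path_segment p b c) 1)
      (loop_join (path_segment p a b) (path_segment p b c)) (path_segment p a c)"
    proof (rule path_hom_reparam[OF p])
      show "continuous_on {0..1} ?\<sigma>" "continuous_on {0..1} (\<lambda>t. a + (c - a) * t)"
        by (intro continuous_intros)+
      show "?\<sigma> \<in> {0..1} \<rightarrow> {0..1}" "(\<lambda>t. a + (c - a) * t) \<in> {0..1} \<rightarrow> {0..1}"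
        using r r' by blast+
    qed (simp_all add: eq path_segment_def)
    then show ?thesis by (simp add: loop_join_def path_segment_def)
  qed
  then show ?thesis by (simp add: loop_join_def path_segment_def)
qed

text \<open>Boundaries lie in cells of strictly lower dimension, so no other cell of
  \<open>A\<close> needs \<open>e\<close>.\<close>

lemma (in cw_complex_space) cell_closed_remove_top:
  assumes A: "cell_closed A" and max: "\<And>f. f \<in> A \<Longrightarrow> dm f \<le> dm e"
  shows "cell_closed (A - {e})"
proof (rule cell_closedI)
  show "A - {e} \<subseteq> C" using A cell_closed_subset by blast
  fix f y assume f: "f \<in> A - {e}" "y \<in> boundary_sphere (dm f)"
  obtain g z where g: "g \<in> A" "dm g < dm f" "z \<in> open_disk (dm g)" "\<phi> f y = \<phi> g z"
    using boundary_lower[OF A _ f(2)] f(1) by blast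
  moreover have "dm f \<le> dm e" using max f(1) by blast
  ultimately have "g \<in> A - {e}" by auto
  then show "\<phi> f y \<in> cells_union (A - {e})"
    unfolding g(4) using g(3) by (rule cells_unionI)
qed

section \<open>Extending the tails over a cell of top dimension\<close>

context path_predicate
begin

context
  fixes A :: "'c set" and e :: 'c and \<tau>' :: "'a \<Rightarrow> real \<Rightarrow> 'a"
  assumes A: "cell_closed A" and AB: "A \<subseteq> B" and e: "e \<in> A"
    and max: "\<And>f. f \<in> A \<Longrightarrow> dm f \<le> dm e"
    and good: "good_tails (A - {e}) \<tau>'"
begin

text \<open>A point of the new cell is reached from the boundary along its radius, after the old
  tail of the radius' outer end. A new 0-cell is a vertex and gets the constant tail.\<close>

definition new_tails :: "'a \<Rightarrow> real \<Rightarrow> 'a" where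
  "new_tails x = (if x \<in> cells_union (A - {e}) then \<tau>' x
     else if dm e = 0 then (\<lambda>t. x)
     else (let y = (SOME y. y \<in> open_disk (dm e) \<and> \<phi> e y = x)
           in loop_join (\<tau>' (\<phi> e (radius_end (dm e) y))) (\<lambda>t. \<phi> e (radius (dm e) y t))))"

lemma A': "cell_closed (A - {e})"
  by (rule cell_closed_remove_top[OF A max])

lemma eC: "e \<in> C" and AC: "A \<subseteq> C" and eB: "e \<in> B"
  using A AB e cell_closed_subset by auto

lemma boundary_in_A': "u \<in> boundary_sphere (dm e) \<Longrightarrow> \<phi> e u \<in> cells_union (A - {e})"
  using boundary_lower[OF A e] cells_unionI[of _ "A - {e}"] by (metis DiffI less_irrefl singletonD)

lemma open_cell_not_A': "y \<in> open_disk (dm e) \<Longrightarrow> \<phi> e y \<notin> cells_union (A - {e})"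
  using cells_union_mem[of "A - {e}" e y] AC eC by blast

lemma cells_union_A_cases:
  assumes "x \<in> cells_union A"
  obtains "x \<in> cells_union (A - {e})" | y where "y \<in> open_disk (dm e)" "x = \<phi> e y"
  using assms by (metis DiffI cells_unionE cells_unionI singletonD)

lemma new_tails_A': "x \<in> cells_union (A - {e}) \<Longrightarrow> new_tails x = \<tau>' x"
  by (simp add: new_tails_def)

lemma new_tails_e:
  assumes "y \<in> open_disk (dm e)" "dm e > 0"
  shows "new_tails (\<phi> e y) = loop_join (new_tails (\<phi> e (radius_end (dm e) y))) (\<lambda>t. \<phi> e (radius (dm e) y t))"
proof -
  have "(SOME z. z \<in> open_disk (dm e) \<and> \<phi> e z = \<phi> e y) = y"
    by (rule some_equality) (use assms char_inj[OF eC] in auto)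
  moreover have "radius_end (dm e) y \<in> boundary_sphere (dm e)"
    using radius_end_boundary[OF assms(2)] assms(1) by (simp add: topspace_disk_Un)
  ultimately show ?thesis
    using assms open_cell_not_A'[OF assms(1)] boundary_in_A' by (simp add: new_tails_def)
qed

lemma joins_char:
  assumes "joins (D e) u v m"
  shows "joins (TB A) (\<phi> e u) (\<phi> e v) (\<lambda>t. \<phi> e (m t))"
proof -
  have "joins T (\<phi> e u) (\<phi> e v) (\<lambda>t. \<phi> e (m t))"
    by (rule joins_image[OF assms continuous_char[OF eC]])
  then show ?thesis
    using char_in_cells_union[OF A e] joins_in_topspace[OF assms] by (simp add: joins_subtopology)
qed

lemma char_path_hom:
  assumes "joins (D e) u v m" "joins (D e) u v m'"
  shows "path_hom (TB A) (\<phi> e u) (\<phi> e v) (\<lambda>t. \<phi> e (m t)) (\<lambda>t. \<phi> e (m' t))"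
proof -
  have "continuous_map (D e) (TB A) (\<phi> e)"
    using continuous_char[OF eC] char_in_cells_union[OF A e] by (auto simp: continuous_map_in_subtopology)
  then show ?thesis
    using disk_path_hom[of "dm e" "TB A" "\<phi> e" m m'] assms by (simp add: joins_def pathin_def)
qed

lemma joins_A_B: "joins (TB A) x y p \<Longrightarrow> joins (TB B) x y p"
  using joins_TB_mono AB by blast

lemma path_hom_A_B: "path_hom (TB A) x y p q \<Longrightarrow> path_hom (TB B) x y p q"
  using path_hom_TB_mono AB by blast

lemma tail_at_new: "x \<in> cells_union A \<Longrightarrow> tail_at new_tails x"
proof (erule cells_union_A_cases)
  show *: "tail_at new_tails x" if "x \<in> cells_union (A - {e})" for x
    using that good by (simp add: good_tails_def tail_at_def new_tails_A')
  fix y assume y: "y \<in> open_disk (dm e)" "x = \<phi> e y"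
  show "tail_at new_tails x"
  proof (cases "dm e = 0")
    case True
    then have "x \<in> vertices B" using y eB by (auto simp: vertices_def disk_0)
    moreover have "x \<in> topspace (TB B)"
      using calculation vertices_subset topspace_TB cell_closed_subset[OF closed] by blast
    moreover have "new_tails x = (\<lambda>t. x)"
      using True y open_cell_not_A' by (simp add: new_tails_def)
    ultimately show ?thesis unfolding tail_at_def using joins_const by metis
  next
    case False
    have yD: "y \<in> topspace (D e)" using y by (simp add: topspace_disk_Un)
    have b: "\<phi> e (radius_end (dm e) y) \<in> cells_union (A - {e})"
      using radius_end_boundary[of "dm e" y] yD False boundary_in_A' by auto
    obtain v where v: "v \<in> vertices B" "joins (TB B) v (\<phi> e (radius_end (dm e) y)) (new_tails (\<phi> e (radius_end (dm e) y)))"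
      using *[OF b] by (auto simp: tail_at_def)
    have "joins (TB B) (\<phi> e (radius_end (dm e) y)) x (\<lambda>t. \<phi> e (radius (dm e) y t))"
      using joins_A_B[OF joins_char[OF radius_joins]] False yD y by simp
    then show ?thesis
      unfolding tail_at_def y(2) new_tails_e[OF y(1) False[unfolded neq0_conv]]
      using joins_loop_join[OF v(2)] v(1) y(2) by blast
  qed
qed

lemma conj_Q_A': "joins (TB (A - {e})) x y p \<Longrightarrow> conj_Q new_tails x y p"
proof -
  assume p: "joins (TB (A - {e})) x y p"
  then have "x \<in> cells_union (A - {e})" "y \<in> cells_union (A - {e})"
    using joins_endpoints[OF p] by auto
  then show ?thesis
    using good p by (simp add: good_tails_def conj_Q_def new_tails_A')
qed

lemma new_tails_vertex: "v \<in> vertices B \<Longrightarrow> v \<in> cells_union A \<Longrightarrow> new_tails v = (\<lambda>t. v)"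
proof (erule cells_union_A_cases)
  assume v: "v \<in> vertices B"
  show "new_tails v = (\<lambda>t. v)" if "v \<in> cells_union (A - {e})"
    using that v good by (simp add: new_tails_A' good_tails_def)
  fix y assume y: "y \<in> open_disk (dm e)" "v = \<phi> e y"
  obtain f where f: "f \<in> B" "dm f = 0" "v = \<phi> f (\<lambda>i. 0)" using v by (auto simp: vertices_def)
  have "e = f"
    using char_eqD[of e f y "\<lambda>i. 0"] f y eC cell_closed_subset[OF closed] by (auto simp: disk_0)
  then show "new_tails v = (\<lambda>t. v)"
    using f(2) open_cell_not_A'[OF y(1)] unfolding new_tails_def y(2) by simp
qed

text \<open>By the choice of the new tails, the conjugated path is a tail followed by its own
  reverse.\<close>

lemma conj_Q_radius:
  assumes y: "y \<in> open_disk (dm e)" and n: "dm e > 0"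
  shows "conj_Q new_tails (\<phi> e (radius_end (dm e) y)) (\<phi> e y) (\<lambda>t. \<phi> e (radius (dm e) y t))"
proof -
  have "tail_at new_tails (\<phi> e y)"
    using tail_at_new cells_unionI[OF e y] by blast
  then obtain v where v: "v \<in> vertices B" "joins (TB B) v (\<phi> e y) (new_tails (\<phi> e y))"
    by (auto simp: tail_at_def)
  have "Q (loop_join (new_tails (\<phi> e y)) (rev_path (new_tails (\<phi> e y))))"
    using Q_hom[OF v(1) v(1) path_hom_sym[OF path_hom_inverse_right[OF v(2)]] Q_const[OF v(1)]] .
  then show ?thesis
    unfolding conj_Q_def new_tails_e[OF y n, symmetric] .
qed

text \<open>In dimension at least 2 the path may be replaced by one in the sphere, whose image lies
  in lower cells. In dimension 1 the sphere has two points, and the path may be replaced by a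
  constant, the edge or the reversed edge.\<close>

lemma conj_Q_sphere:
  assumes n: "dm e > 0" and u: "u \<in> boundary_sphere (dm e)" and v: "v \<in> boundary_sphere (dm e)"
    and m: "joins (D e) u v m"
  shows "conj_Q new_tails (\<phi> e u) (\<phi> e v) (\<lambda>t. \<phi> e (m t))"
proof -
  have tails: "tail_at new_tails (\<phi> e u)" "tail_at new_tails (\<phi> e v)"
    using tail_at_new char_in_cells_union[OF A e] u v by (simp_all add: topspace_disk_Un)
  \<comment> \<open>Paths in the disk with common ends are homotopic, so one convenient path
    \<open>m'\<close> is enough.\<close>
  have suff: "conj_Q new_tails (\<phi> e u) (\<phi> e v) (\<lambda>t. \<phi> e (m t))"
    if "joins (D e) u v m'" "conj_Q new_tails (\<phi> e u) (\<phi> e v) (\<lambda>t. \<phi> e (m' t))" for m'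
    by (rule conj_Q_hom[OF tails path_hom_A_B[OF char_path_hom[OF that(1) m]] that(2)])
  consider "dm e \<ge> 2" | "dm e = 1" using n by linarith
  then show ?thesis
  proof cases
    case 1
    obtain g where g: "continuous_map UI (D e) g" "g ` {0..1} \<subseteq> boundary_sphere (dm e)" "g 0 = u" "g 1 = v"
      by (rule boundary_sphere_path[OF 1 u v])
    then have j: "joins (D e) u v g" by (simp add: joins_def pathin_def)
    have "joins (TB (A - {e})) (\<phi> e u) (\<phi> e v) (\<lambda>t. \<phi> e (g t))"
      using joins_char[OF j] boundary_in_A' g(2) unfolding joins_subtopology by blast
    then show ?thesis using suff[OF j] conj_Q_A' by blast
  next
    case 2
    let ?a = "\<lambda>i::nat. if i = 0 then - 1 else (0::real)" and ?b = "\<lambda>i::nat. if i = 0 then 1 else (0::real)"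
    have ab: "?a \<in> boundary_sphere (dm e)" "?b \<in> boundary_sphere (dm e)"
      using 2 boundary_1 by auto
    let ?m = "\<lambda>t i. if i = 0 then 2 * t - 1 else (0::real)"
    have m': "joins (D e) ?a ?b ?m"
      unfolding joins_def pathin_def
    proof (intro conjI continuous_map_into_disk)
      show "continuous_map UI euclideanreal (\<lambda>t. ?m t i)" for i
        by (cases "i = 0") (auto intro!: continuous_intros)
      show "?m t \<in> topspace (D e)" if "t \<in> topspace UI" for t
        using that 2 by (auto simp: topspace_disk L2_set_def abs_le_iff)
    qed auto
    have vert: "\<phi> e ?a \<in> vertices B" "\<phi> e ?b \<in> vertices B"
      using boundary_vertex[OF closed eB 2] ab by blast+
    have nt: "new_tails (\<phi> e ?a) = (\<lambda>t. \<phi> e ?a)" "new_tails (\<phi> e ?b) = (\<lambda>t. \<phi> e ?b)"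
      using new_tails_vertex vert char_in_cells_union[OF A e] ab by (simp_all add: topspace_disk_Un)
    have jab: "joins (TB B) (\<phi> e ?a) (\<phi> e ?b) (\<lambda>t. \<phi> e (?m t))"
      by (rule joins_A_B[OF joins_char[OF m']])
    have "edge_path X e = (\<lambda>t. \<phi> e (?m t))" by (simp add: fun_eq_iff edge_path_def)
    then have "Q (\<lambda>t. \<phi> e (?m t))" using Q_edge[OF eB 2] by simp
    moreover have "path_hom (TB B) (\<phi> e ?a) (\<phi> e ?b) (\<lambda>t. \<phi> e (?m t))
      (loop_join (loop_join (\<lambda>t. \<phi> e ?a) (\<lambda>t. \<phi> e (?m t))) (\<lambda>t. \<phi> e ?b))"
      using path_hom_sym[OF path_hom_trans[OF path_hom_const_right[OF joins_loop_join[OF joins_const jab]]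
        path_hom_const_left[OF jab]]] joins_endpoints[OF jab] by simp
    ultimately have edge: "conj_Q new_tails (\<phi> e ?a) (\<phi> e ?b) (\<lambda>t. \<phi> e (?m t))"
      unfolding conj_Q_def nt using Q_hom[OF vert] by blast
    consider "u = v" | "u = ?a" "v = ?b" | "u = ?b" "v = ?a"
      using u v boundary_1 2 by auto
    then show ?thesis
    proof cases
      case 1
      have "joins (D e) u v (\<lambda>t. u)" using joins_const[of u "D e"] u 1 by (simp add: topspace_disk_Un)
      then show ?thesis by (rule suff) (use conj_Q_const[OF tails(1)] 1 in simp)
    next
      case 2
      then show ?thesis using suff[of ?m] m' edge by simp
    next
      case 3
      have "conj_Q new_tails (\<phi> e u) (\<phi> e v) (rev_path (\<lambda>t. \<phi> e (?m t)))"
        using conj_Q_rev[OF _ _ jab edge] tails 3 by simp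
      moreover have "joins (D e) u v (rev_path ?m)" using joins_rev[OF m'] 3 by simp
      ultimately show ?thesis using suff[of "rev_path ?m"] by simp
    qed
  qed
qed

text \<open>The path lifts to the open disk, on which the characteristic map is an embedding.
  Prolonged by radii at both ends, the lift becomes a path between boundary points, to which
  \<open>conj_Q_sphere\<close> applies.\<close>

lemma conj_Q_open_cell:
  assumes p: "joins (TB A) x y p" and im: "\<And>t. t \<in> {0..1} \<Longrightarrow> p t \<in> open_cell X e"
  shows "conj_Q new_tails x y p"
proof -
  let ?O = "open_disk (dm e)"
  let ?S = "subtopology (D e) ?O"
  have OD: "?O \<subseteq> topspace (D e)" by (auto simp: topspace_disk_Un)
  have "homeomorphic_map ?S (subtopology T (\<phi> e ` topspace ?S)) (\<phi> e)"
    using embedding_char[OF eC] by (simp add: embedding_map_def)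
  then obtain h where h: "homeomorphic_maps ?S (subtopology T (\<phi> e ` topspace ?S)) (\<phi> e) h"
    by (auto simp: homeomorphic_map_maps)
  have top: "topspace ?S = ?O" using OD by auto
  have imS: "\<phi> e ` topspace ?S = open_cell X e" unfolding top open_cell_def ..
  have p': "continuous_map UI (subtopology T (\<phi> e ` topspace ?S)) p"
    using joins_continuous[OF p] im unfolding imS by (auto simp: continuous_map_in_subtopology)
  define q where "q t = h (p t)" for t
  have "continuous_map UI ?S q"
    unfolding q_def using h by (intro continuous_map_composeI[OF _ p']) (simp add: homeomorphic_maps_def)
  then have q: "continuous_map UI (D e) q" "\<And>t. t \<in> {0..1} \<Longrightarrow> q t \<in> ?O"
    by (auto simp: continuous_map_in_subtopology)
  have pq: "p t = \<phi> e (q t)" if "t \<in> {0..1}" for t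
    using h im[OF that] continuous_map_image_subset_topspace[OF p'] that unfolding homeomorphic_maps_def q_def
    by (auto simp: image_subset_iff)
  have xy: "x = \<phi> e (q 0)" "y = \<phi> e (q 1)" using pq[of 0] pq[of 1] p by (auto simp: joins_def)
  have q01: "q 0 \<in> ?O" "q 1 \<in> ?O" using q(2)[of 0] q(2)[of 1] by auto
  have qj: "joins (D e) (q 0) (q 1) q" using q(1) by (simp add: joins_def pathin_def)
  have tails: "tail_at new_tails x" "tail_at new_tails y"
    using tail_at_new cells_unionI[OF e] q01 by (simp_all add: xy)
  have pq_hom: "path_hom (TB B) x y (\<lambda>t. \<phi> e (q t)) p"
    using path_hom_sym[OF path_hom_eq[OF joins_A_B[OF p] pq]] by simp
  show ?thesis
  proof (cases "dm e = 0")
    case True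
    have px: "p t = x" if "t \<in> {0..1}" for t
    proof -
      have "q t = q 0" using q(2)[OF that] q01(1) True by (simp add: disk_0)
      then show ?thesis using pq[OF that] xy(1) by simp
    qed
    have "x = y" using p px[of 1] by (simp add: joins_def)
    moreover have "path_hom (TB B) x y (\<lambda>t. x) p"
      using path_hom_sym[OF path_hom_eq[OF joins_A_B[OF p] px]] .
    moreover have "conj_Q new_tails x y (\<lambda>t. x)"
      using conj_Q_const[OF tails(1)] calculation(1) by simp
    ultimately show ?thesis using conj_Q_hom[OF tails] by blast
  next
    case False
    then have n: "dm e > 0" by simp
    let ?re = "radius_end (dm e)" and ?r = "radius (dm e)"
    have D01: "q 0 \<in> topspace (D e)" "q 1 \<in> topspace (D e)" using q01 OD by auto
    note re = radius_end_boundary[OF n D01(1)] radius_end_boundary[OF n D01(2)]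
    note rj = radius_joins[OF n D01(1)] radius_joins[OF n D01(2)]
    define m where "m = loop_join (?r (q 0)) (loop_join q (rev_path (?r (q 1))))"
    have m: "joins (D e) (?re (q 0)) (?re (q 1)) m"
      unfolding m_def by (rule joins_loop_join[OF rj(1) joins_loop_join[OF qj joins_rev[OF rj(2)]]])
    \<comment> \<open>The radii are undone again; \<open>w\<close> and \<open>q\<close> have the
      same ends in the disk and are therefore homotopic.\<close>
    define w where "w = loop_join (loop_join (rev_path (?r (q 0))) m) (?r (q 1))"
    have w: "joins (D e) (q 0) (q 1) w"
      unfolding w_def by (rule joins_loop_join[OF joins_loop_join[OF joins_rev[OF rj(1)] m] rj(2)])
    have tb: "tail_at new_tails (\<phi> e (?re (q 0)))" "tail_at new_tails (\<phi> e (?re (q 1)))"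
      using tail_at_new char_in_cells_union[OF A e] re by (simp_all add: topspace_disk_Un)
    have j: "joins (TB B) (\<phi> e (?re (q 0))) x (\<lambda>t. \<phi> e (?r (q 0) t))"
      "joins (TB B) (\<phi> e (?re (q 1))) y (\<lambda>t. \<phi> e (?r (q 1) t))"
      "joins (TB B) (\<phi> e (?re (q 0))) (\<phi> e (?re (q 1))) (\<lambda>t. \<phi> e (m t))"
      unfolding xy using joins_A_B[OF joins_char] rj m by blast+
    have "conj_Q new_tails x y (loop_join (loop_join (rev_path (\<lambda>t. \<phi> e (?r (q 0) t))) (\<lambda>t. \<phi> e (m t))) (\<lambda>t. \<phi> e (?r (q 1) t)))"
    proof (rule conj_Q_join[OF tails(1) tb(2) tails(2) joins_loop_join[OF joins_rev[OF j(1)] j(3)] j(2)])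
      show "conj_Q new_tails x (\<phi> e (?re (q 1))) (loop_join (rev_path (\<lambda>t. \<phi> e (?r (q 0) t))) (\<lambda>t. \<phi> e (m t)))"
      proof (rule conj_Q_join[OF tails(1) tb(1) tb(2) joins_rev[OF j(1)] j(3)])
        show "conj_Q new_tails x (\<phi> e (?re (q 0))) (rev_path (\<lambda>t. \<phi> e (?r (q 0) t)))"
          by (rule conj_Q_rev[OF tb(1) tails(1) j(1)]) (use conj_Q_radius[OF q01(1) n] xy in simp)
        show "conj_Q new_tails (\<phi> e (?re (q 0))) (\<phi> e (?re (q 1))) (\<lambda>t. \<phi> e (m t))"
          by (rule conj_Q_sphere[OF n re m])
      qed
      show "conj_Q new_tails (\<phi> e (?re (q 1))) y (\<lambda>t. \<phi> e (?r (q 1) t))"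
        using conj_Q_radius[OF q01(2) n] xy by simp
    qed
    then have "conj_Q new_tails x y (\<lambda>t. \<phi> e (w t))"
      by (simp add: w_def loop_join_image)
    moreover have "path_hom (TB B) x y (\<lambda>t. \<phi> e (w t)) p"
      using path_hom_trans[OF path_hom_A_B[OF char_path_hom[OF w qj]]] pq_hom xy by simp
    ultimately show ?thesis using conj_Q_hom[OF tails] by blast
  qed
qed

text \<open>Radial stretching pushes the path off the open cell into \<open>A - {e}\<close>, where
  the old tails apply. Meanwhile an end in the open cell moves outwards along a radius, which
  \<open>conj_Q_radius\<close> covers; other ends stay fixed.\<close>

lemma conj_Q_avoid_centre:
  assumes p: "joins (TB A) x y p"
    and im: "\<And>t. t \<in> {0..1} \<Longrightarrow> p t \<notin> \<phi> e ` {y \<in> topspace (D e). dnorm (dm e) y \<le> 1/2}"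
  shows "conj_Q new_tails x y p"
proof -
  \<comment> \<open>Only the cell \<open>e\<close> is deformed. Its boundary stays fixed, and no
    other cell of \<open>A\<close> has \<open>e\<close> in its boundary, since \<open>e\<close> has
    top dimension.\<close>
  obtain \<Delta> where \<Delta>: "\<And>f y. f \<in> A \<Longrightarrow> y \<in> topspace (D f) \<Longrightarrow>
      \<Delta> (\<phi> f y) = (\<lambda>s\<in>{0..1}. if f = e then \<phi> e (stretch (dm e) s y) else \<phi> f y)"
  proof (rule cells_glue[OF A])
    fix f y g z assume "f \<in> A" "g \<in> A" "y \<in> boundary_sphere (dm f)" "z \<in> open_disk (dm g)"
      "dm g < dm f" "\<phi> f y = \<phi> g z"
    then show "(\<lambda>s\<in>{0..1}. if f = e then \<phi> e (stretch (dm e) s y) else \<phi> f y)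
        = (\<lambda>s\<in>{0..1::real}. if g = e then \<phi> e (stretch (dm e) s z) else \<phi> g z)"
      using max[of f] by (auto simp: stretch_boundary fun_eq_iff)
  next
    fix h
    assume "\<And>f y. f \<in> A \<Longrightarrow> y \<in> topspace (D f) \<Longrightarrow>
      h (\<phi> f y) = (\<lambda>s\<in>{0..1}. if f = e then \<phi> e (stretch (dm e) s y) else \<phi> f y)"
    then show thesis by (rule that)
  qed
  have cont: "continuous_map (cyl (TB A)) (TB A) (\<lambda>z. \<Delta> (snd z) (fst z))"
  proof (rule generated_by_continuous_cyl[OF generated_cells[OF A]])
    fix f assume f: "f \<in> A"
    have fc: "continuous_map (D f) (TB A) (\<phi> f)"
      using generated_cells[OF A] f by (simp add: generated_by_def)
    have "continuous_map (cyl (D f)) (TB A) (\<lambda>z. if f = e then \<phi> e (stretch (dm e) (fst z) (snd z)) else \<phi> f (snd z))"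
    proof (cases "f = e")
      case True
      then show ?thesis
        using continuous_map_composeI[OF fc continuous_map_stretch[OF continuous_map_fst continuous_map_snd, of "dm f"]]
        by simp
    next
      case False
      then show ?thesis using continuous_map_composeI[OF fc continuous_map_snd] by simp
    qed
    then show "continuous_map (cyl (D f)) (TB A) (\<lambda>z. \<Delta> (snd (fst z, \<phi> f (snd z))) (fst (fst z, \<phi> f (snd z))))"
      by (rule continuous_map_eq) (use \<Delta>[OF f] in auto)
  qed
  have \<Delta>A': "\<Delta> x s = x" if x: "x \<in> cells_union (A - {e})" and "s \<in> {0..1}" for x s
  proof -
    obtain f z where "f \<in> A - {e}" "z \<in> open_disk (dm f)" "x = \<phi> f z"
      by (rule cells_unionE[OF x])
    then show ?thesis using \<Delta>[of f z] that(2) by (simp add: topspace_disk_Un)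
  qed
  have \<Delta>e: "\<Delta> (\<phi> e y) s = \<phi> e (stretch (dm e) s y)" if "y \<in> open_disk (dm e)" "s \<in> {0..1}" for y s
    using \<Delta>[OF e, of y] that by (simp add: topspace_disk_Un)
  have \<Delta>0: "\<Delta> x 0 = x" if "x \<in> cells_union A" for x
    using that by (rule cells_union_A_cases) (auto simp: \<Delta>A' \<Delta>e stretch_0 topspace_disk_Un)
  have far: "dnorm (dm e) z > 1/2 \<and> dm e > 0" if "t \<in> {0..1}" "z \<in> open_disk (dm e)" "p t = \<phi> e z" for t z
  proof -
    have "\<not> dnorm (dm e) z \<le> 1/2"
      using im[OF that(1)] that(2,3) by (auto simp: topspace_disk_Un)
    moreover have "dm e > 0" using calculation by (cases "dm e = 0") auto
    ultimately show ?thesis by simp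
  qed
  have pA: "p t \<in> cells_union A" if "t \<in> {0..1}" for t using p that by (simp add: joins_subtopology)
  have end_e: "\<Delta> (p t) 1 = \<phi> e (radius_end (dm e) z) \<and> radius_end (dm e) z \<in> boundary_sphere (dm e)"
    if "t \<in> {0..1}" "z \<in> open_disk (dm e)" "p t = \<phi> e z" for t z
    using far[OF that] \<Delta>e[OF that(2), of 1] that radius_end_boundary[of "dm e" z]
    by (auto simp: stretch_1 radius_end_def topspace_disk_Un)
  have \<Delta>1: "\<Delta> (p t) 1 \<in> cells_union (A - {e})" if "t \<in> {0..1}" for t
  proof (rule cells_union_A_cases[OF pA[OF that]])
    fix z assume "z \<in> open_disk (dm e)" "p t = \<phi> e z"
    then show ?thesis using end_e[OF that] boundary_in_A' by metis
  qed (simp add: \<Delta>A')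
  \<comment> \<open>A square with the path on one side, the pushed path on the opposite side, and
    the tracks of the two end points in between.\<close>
  have H: "continuous_map (cyl UI) (TB A) (\<lambda>z. \<Delta> (p (snd z)) (fst z))"
  proof -
    have "continuous_map (cyl UI) (cyl (TB A)) (\<lambda>z. (fst z, p (snd z)))"
      by (intro continuous_map_pairedI continuous_map_fst continuous_map_composeI[OF joins_continuous[OF p]] continuous_map_snd)
    from continuous_map_composeI[OF cont this] show ?thesis by simp
  qed
  define track where "track t = (\<lambda>s. \<Delta> (p t) s)" for t
  have p01: "p 0 = x" "p 1 = y" using p by (simp_all add: joins_def)
  have track: "joins (TB A) (p t) (\<Delta> (p t) 1) (track t)" if t: "t \<in> {0..1}" for t
  proof -
    have "p t \<in> topspace (TB A)" using joins_in_topspace[OF p t] .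
    then have "continuous_map UI (cyl (TB A)) (\<lambda>s. (s, p t))"
      by (intro continuous_map_pairedI continuous_map_ident) auto
    from continuous_map_composeI[OF cont this] show ?thesis
      using \<Delta>0[OF pA[OF t]] by (simp add: track_def[abs_def] joins_def pathin_def)
  qed
  have tails: "tail_at new_tails (p t)" "tail_at new_tails (\<Delta> (p t) 1)" if "t \<in> {0..1}" for t
    using tail_at_new pA[OF that] \<Delta>1[OF that] by (auto simp: cells_union_def)
  have conj_track: "conj_Q new_tails (p t) (\<Delta> (p t) 1) (track t)" if t: "t \<in> {0..1}" for t
  proof (rule cells_union_A_cases[OF pA[OF t]])
    assume pt: "p t \<in> cells_union (A - {e})"
    have "path_hom (TB B) (p t) (p t) (\<lambda>s. p t) (track t)"
      by (rule path_hom_sym[OF path_hom_eq[OF joins_A_B]])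
        (use track[OF t] pt in \<open>simp_all add: track_def \<Delta>A'\<close>)
    then show ?thesis
      using conj_Q_hom[OF tails(1)[OF t] tails(1)[OF t] _ conj_Q_const[OF tails(1)[OF t]]] pt by (simp add: \<Delta>A')
  next
    fix z assume z: "z \<in> open_disk (dm e)" "p t = \<phi> e z"
    have n: "dm e > 0" "dnorm (dm e) z > 1/2" using far[OF t z] by simp_all
    have zD: "z \<in> topspace (D e)" using z by (simp add: topspace_disk_Un)
    have st: "joins (D e) z (radius_end (dm e) z) (\<lambda>s. stretch (dm e) s z)"
    proof -
      have "continuous_map UI (D e) (\<lambda>s. stretch (dm e) s z)"
        by (rule continuous_map_stretch[OF continuous_map_ident]) (use zD in simp)
      then show ?thesis
        using n zD by (auto simp: joins_def pathin_def stretch_0 stretch_1 radius_end_def)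
    qed
    have rj: "joins (TB B) (\<phi> e (radius_end (dm e) z)) (\<phi> e z) (\<lambda>t. \<phi> e (radius (dm e) z t))"
      by (rule joins_A_B[OF joins_char[OF radius_joins[OF n(1) zD]]])
    have e1: "\<Delta> (p t) 1 = \<phi> e (radius_end (dm e) z)" using end_e[OF t z] by simp
    \<comment> \<open>The stretching track and the reversed radius have the same ends in the disk,
      so the one may replace the other.\<close>
    have "conj_Q new_tails (p t) (\<Delta> (p t) 1) (\<lambda>s. \<phi> e (radius (dm e) z (1 - s)))"
      using conj_Q_rev[OF _ _ rj conj_Q_radius[OF z(1) n(1)]] tails[OF t] unfolding e1 unfolding z(2) by blast
    moreover have "path_hom (TB B) (p t) (\<Delta> (p t) 1) (\<lambda>s. \<phi> e (radius (dm e) z (1 - s))) (\<lambda>s. \<phi> e (stretch (dm e) s z))"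
      unfolding e1 unfolding z(2) by (rule path_hom_A_B[OF char_path_hom[OF joins_rev[OF radius_joins[OF n(1) zD]] st]])
    moreover have "path_hom (TB B) (p t) (\<Delta> (p t) 1) (\<lambda>s. \<phi> e (stretch (dm e) s z)) (track t)"
      by (rule path_hom_sym[OF path_hom_eq[OF joins_A_B[OF track[OF t]]]]) (simp add: track_def z(2) \<Delta>e[OF z(1)])
    ultimately show ?thesis using conj_Q_hom[OF tails[OF t]] path_hom_trans by metis
  qed
  let ?r = "\<lambda>t. \<Delta> (p t) 1"
  have r: "joins (TB (A - {e})) (?r 0) (?r 1) ?r"
  proof -
    have "continuous_map UI (cyl (TB A)) (\<lambda>t. (1, p t))"
      by (intro continuous_map_pairedI joins_continuous[OF p]) auto
    from continuous_map_composeI[OF cont this] have "joins (TB A) (?r 0) (?r 1) ?r"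
      by (simp add: joins_def pathin_def)
    then show ?thesis using \<Delta>1 by (simp add: joins_subtopology)
  qed
  have rB: "joins (TB B) (?r 0) (?r 1) ?r" using joins_TB_mono[OF r] AB by blast
  have tr: "joins (TB B) (p 0) (?r 0) (track 0)" "joins (TB B) (p 1) (?r 1) (track 1)"
    using joins_A_B track by auto
  have pB: "joins (TB B) (p 0) (p 1) p" using joins_A_B[OF p] by (simp add: p01)
  have "path_hom (TB A) (p 0) (?r 1) (loop_join p (track 1)) (loop_join (track 0) ?r)"
  proof -
    have sq: "path_hom (TB A) (\<Delta> (p 0) 0) (?r 1) (loop_join (\<lambda>t. \<Delta> (p t) 0) (track 1)) (loop_join (track 0) ?r)"
      using square_imp_path_hom[OF H] by (simp add: track_def)
    have bot: "path_hom (TB A) (p 0) (?r 1) (loop_join p (track 1)) (loop_join (\<lambda>t. \<Delta> (p t) 0) (track 1))"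
    proof (rule path_hom_join[OF path_hom_eq path_hom_refl])
      show "joins (TB A) (p 0) (p 1) p" using p by (simp add: p01)
      show "joins (TB A) (p 1) (?r 1) (track 1)" using track[of 1] by simp
    qed (simp add: \<Delta>0 pA)
    have "\<Delta> (p 0) 0 = p 0" using \<Delta>0 pA by simp
    with path_hom_trans[OF bot] sq show ?thesis by simp
  qed
  then have hom: "path_hom (TB B) (p 0) (p 1) p (loop_join (loop_join (track 0) ?r) (rev_path (track 1)))"
    by (rule path_hom_cancel_right[OF path_hom_A_B pB tr(2)])
  have t01: "(0::real) \<in> {0..1}" "(1::real) \<in> {0..1}" by simp_all
  have c0: "conj_Q new_tails (p 0) (?r 1) (loop_join (track 0) ?r)"
    by (rule conj_Q_join[OF tails(1) tails(2) tails(2) tr(1) rB conj_track conj_Q_A'[OF r]]) (rule t01)+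
  have c1: "conj_Q new_tails (?r 1) (p 1) (rev_path (track 1))"
    by (rule conj_Q_rev[OF tails(1) tails(2) tr(2) conj_track]) (rule t01)+
  have "conj_Q new_tails (p 0) (p 1) (loop_join (loop_join (track 0) ?r) (rev_path (track 1)))"
    by (rule conj_Q_join[OF tails(1) tails(2) tails(1) joins_loop_join[OF tr(1) rB] joins_rev[OF tr(2)] c0 c1])
      (rule t01)+
  then have "conj_Q new_tails (p 0) (p 1) p"
    by (rule conj_Q_hom[OF tails(1)[OF t01(1)] tails(1)[OF t01(2)] path_hom_sym[OF hom]])
  then show ?thesis by (simp add: p01)
qed

text \<open>A path is cut into pieces that either stay in the open top cell or avoid the
  image of the closed disk of radius \<open>1/2\<close>, and hence can be pushed off the top cell.\<close>

lemma good_new_tails: "good_tails A new_tails"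
  unfolding good_tails_def
proof (intro conjI ballI allI impI)
  show "tail_at new_tails x" if "x \<in> cells_union A" for x using tail_at_new that .
  show "new_tails v = (\<lambda>t. v)" if "v \<in> vertices B \<inter> cells_union A" for v using new_tails_vertex that by blast
  fix x y p assume p: "joins (TB A) x y p"
  let ?K = "\<phi> e ` {y \<in> topspace (D e). dnorm (dm e) y \<le> 1/2}"
  have Kclo: "closedin T ?K"
  proof (intro compactin_imp_closedin[OF Hausdorff] compactin_char_image eC)
    have "closedin (D e) {y \<in> topspace (D e). dnorm (dm e) y \<in> {..1/2}}"
      by (rule closedin_continuous_map_preimage[OF continuous_map_dnorm[OF continuous_map_ident]]) auto
    then show "closedin (D e) {y \<in> topspace (D e). dnorm (dm e) y \<le> 1/2}" by simp
  qed
  have KO: "?K \<subseteq> open_cell X e"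
    by (auto simp: open_cell_def open_disk_eq topspace_disk)
  have opens: "openin T (topspace T - ?K)" "openin T (topspace T - cells_union (A - {e}))"
    using Kclo closedin_cells_union[OF A'] by blast+
  have pT: "continuous_map UI T p" using joins_continuous p joins_subtopology by metis
  have pA: "p t \<in> cells_union A" if "t \<in> {0..1}" for t using p that by (simp add: joins_subtopology)
  \<comment> \<open>\<open>Bolzano\<close> takes the place of choosing a subdivision: the property
    passes from adjacent intervals to their union and holds on all short intervals around each
    point.\<close>
  have "0 \<le> (0::real) \<and> (0::real) \<le> 1 \<and> (1::real) \<le> 1 \<longrightarrow> conj_Q new_tails (p 0) (p 1) (path_segment p 0 1)"
  proof (rule Bolzano[where P = "\<lambda>a b. 0 \<le> a \<and> a \<le> b \<and> b \<le> 1 \<longrightarrow> conj_Q new_tails (p a) (p b) (path_segment p a b)"])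
    fix a b c :: real
    assume ab: "0 \<le> a \<and> a \<le> b \<and> b \<le> 1 \<longrightarrow> conj_Q new_tails (p a) (p b) (path_segment p a b)"
      and bc: "0 \<le> b \<and> b \<le> c \<and> c \<le> 1 \<longrightarrow> conj_Q new_tails (p b) (p c) (path_segment p b c)"
      and le: "a \<le> b" "b \<le> c"
    show "0 \<le> a \<and> a \<le> c \<and> c \<le> 1 \<longrightarrow> conj_Q new_tails (p a) (p c) (path_segment p a c)"
    proof
      assume ac: "0 \<le> a \<and> a \<le> c \<and> c \<le> 1"
      have t: "tail_at new_tails (p a)" "tail_at new_tails (p b)" "tail_at new_tails (p c)"
        using tail_at_new pA ac le by auto
      have j: "joins (TB B) (p a) (p b) (path_segment p a b)" "joins (TB B) (p b) (p c) (path_segment p b c)"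
        using joins_path_segment[OF joins_A_B[OF p]] ac le by auto
      have "conj_Q new_tails (p a) (p c) (loop_join (path_segment p a b) (path_segment p b c))"
        using conj_Q_join[OF t j] ab bc ac le by simp
      then show "conj_Q new_tails (p a) (p c) (path_segment p a c)"
        using conj_Q_hom[OF t(1,3) path_segment_join[OF joins_A_B[OF p]]] ac le by auto
    qed
  next
    fix r :: real assume r: "0 \<le> r" "r \<le> 1"
    have *: "\<exists>d>0. \<forall>a b. a \<le> r \<and> r \<le> b \<and> b - a < d \<longrightarrow> 0 \<le> a \<and> a \<le> b \<and> b \<le> 1 \<longrightarrow> conj_Q new_tails (p a) (p b) (path_segment p a b)"
      if W: "openin T W" "p r \<in> W"
        and good: "\<And>u v q. joins (TB A) u v q \<Longrightarrow> (\<And>t. t \<in> {0..1} \<Longrightarrow> q t \<in> W) \<Longrightarrow> conj_Q new_tails u v q" for W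
    proof -
      have "openin UI {t \<in> topspace UI. p t \<in> W}" using pT W(1) by (simp add: continuous_map_def)
      moreover have "r \<in> {t \<in> topspace UI. p t \<in> W}" using r W by simp
      ultimately obtain d where d: "d > 0" "ball r d \<inter> {0..1} \<subseteq> {t \<in> topspace UI. p t \<in> W}"
        unfolding openin_contains_ball by blast
      show ?thesis
      proof (intro exI conjI allI impI)
        fix a b assume ab: "a \<le> r \<and> r \<le> b \<and> b - a < d" "0 \<le> a \<and> a \<le> b \<and> b \<le> 1"
        show "conj_Q new_tails (p a) (p b) (path_segment p a b)"
        proof (rule good)
          show "joins (TB A) (p a) (p b) (path_segment p a b)"
            using joins_path_segment[OF p] ab by blast
          fix t :: real assume "t \<in> {0..1}"
          then have "a + (b - a) * t \<in> {a..b}" using path_segment_range ab by blast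
          then have "a + (b - a) * t \<in> ball r d \<inter> {0..1}" using ab by (auto simp: dist_real_def)
          then show "path_segment p a b t \<in> W" using d(2) by (auto simp: path_segment_def)
        qed
      qed (rule d(1))
    qed
    show "\<exists>d>0. \<forall>a b. a \<le> r \<and> r \<le> b \<and> b - a < d \<longrightarrow> 0 \<le> a \<and> a \<le> b \<and> b \<le> 1 \<longrightarrow> conj_Q new_tails (p a) (p b) (path_segment p a b)"
    proof (cases "p r \<in> ?K")
      case False
      show ?thesis
      proof (rule *[OF opens(1)])
        show "p r \<in> topspace T - ?K"
          using False pA[of r] r cells_union_subset[OF AC] by auto
      qed (use conj_Q_avoid_centre in blast)
    next
      case True
      show ?thesis
      proof (rule *[OF opens(2)])
        have "p r \<notin> cells_union (A - {e})"
          using True KO open_cell_not_A' by (auto simp: open_cell_def)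
        then show "p r \<in> topspace T - cells_union (A - {e})"
          using pA[of r] r cells_union_subset[OF AC] by auto
        fix u v q assume q: "joins (TB A) u v q" "\<And>t. t \<in> {0..1} \<Longrightarrow> q t \<in> topspace T - cells_union (A - {e})"
        show "conj_Q new_tails u v q"
        proof (rule conj_Q_open_cell[OF q(1)])
          fix t :: real assume t: "t \<in> {0..1}"
          have "q t \<in> cells_union A" using q(1) t by (simp add: joins_subtopology)
          then show "q t \<in> open_cell X e"
            by (rule cells_union_A_cases) (use q(2)[OF t] in \<open>auto simp: open_cell_def\<close>)
        qed
      qed
    qed
  qed simp
  moreover have "path_segment p 0 1 = p" by (simp add: path_segment_def fun_eq_iff)
  ultimately show "conj_Q new_tails x y p" using p by (simp add: joins_def)
qed

end

lemma finite_good_tails: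
  assumes "finite A" "cell_closed A" "A \<subseteq> B"
  shows "\<exists>\<tau>. good_tails A \<tau>"
  using assms
proof (induction "card A" arbitrary: A)
  case 0
  then have "cells_union A = {}" by (simp add: cells_union_def)
  then have "\<not> joins (TB A) x y p" for x y p
    using joins_endpoints(1)[of "TB A" x y p] by auto
  then show ?case using \<open>cells_union A = {}\<close> by (simp add: good_tails_def)
next
  case (Suc k)
  then have "A \<noteq> {}" by auto
  then obtain e where e: "e \<in> A" "dm e = Max (dm ` A)"
    using Max_in[of "dm ` A"] Suc.prems(1) by fastforce
  have max: "dm f \<le> dm e" if "f \<in> A" for f using that Suc.prems(1) e by simp
  have "cell_closed (A - {e})" by (rule cell_closed_remove_top[OF Suc.prems(2) max])
  moreover have "k = card (A - {e})" using Suc.hyps(2) e Suc.prems(1) by simp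
  ultimately obtain \<tau>' where "good_tails (A - {e}) \<tau>'"
    using Suc.hyps(1)[of "A - {e}"] Suc.prems by blast
  then show ?case using good_new_tails[OF Suc.prems(2,3) e(1) max] by blast
qed

text \<open>By compactness the path lies in a finite subcomplex, for which good tails exist. They
  are constant at the two vertices, so the conjugation disappears up to homotopy.\<close>

lemma path_predicate_holds:
  assumes v: "v \<in> vertices B" and w: "w \<in> vertices B" and p: "joins (TB B) v w p"
  shows "Q p"
proof -
  have "compactin T (p ` {0..1})"
  proof (rule image_compactin)
    show "continuous_map UI T p" using joins_continuous p joins_subtopology by metis
  qed (simp add: compactin_subtopology)
  moreover have "p ` {0..1} \<subseteq> cells_union B" using p by (auto simp: joins_subtopology)
  ultimately obtain F where F: "finite F" "cell_closed F" "F \<subseteq> B" "p ` {0..1} \<subseteq> cells_union F"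
    by (rule compact_finite_cells[OF closed])
  obtain \<tau> where \<tau>: "good_tails F \<tau>" using finite_good_tails[OF F(1-3)] by blast
  have pF: "joins (TB F) v w p" using p F(4) by (auto simp: joins_subtopology)
  have "v \<in> p ` {0..1}" "w \<in> p ` {0..1}" using p by (auto simp: joins_def intro: image_eqI[of _ _ 0] image_eqI[of _ _ 1])
  then have "\<tau> v = (\<lambda>t. v)" "\<tau> w = (\<lambda>t. w)" using \<tau> v w F(4) by (auto simp: good_tails_def)
  moreover have "conj_Q \<tau> v w p" using \<tau> pF by (simp add: good_tails_def)
  ultimately have "Q (loop_join (loop_join (\<lambda>t. v) p) (\<lambda>t. w))" by (simp add: conj_Q_def)
  moreover have "path_hom (TB B) v w (loop_join (loop_join (\<lambda>t. v) p) (\<lambda>t. w)) p"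
    by (rule path_hom_trans[OF path_hom_const_right[OF joins_loop_join[OF joins_const p]] path_hom_const_left[OF p]])
      (rule joins_endpoints(1)[OF p])
  ultimately show ?thesis using Q_hom[OF v w] by blast
qed

end

subsection \<open>Cofibrations\<close>

text \<open>A retraction of the cylinder onto base and wall, regarded as a self-map of the cylinder.
  For closed \<open>A\<close> this expresses the homotopy extension property without quantifying
  over target spaces of all types.\<close>

definition cofibration :: "'a topology \<Rightarrow> 'a set \<Rightarrow> bool" where
  "cofibration X A \<longleftrightarrow> closedin X A \<and>
     (\<exists>R. continuous_map (cyl X) (cyl X) R \<and> (\<forall>x\<in>topspace X. R (0, x) = (0, x)) \<and>
        (\<forall>t\<in>{0..1}. \<forall>x\<in>A. R (t, x) = (t, x)) \<and>
        (\<forall>z\<in>topspace (cyl X). fst (R z) = 0 \<or> snd (R z) \<in> A))"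

lemma cofibrationE:
  assumes "cofibration X A"
  obtains R where "continuous_map (cyl X) (cyl X) R" "\<And>x. x \<in> topspace X \<Longrightarrow> R (0, x) = (0, x)"
    "\<And>t x. t \<in> {0..1} \<Longrightarrow> x \<in> A \<Longrightarrow> R (t, x) = (t, x)"
    "\<And>z. z \<in> topspace (cyl X) \<Longrightarrow> fst (R z) = 0 \<or> snd (R z) \<in> A"
  using assms unfolding cofibration_def by (elim conjE exE) blast

lemma cofibration_closedin: "cofibration X A \<Longrightarrow> closedin X A"
  by (simp add: cofibration_def)

text \<open>Retract to base and wall, then apply \<open>f\<close> on the base and \<open>h\<close>
  on the wall. The preimages of both parts are closed, so the two maps can be pasted.\<close>

lemma homotopy_extension:
  assumes cof: "cofibration X A" and f: "continuous_map X Z f"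
    and h: "continuous_map (cyl (subtopology X A)) Z h" and hf: "\<And>x. x \<in> A \<Longrightarrow> h (0, x) = f x"
  obtains F where "continuous_map (cyl X) Z F" "\<And>x. x \<in> topspace X \<Longrightarrow> F (0, x) = f x"
    "\<And>t x. t \<in> {0..1} \<Longrightarrow> x \<in> A \<Longrightarrow> F (t, x) = h (t, x)"
proof -
  obtain R where R: "continuous_map (cyl X) (cyl X) R" "\<And>x. x \<in> topspace X \<Longrightarrow> R (0, x) = (0, x)"
    "\<And>t x. t \<in> {0..1} \<Longrightarrow> x \<in> A \<Longrightarrow> R (t, x) = (t, x)"
    "\<And>z. z \<in> topspace (cyl X) \<Longrightarrow> fst (R z) = 0 \<or> snd (R z) \<in> A"
    by (rule cofibrationE[OF cof]) blast
  define F where "F z = (if fst (R z) = 0 then f (snd (R z)) else h (R z))" for z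
  have R1: "continuous_map (cyl X) euclideanreal (\<lambda>z. fst (R z))"
    by (rule continuous_map_composeI[OF continuous_map_fst_cyl R(1)])
  have R2: "continuous_map (cyl X) X (\<lambda>z. snd (R z))"
    by (rule continuous_map_composeI[OF continuous_map_snd R(1)])
  \<comment> \<open>\<open>True\<close> stands for the preimage of the base, \<open>False\<close>
    for that of the wall.\<close>
  let ?S = "\<lambda>b. if b then {z \<in> topspace (cyl X). fst (R z) = 0} else {z \<in> topspace (cyl X). snd (R z) \<in> A}"
  have Sclo: "closedin (cyl X) (?S b)" for b
  proof (cases b)
    case True
    have "closedin (cyl X) {z \<in> topspace (cyl X). fst (R z) \<in> {0}}"
      by (rule closedin_continuous_map_preimage[OF R1]) simp
    then show ?thesis using True by simp
  next
    case False
    then show ?thesis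
      using closedin_continuous_map_preimage[OF R2 cofibration_closedin[OF cof]] by simp
  qed
  have cont: "continuous_map (subtopology (cyl X) (?S b)) Z (if b then (\<lambda>z. f (snd (R z))) else (\<lambda>z. h (R z)))" for b
  proof (cases b)
    case True
    then show ?thesis
      using continuous_map_from_subtopology[OF continuous_map_composeI[OF f R2]] by simp
  next
    case False
    have "continuous_map (subtopology (cyl X) (?S b)) (cyl (subtopology X A)) R"
      unfolding continuous_map_pairwise
      using continuous_map_from_subtopology[OF R(1)] False
      by (auto simp: continuous_map_pairwise continuous_map_in_subtopology)
    then show ?thesis using False continuous_map_composeI[OF h] by auto
  qed
  have "continuous_map (cyl X) Z F"
  proof (rule pasting_lemma_closed[of "UNIV :: bool set" "cyl X" ?S Z "\<lambda>b. if b then (\<lambda>z. f (snd (R z))) else (\<lambda>z. h (R z))"])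
    fix b c z assume "z \<in> topspace (cyl X) \<inter> ?S b \<inter> ?S c"
    then show "(if b then (\<lambda>z. f (snd (R z))) else (\<lambda>z. h (R z))) z = (if c then (\<lambda>z. f (snd (R z))) else (\<lambda>z. h (R z))) z"
      using hf[of "snd (R z)"] by (cases "R z") (auto split: if_splits)
  next
    fix z assume z: "z \<in> topspace (cyl X)"
    show "\<exists>b. b \<in> UNIV \<and> z \<in> ?S b \<and> F z = (if b then (\<lambda>z. f (snd (R z))) else (\<lambda>z. h (R z))) z"
    proof (cases "fst (R z) = 0")
      case True
      then show ?thesis using z by (intro exI[of _ True]) (simp add: F_def)
    next
      case False
      then show ?thesis using z R(4)[OF z] by (intro exI[of _ False]) (simp add: F_def)
    qed
  qed (use Sclo cont in auto)
  then show ?thesis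
    by (rule that) (use R hf in \<open>auto simp: F_def\<close>)
qed

lemma homotopy_extension_end:
  assumes cof: "cofibration X A" and f: "continuous_map X Z f"
    and h: "continuous_map (cyl (subtopology X A)) Z h" and hf: "\<And>x. x \<in> A \<Longrightarrow> h (1, x) = f x"
  obtains F where "continuous_map (cyl X) Z F" "\<And>x. x \<in> topspace X \<Longrightarrow> F (1, x) = f x"
    "\<And>t x. t \<in> {0..1} \<Longrightarrow> x \<in> A \<Longrightarrow> F (t, x) = h (t, x)"
proof -
  obtain F where F: "continuous_map (cyl X) Z F" "\<And>x. x \<in> topspace X \<Longrightarrow> F (0, x) = f x"
    "\<And>t x. t \<in> {0..1} \<Longrightarrow> x \<in> A \<Longrightarrow> F (t, x) = h (1 - t, x)"
    using homotopy_extension[OF cof f continuous_map_reverse[OF h]] hf by auto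
  show ?thesis
    by (rule that[OF continuous_map_reverse[OF F(1)]]) (use F in auto)
qed

text \<open>Two extensions of a homotopy end in maps that are homotopic relative to the subspace:
  deform the cylinder into the union of its base and its wall.\<close>

lemma homotopy_extension_unique:
  assumes cof: "cofibration X A" and F: "continuous_map (cyl X) Z F" and F': "continuous_map (cyl X) Z F'"
    and base: "\<And>x. x \<in> topspace X \<Longrightarrow> F (0, x) = F' (0, x)"
    and wall: "\<And>t x. t \<in> {0..1} \<Longrightarrow> x \<in> A \<Longrightarrow> F (t, x) = F' (t, x)"
  obtains G where "continuous_map (cyl X) Z G" "\<And>x. x \<in> topspace X \<Longrightarrow> G (0, x) = F (1, x)"
    "\<And>x. x \<in> topspace X \<Longrightarrow> G (1, x) = F' (1, x)" "\<And>t x. t \<in> {0..1} \<Longrightarrow> x \<in> A \<Longrightarrow> G (t, x) = F (1, x)"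
proof -
  obtain R where R: "continuous_map (cyl X) (cyl X) R" "\<And>x. x \<in> topspace X \<Longrightarrow> R (0, x) = (0, x)"
    "\<And>t x. t \<in> {0..1} \<Longrightarrow> x \<in> A \<Longrightarrow> R (t, x) = (t, x)"
    "\<And>z. z \<in> topspace (cyl X) \<Longrightarrow> fst (R z) = 0 \<or> snd (R z) \<in> A"
    by (rule cofibrationE[OF cof]) blast
  have AX: "A \<subseteq> topspace X" using cofibration_closedin[OF cof] closedin_subset by blast
  have RX: "fst (R z) \<in> {0..1}" "snd (R z) \<in> topspace X" if "z \<in> topspace (cyl X)" for z
  proof -
    have "R z \<in> topspace (cyl X)" using R(1) that by (auto simp: continuous_map_def Pi_iff)
    then show "fst (R z) \<in> {0..1}" "snd (R z) \<in> topspace X" by auto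
  qed
  \<comment> \<open>Moves \<open>(1, x)\<close> to \<open>R (1, x)\<close>, hence from the lid into
    the union of base and wall, where \<open>F\<close> and \<open>F'\<close> agree. Points of the
    lid over \<open>A\<close> do not move.\<close>
  define D where "D z = ((1 - fst z) + fst z * fst (R (1, snd z)), snd (R z))" for z
  have D: "continuous_map (cyl X) (cyl X) D"
    unfolding D_def
  proof (rule continuous_map_cyl)
    have "continuous_map (cyl X) (cyl X) (\<lambda>z. (1, snd z))"
      by (intro continuous_map_cyl continuous_map_snd) auto
    from continuous_map_composeI[OF R(1) this]
    have "continuous_map (cyl X) euclideanreal (\<lambda>z. fst (R (1, snd z)))"
      by (rule continuous_map_composeI[OF continuous_map_fst_cyl])
    then show "continuous_map (cyl X) euclideanreal (\<lambda>z. 1 - fst z + fst z * fst (R (1, snd z)))"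
      by (intro continuous_intros continuous_map_fst_cyl) auto
    show "continuous_map (cyl X) X (\<lambda>z. snd (R z))"
      by (rule continuous_map_composeI[OF continuous_map_snd R(1)])
    fix z assume z: "z \<in> topspace (cyl X)"
    then have t: "fst z \<in> {0..1}" and r: "fst (R (1, snd z)) \<in> {0..1}" using RX(1)[of "(1, snd z)"] by auto
    have "fst z * fst (R (1, snd z)) \<le> fst z" "0 \<le> fst z * fst (R (1, snd z))"
      using t r by (auto simp: mult_left_le)
    then show "0 \<le> 1 - fst z + fst z * fst (R (1, snd z)) \<and> 1 - fst z + fst z * fst (R (1, snd z)) \<le> 1"
      using t by auto
  qed
  have D0: "D (0, x) = (1, x)" and D1: "D (1, x) = R (1, x)" if "x \<in> topspace X" for x
    using R(2)[OF that] by (simp_all add: D_def)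
  have DA: "D (t, x) = (1, x)" if "t \<in> {0..1}" "x \<in> A" for t x
    using R(3)[OF that] R(3)[of 1 x] that by (simp add: D_def)
  have eq: "F (R (1, x)) = F' (R (1, x))" if x: "x \<in> topspace X" for x
  proof -
    have z: "(1, x) \<in> topspace (cyl X)" using x by simp
    have "R (1, x) = (fst (R (1, x)), snd (R (1, x)))" by simp
    then show ?thesis using R(4)[OF z] RX[OF z] base wall by metis
  qed
  define G where "G = hcat (\<lambda>z. F (D z)) (\<lambda>z. F' (D (1 - fst z, snd z)))"
  have "continuous_map (cyl X) Z G"
    unfolding G_def
  proof (rule continuous_map_hcat)
    show "continuous_map (cyl X) Z (\<lambda>z. F (D z))" by (rule continuous_map_composeI[OF F D])
    show "continuous_map (cyl X) Z (\<lambda>z. F' (D (1 - fst z, snd z)))"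
      by (rule continuous_map_reverse[OF continuous_map_composeI[OF F' D]])
  qed (simp add: D1 eq)
  then show ?thesis
  proof (rule that)
    show "G (t, x) = F (1, x)" if "t \<in> {0..1}" "x \<in> A" for t x
      using that DA[of "2*t" x] DA[of "1 - (2*t - 1)" x] wall[of 1 x] by (auto simp: G_def hcat_def)
  qed (simp_all add: G_def D0 D1)
qed

text \<open>Given a retraction \<open>\<rho>\<close> and a homotopy \<open>J\<close> from \<open>\<rho>\<close> to the identity, both \<open>J\<close> and \<open>J\<close> after \<open>\<rho>\<close>
  start at \<open>\<rho>\<close> and agree on the subspace, so their ends are homotopic relative to it.\<close>

lemma homotopy_equivalence_deformation_retract:
  assumes cof: "cofibration X A" and he: "homotopy_equivalence_map (subtopology X A) X (\<lambda>x. x)"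
  obtains \<rho> K where "continuous_map X (subtopology X A) \<rho>" "continuous_map (cyl X) X K"
    "\<And>x. x \<in> topspace X \<Longrightarrow> K (0, x) = \<rho> x" "\<And>x. x \<in> topspace X \<Longrightarrow> K (1, x) = x"
    "\<And>t x. t \<in> {0..1} \<Longrightarrow> x \<in> A \<Longrightarrow> K (t, x) = x" "\<And>x. x \<in> A \<Longrightarrow> \<rho> x = x"
proof -
  let ?A = "subtopology X A"
  have AX: "A \<subseteq> topspace X" using cofibration_closedin[OF cof] closedin_subset by blast
  obtain g where g: "continuous_map X ?A g"
    and gi: "homotopic_with (\<lambda>h. True) ?A ?A (g \<circ> (\<lambda>x. x)) id"
    and ig: "homotopic_with (\<lambda>h. True) X X ((\<lambda>x. x) \<circ> g) id"
    using he by (auto simp: homotopy_equivalence_map_def)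
  obtain k where k: "continuous_map (cyl ?A) ?A k" "\<And>x. k (0, x) = g x" "\<And>x. k (1, x) = x"
    using gi unfolding homotopic_with_def by auto
  obtain l where l: "continuous_map (cyl X) X l" "\<And>x. l (0, x) = g x" "\<And>x. l (1, x) = x"
    using ig unfolding homotopic_with_def by auto
  obtain F where F: "continuous_map (cyl X) ?A F" "\<And>x. x \<in> topspace X \<Longrightarrow> F (0, x) = g x"
    "\<And>t x. t \<in> {0..1} \<Longrightarrow> x \<in> A \<Longrightarrow> F (t, x) = k (t, x)"
    using homotopy_extension[OF cof g k(1)] k(2) by metis
  define \<rho> where "\<rho> x = F (1, x)" for x
  have \<rho>: "continuous_map X ?A \<rho>"
  proof -
    have "continuous_map X (cyl X) (\<lambda>x. (1, x))"
      by (intro continuous_map_cyl continuous_map_ident) auto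
    from continuous_map_composeI[OF F(1) this] show ?thesis by (simp add: \<rho>_def[abs_def])
  qed
  have \<rho>A: "\<rho> x = x" if "x \<in> A" for x using F(3)[of 1 x] k(3) that by (simp add: \<rho>_def)
  have \<rho>X: "\<rho> x \<in> A" "\<rho> x \<in> topspace X" if "x \<in> topspace X" for x
    using \<rho> that by (auto simp: continuous_map_def Pi_iff)
  \<comment> \<open>Backwards along \<open>F\<close> from \<open>\<rho>\<close> to \<open>g\<close>,
    then along \<open>l\<close> from \<open>g\<close> to the identity.\<close>
  define J where "J = hcat (\<lambda>z. F (1 - fst z, snd z)) l"
  have J: "continuous_map (cyl X) X J"
    unfolding J_def
  proof (rule continuous_map_hcat)
    show "continuous_map (cyl X) X (\<lambda>z. F (1 - fst z, snd z))"
      using continuous_map_reverse[OF F(1)] continuous_map_in_subtopology by blast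
  qed (use F(2) l in auto)
  have J01: "J (0, x) = \<rho> x" "J (1, x) = x" for x
    using l by (simp_all add: J_def \<rho>_def)
  have J': "continuous_map (cyl X) X (\<lambda>z. J (fst z, \<rho> (snd z)))"
  proof (rule continuous_map_composeI[OF J])
    have "continuous_map X X \<rho>" using \<rho> continuous_map_in_subtopology by blast
    then show "continuous_map (cyl X) (cyl X) (\<lambda>z. (fst z, \<rho> (snd z)))"
      by (intro continuous_map_pairedI continuous_map_fst continuous_map_composeI[OF _ continuous_map_snd])
  qed
  obtain G where G: "continuous_map (cyl X) X G" "\<And>x. x \<in> topspace X \<Longrightarrow> G (0, x) = x"
    "\<And>x. x \<in> topspace X \<Longrightarrow> G (1, x) = \<rho> x" "\<And>t x. t \<in> {0..1} \<Longrightarrow> x \<in> A \<Longrightarrow> G (t, x) = x"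
    using homotopy_extension_unique[OF cof J J'] by (auto simp: J01 \<rho>A \<rho>X)
  show ?thesis
    by (rule that[OF \<rho> continuous_map_reverse[OF G(1)]]) (use G \<rho>A in auto)
qed

lemma continuous_map_time:
  assumes "continuous_map (cyl X) Y K" "t \<in> {0..1}"
  shows "continuous_map X Y (\<lambda>x. K (t, x))"
  by (rule continuous_map_composeI[OF assms(1)], intro continuous_map_cyl continuous_map_ident) (use assms(2) in auto)

text \<open>Deform \<open>a\<close> into \<open>M\<close>, lift there by means of \<open>\<rho>N\<close>, and undo the deformation. On \<open>A\<close> the resulting
  homotopy runs along a path and back again, which \<open>homotopy_extension_unique\<close> allows to cancel.
  The conclusion only controls the set of points through which \<open>H'\<close> moves a point of \<open>A\<close>, because
  the time parameter of \<open>H\<close> gets changed.\<close>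

lemma relative_lifting:
  assumes iW: "continuous_map M W iW" and f: "continuous_map W N f"
    and fi: "\<And>x. x \<in> topspace M \<Longrightarrow> f (iW x) = iN x"
    and \<rho>W: "continuous_map W M \<rho>W" and E: "continuous_map (cyl W) W E"
    and E0: "\<And>w. w \<in> topspace W \<Longrightarrow> E (0, w) = iW (\<rho>W w)" and E1: "\<And>w. w \<in> topspace W \<Longrightarrow> E (1, w) = w"
    and \<rho>N: "continuous_map N M \<rho>N" and K: "continuous_map (cyl N) N K"
    and K0: "\<And>y. y \<in> topspace N \<Longrightarrow> K (0, y) = iN (\<rho>N y)" and K1: "\<And>y. y \<in> topspace N \<Longrightarrow> K (1, y) = y"
    and Kconst: "\<And>t x. t \<in> {0..1} \<Longrightarrow> x \<in> topspace M \<Longrightarrow> K (t, iN x) = iN x"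
    and \<rho>Ni: "\<And>x. x \<in> topspace M \<Longrightarrow> \<rho>N (iN x) = x"
    and cof: "cofibration X A" and a: "continuous_map (subtopology X A) W a" and b: "continuous_map X N b"
    and H: "continuous_map (cyl (subtopology X A)) N H"
    and H0: "\<And>x. x \<in> A \<Longrightarrow> H (0, x) = f (a x)" and H1: "\<And>x. x \<in> A \<Longrightarrow> H (1, x) = b x"
  obtains a' H' where "continuous_map X W a'" "\<And>x. x \<in> A \<Longrightarrow> a' x = a x"
    "continuous_map (cyl X) N H'" "\<And>x. x \<in> topspace X \<Longrightarrow> H' (0, x) = f (a' x)"
    "\<And>x. x \<in> topspace X \<Longrightarrow> H' (1, x) = b x"
    "\<And>t x. t \<in> {0..1} \<Longrightarrow> x \<in> A \<Longrightarrow> \<exists>s\<in>{0..1}. H' (t, x) = H (s, x)"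
proof -
  let ?A = "subtopology X A"
  have AX: "A \<subseteq> topspace X" using cofibration_closedin[OF cof] closedin_subset by blast
  have aW: "a x \<in> topspace W" if "x \<in> A" for x
    using a that AX by (auto simp: continuous_map_def Pi_iff)
  have M: "\<rho>W (a x) \<in> topspace M" if "x \<in> A" for x
    using \<rho>W aW[OF that] by (auto simp: continuous_map_def Pi_iff)
  \<comment> \<open>Pulls \<open>b\<close> back along \<open>H\<close> until it restricts to
    \<open>f\<close> after \<open>a\<close> on \<open>A\<close>.\<close>
  obtain G where G: "continuous_map (cyl X) N G" "\<And>x. x \<in> topspace X \<Longrightarrow> G (1, x) = b x"
    "\<And>t x. t \<in> {0..1} \<Longrightarrow> x \<in> A \<Longrightarrow> G (t, x) = H (t, x)"
    by (rule homotopy_extension_end[OF cof b H H1]) blast+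
  define b0 where "b0 x = G (0, x)" for x
  have b0: "continuous_map X N b0" unfolding b0_def by (rule continuous_map_time[OF G(1)]) simp
  have b0A: "b0 x = f (a x)" if "x \<in> A" for x using G(3)[of 0 x] H0 that by (simp add: b0_def)
  have Ea: "continuous_map (cyl ?A) W (\<lambda>z. E (fst z, a (snd z)))"
    by (rule continuous_map_composeI[OF E])
      (intro continuous_map_pairedI continuous_map_fst continuous_map_composeI[OF a continuous_map_snd])
  have Ea': "continuous_map (cyl ?A) W (\<lambda>z. E (1 - fst z, a (snd z)))"
    using continuous_map_reverse[OF Ea] by simp
  \<comment> \<open>Moves on until the restriction to \<open>A\<close> is the retraction of
    \<open>a\<close> into \<open>M\<close>, where lifting is immediate.\<close>
  obtain G1 where G1: "continuous_map (cyl X) N G1" "\<And>x. x \<in> topspace X \<Longrightarrow> G1 (0, x) = b0 x"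
    "\<And>t x. t \<in> {0..1} \<Longrightarrow> x \<in> A \<Longrightarrow> G1 (t, x) = f (E (1 - t, a x))"
    using homotopy_extension[OF cof b0 continuous_map_composeI[OF f Ea']] E1 aW b0A by auto
  define b1 where "b1 x = G1 (1, x)" for x
  have b1: "continuous_map X N b1" unfolding b1_def by (rule continuous_map_time[OF G1(1)]) simp
  have b1X: "b1 x \<in> topspace N" if "x \<in> topspace X" for x
    using b1 that by (auto simp: continuous_map_def Pi_iff)
  have b1A: "b1 x = iN (\<rho>W (a x))" if "x \<in> A" for x
    using G1(3)[of 1 x] that E0[OF aW[OF that]] fi[OF M[OF that]] by (simp add: b1_def)
  have a1: "continuous_map X M (\<lambda>x. \<rho>N (b1 x))" by (rule continuous_map_composeI[OF \<rho>N b1])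
  have a1X: "\<rho>N (b1 x) \<in> topspace M" if "x \<in> topspace X" for x
    using a1 that by (auto simp: continuous_map_def Pi_iff)
  have ia1: "continuous_map X W (\<lambda>x. iW (\<rho>N (b1 x)))" by (rule continuous_map_composeI[OF iW a1])
  \<comment> \<open>The lift is \<open>\<rho>N\<close> after \<open>b1\<close>, placed in
    \<open>W\<close> by \<open>iW\<close>. On \<open>A\<close> it is the retracted \<open>a\<close>,
    so \<open>E\<close> carries it back to \<open>a\<close> there.\<close>
  obtain G2 where G2: "continuous_map (cyl X) W G2" "\<And>x. x \<in> topspace X \<Longrightarrow> G2 (0, x) = iW (\<rho>N (b1 x))"
    "\<And>t x. t \<in> {0..1} \<Longrightarrow> x \<in> A \<Longrightarrow> G2 (t, x) = E (t, a x)"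
    using homotopy_extension[OF cof ia1 Ea] E0 aW b1A M \<rho>Ni by auto
  define a' where "a' x = G2 (1, x)" for x
  have a': "continuous_map X W a'" unfolding a'_def by (rule continuous_map_time[OF G2(1)]) simp
  have a'A: "a' x = a x" if "x \<in> A" for x
    using G2(3)[of 1 x] that E1 aW by (simp add: a'_def)
  \<comment> \<open>Two homotopies starting at \<open>b1\<close>, one ending at \<open>b0\<close>,
    the other at \<open>f\<close> after the lift \<open>a'\<close>. The pause in the first half of
    \<open>F\<close> matches the first half of \<open>F'\<close> on \<open>A\<close>, where
    \<open>K\<close> fixes points of \<open>M\<close>; so both agree on \<open>A\<close>, and their
    ends are homotopic relative to it.\<close>
  define F where "F = hcat (\<lambda>z. b1 (snd z)) (\<lambda>z. G1 (1 - fst z, snd z))"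
  have F: "continuous_map (cyl X) N F"
    unfolding F_def
    by (rule continuous_map_hcat[OF continuous_map_composeI[OF b1 continuous_map_snd] continuous_map_reverse[OF G1(1)]])
      (simp add: b1_def)
  define F' where "F' = hcat (\<lambda>z. K (1 - fst z, b1 (snd z))) (\<lambda>z. f (G2 z))"
  have "continuous_map (cyl X) N (\<lambda>z. K (fst z, b1 (snd z)))"
    by (rule continuous_map_composeI[OF K])
      (intro continuous_map_pairedI continuous_map_fst continuous_map_composeI[OF b1 continuous_map_snd])
  from continuous_map_reverse[OF this]
  have Kr: "continuous_map (cyl X) N (\<lambda>z. K (1 - fst z, b1 (snd z)))" by simp
  have F': "continuous_map (cyl X) N F'"
    unfolding F'_def
    by (rule continuous_map_hcat[OF Kr continuous_map_composeI[OF f G2(1)]])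
      (simp add: K0 b1X G2(2) fi a1X)
  have wall: "F (t, x) = F' (t, x)" if "t \<in> {0..1}" "x \<in> A" for t x
    using that M[of x] Kconst[of "1 - 2*t" "\<rho>W (a x)"] G1(3)[of "1 - (2*t - 1)" x] G2(3)[of "2*t - 1" x]
    by (auto simp: F_def F'_def hcat_def b1A)
  have base: "F (0, x) = F' (0, x)" if "x \<in> topspace X" for x
    using K1 b1X that by (simp add: F_def F'_def)
  obtain G3 where G3: "continuous_map (cyl X) N G3" "\<And>x. x \<in> topspace X \<Longrightarrow> G3 (0, x) = F (1, x)"
    "\<And>x. x \<in> topspace X \<Longrightarrow> G3 (1, x) = F' (1, x)" "\<And>t x. t \<in> {0..1} \<Longrightarrow> x \<in> A \<Longrightarrow> G3 (t, x) = F (1, x)"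
    by (rule homotopy_extension_unique[OF cof F F' base wall]) blast+
  define H' where "H' = hcat (\<lambda>z. G3 (1 - fst z, snd z)) G"
  have H': "continuous_map (cyl X) N H'"
    unfolding H'_def
    by (rule continuous_map_hcat[OF continuous_map_reverse[OF G3(1)] G(1)])
      (simp add: G3(2) F_def G1(2) b0_def)
  show ?thesis
  proof (rule that[OF a' a'A H'])
    show "H' (0, x) = f (a' x)" "H' (1, x) = b x" if "x \<in> topspace X" for x
      using that by (simp_all add: H'_def G3(3) F'_def a'_def G(2))
    fix t :: real and x assume t: "t \<in> {0..1}" and x: "x \<in> A"
    show "\<exists>s\<in>{0..1}. H' (t, x) = H (s, x)"
    proof (cases "t \<le> 1/2")
      case True
      then have "H' (t, x) = F (1, x)" using G3(4)[of "1 - 2*t" x] t x by (simp add: H'_def hcat_def)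
      also have "\<dots> = H (0, x)" using x AX G1(2)[of x] H0 b0A by (auto simp: F_def)
      finally show ?thesis by (intro bexI[of _ 0]) auto
    next
      case False
      then have "H' (t, x) = H (2*t - 1, x)" using G(3)[of "2*t - 1" x] t x by (simp add: H'_def hcat_def)
      then show ?thesis using False t by (intro bexI[of _ "2*t - 1"]) auto
    qed
  qed
qed

lemma cofibration_disk: "cofibration (disk n) (boundary_sphere n)"
  unfolding cofibration_def
proof (intro conjI exI)
  have "closedin (disk n) {y \<in> topspace (disk n). dnorm n y \<in> {1}}"
    by (rule closedin_continuous_map_preimage[OF continuous_map_dnorm[OF continuous_map_ident]]) auto
  moreover have "{y \<in> topspace (disk n). dnorm n y \<in> {1}} = boundary_sphere n"
    by (auto simp: topspace_disk boundary_sphere_eq)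
  ultimately show "closedin (disk n) (boundary_sphere n)" by simp
  show "continuous_map (cyl (disk n)) (cyl (disk n)) (disk_retract n)" by (rule continuous_map_disk_retract)
  show "\<forall>z\<in>topspace (cyl (disk n)). fst (disk_retract n z) = 0 \<or> snd (disk_retract n z) \<in> boundary_sphere n"
    using disk_retract_cases(3) by auto
qed (auto simp: disk_retract_0 disk_retract_boundary)

section \<open>Subcomplexes are cofibrations\<close>

context cw_complex_space
begin

text \<open>The retraction is extended one dimension at a time: on each new cell it is known over
  the boundary and extends because the sphere is a cofibration in the disk. The weak topology makes
  the union of the stages continuous.\<close>

lemma cofibration_cells_union:
  assumes B: "cell_closed B"
  shows "cofibration T (cells_union B)"
proof -
  \<comment> \<open>The strict bound makes \<open>Bk 0\<close> equal to \<open>B\<close>.\<close>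
  define Bk where "Bk k = B \<union> {e \<in> C. dm e < k}" for k
  have BC: "B \<subseteq> C" using B cell_closed_subset by blast
  have Bk: "cell_closed (Bk k)" for k
  proof (cases k)
    case (Suc j)
    then show ?thesis
      using cell_closed_Un[OF B cell_closed_skeleton[OF cell_closed_all, of j]] by (simp add: Bk_def less_Suc_eq_le)
  qed (simp add: Bk_def B)
  have Bk_mono: "cells_union (Bk k) \<subseteq> cells_union (Bk (Suc k))" for k
    by (auto simp: cells_union_def Bk_def)
  \<comment> \<open>Base and wall of the cylinder. With this space as target, every extension stays
    inside it automatically.\<close>
  define Z where "Z = subtopology (cyl T) ({0} \<times> topspace T \<union> {0..1} \<times> cells_union B)"
  \<comment> \<open>Curried with the point first, because \<open>cells_glue\<close> glues functions
    of points whose values here are functions of time.\<close>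
  define P where "P k R \<longleftrightarrow> continuous_map (cyl (TB (Bk k))) Z (\<lambda>z. R (snd z) (fst z)) \<and>
     (\<forall>x\<in>cells_union (Bk k). R x 0 = (0, x)) \<and> (\<forall>x\<in>cells_union B. \<forall>t\<in>{0..1}. R x t = (t, x))"
    for k and R :: "'a \<Rightarrow> real \<Rightarrow> real \<times> 'a"
  define Q where "Q k R R' \<longleftrightarrow> (\<forall>x\<in>cells_union (Bk k). \<forall>t\<in>{0..1}. R' x t = R x t)"
    for k and R R' :: "'a \<Rightarrow> real \<Rightarrow> real \<times> 'a"
  have base: "P 0 (\<lambda>x t. (t, x))"
    unfolding P_def
  proof (intro conjI)
    have "continuous_map (cyl (TB (Bk 0))) T snd"
      using continuous_map_snd[of UI "TB (Bk 0)"] continuous_map_in_subtopology by blast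
    then have "continuous_map (cyl (TB (Bk 0))) (cyl T) (\<lambda>z. (fst z, snd z))"
      by (intro continuous_map_pairedI continuous_map_fst)
    then show "continuous_map (cyl (TB (Bk 0))) Z (\<lambda>z. (fst z, snd z))"
      by (auto simp: Z_def continuous_map_in_subtopology Bk_def)
  qed auto
  have step: "\<exists>R'. P (Suc k) R' \<and> Q k R R'" if R: "P k R" for k R
  proof -
    have Rc: "continuous_map (cyl (TB (Bk k))) Z (\<lambda>z. R (snd z) (fst z))" using R by (simp add: P_def)
    have "\<exists>F. continuous_map (cyl (D e)) Z F \<and> (\<forall>y\<in>topspace (D e). F (0, y) = (0, \<phi> e y)) \<and>
        (\<forall>t\<in>{0..1}. \<forall>y\<in>boundary_sphere (dm e). F (t, y) = R (\<phi> e y) t)"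
      if e: "e \<in> Bk (Suc k) - Bk k" for e
    proof -
      have eC: "e \<in> C" and ek: "dm e = k" using e by (auto simp: Bk_def)
      have f: "continuous_map (D e) Z (\<lambda>y. (0, \<phi> e y))"
      proof -
        have "continuous_map (D e) (cyl T) (\<lambda>y. (0, \<phi> e y))"
          by (intro continuous_map_cyl continuous_char[OF eC]) auto
        moreover have "\<phi> e y \<in> topspace T" if "y \<in> topspace (D e)" for y
          using continuous_char[OF eC] that by (auto simp: continuous_map_def Pi_iff)
        ultimately show ?thesis by (simp add: Z_def continuous_map_in_subtopology)
      qed
      have bd: "\<phi> e y \<in> cells_union (Bk k)" if y: "y \<in> boundary_sphere (dm e)" for y
      proof -
        obtain g z where g: "g \<in> Bk (Suc k)" "dm g < dm e" "z \<in> open_disk (dm g)" "\<phi> e y = \<phi> g z"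
          using boundary_lower[OF Bk _ y] e by blast
        then have "g \<in> Bk k" using ek by (auto simp: Bk_def)
        then show ?thesis unfolding g(4) using g(3) by (rule cells_unionI)
      qed
      have "continuous_map (subtopology (D e) (boundary_sphere (dm e))) (TB (Bk k)) (\<phi> e)"
        using continuous_map_from_subtopology[OF continuous_char[OF eC]] bd
        by (auto simp: continuous_map_in_subtopology)
      then have "continuous_map (cyl (subtopology (D e) (boundary_sphere (dm e)))) (cyl (TB (Bk k))) (\<lambda>z. (fst z, \<phi> e (snd z)))"
        by (intro continuous_map_pairedI continuous_map_fst continuous_map_composeI[OF _ continuous_map_snd])
      from continuous_map_composeI[OF Rc this]
      have h: "continuous_map (cyl (subtopology (D e) (boundary_sphere (dm e)))) Z (\<lambda>z. R (\<phi> e (snd z)) (fst z))"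
        by simp
      show ?thesis
        by (rule homotopy_extension[OF cofibration_disk f h]) (use R bd in \<open>auto simp: P_def\<close>)
    qed
    then have "\<exists>F. \<forall>e\<in>Bk (Suc k) - Bk k. continuous_map (cyl (D e)) Z (F e) \<and> (\<forall>y\<in>topspace (D e). F e (0, y) = (0, \<phi> e y)) \<and>
        (\<forall>t\<in>{0..1}. \<forall>y\<in>boundary_sphere (dm e). F e (t, y) = R (\<phi> e y) t)"
      by (intro bchoice) blast
    then obtain F where F: "\<And>e. e \<in> Bk (Suc k) - Bk k \<Longrightarrow> continuous_map (cyl (D e)) Z (F e)"
      "\<And>e y. e \<in> Bk (Suc k) - Bk k \<Longrightarrow> y \<in> topspace (D e) \<Longrightarrow> F e (0, y) = (0, \<phi> e y)"
      "\<And>e t y. e \<in> Bk (Suc k) - Bk k \<Longrightarrow> t \<in> {0..1} \<Longrightarrow> y \<in> boundary_sphere (dm e) \<Longrightarrow> F e (t, y) = R (\<phi> e y) t"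
      by metis
    define u where "u e y = (\<lambda>t\<in>{0..1}. if e \<in> Bk k then R (\<phi> e y) t else F e (t, y))" for e y
    have compat: "u e y = u g z"
      if "e \<in> Bk (Suc k)" "g \<in> Bk (Suc k)" "y \<in> boundary_sphere (dm e)" "z \<in> open_disk (dm g)" "dm g < dm e" "\<phi> e y = \<phi> g z"
      for e y g z
    proof -
      have gC: "g \<in> C" using that(2) Bk cell_closed_subset by blast
      have "\<phi> g z \<in> cells_union (Bk k)" if "e \<in> Bk k"
        using char_in_cells_union[OF Bk that, of y] \<open>y \<in> _\<close> \<open>\<phi> e y = \<phi> g z\<close> by (simp add: topspace_disk_Un)
      then have "g \<in> Bk k"
        using cells_union_mem[OF cell_closed_subset[OF Bk] gC \<open>z \<in> _\<close>, of k] that by (auto simp: Bk_def)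
      then show ?thesis using F(3)[of e _ y] that by (auto simp: u_def fun_eq_iff)
    qed
    obtain R' where R': "\<And>e y. e \<in> Bk (Suc k) \<Longrightarrow> y \<in> topspace (D e) \<Longrightarrow> R' (\<phi> e y) = u e y"
    proof (rule cells_glue[OF Bk, of "Suc k" u])
      fix h assume "\<And>e y. e \<in> Bk (Suc k) \<Longrightarrow> y \<in> topspace (D e) \<Longrightarrow> h (\<phi> e y) = u e y"
      then show thesis by (rule that)
    qed (rule compat; assumption)
    have Q: "Q k R R'"
      unfolding Q_def
    proof (intro ballI)
      fix x t assume x: "x \<in> cells_union (Bk k)" and t: "t \<in> {0..1::real}"
      obtain e y where e: "e \<in> Bk k" "y \<in> open_disk (dm e)" "x = \<phi> e y" by (rule cells_unionE[OF x])
      then show "R' x t = R x t"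
        using R'[of e y] t by (auto simp: u_def topspace_disk_Un Bk_def)
    qed
    have "P (Suc k) R'"
      unfolding P_def
    proof (intro conjI ballI)
      show "continuous_map (cyl (TB (Bk (Suc k)))) Z (\<lambda>z. R' (snd z) (fst z))"
      proof (rule generated_by_continuous_cyl[OF generated_cells[OF Bk]])
        fix e assume e: "e \<in> Bk (Suc k)"
        have "continuous_map (cyl (D e)) Z (\<lambda>z. u e (snd z) (fst z))"
        proof (cases "e \<in> Bk k")
          case True
          have "continuous_map (D e) (TB (Bk k)) (\<phi> e)"
            using generated_cells[OF Bk] True by (simp add: generated_by_def)
          then have "continuous_map (cyl (D e)) (cyl (TB (Bk k))) (\<lambda>z. (fst z, \<phi> e (snd z)))"
            by (intro continuous_map_pairedI continuous_map_fst continuous_map_composeI[OF _ continuous_map_snd])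
          from continuous_map_composeI[OF Rc this] show ?thesis
            by (rule continuous_map_eq) (use True in \<open>auto simp: u_def\<close>)
        next
          case False
          with F(1)[of e] e have "continuous_map (cyl (D e)) Z (F e)" by simp
          then show ?thesis by (rule continuous_map_eq) (use False in \<open>auto simp: u_def\<close>)
        qed
        then show "continuous_map (cyl (D e)) Z (\<lambda>z. R' (snd (fst z, \<phi> e (snd z))) (fst (fst z, \<phi> e (snd z))))"
          by (rule continuous_map_eq) (use R'[OF e] in auto)
      qed
      show "R' x 0 = (0, x)" if x: "x \<in> cells_union (Bk (Suc k))" for x
      proof -
        obtain e y where e: "e \<in> Bk (Suc k)" "y \<in> open_disk (dm e)" "x = \<phi> e y" by (rule cells_unionE[OF x])
        have yD: "y \<in> topspace (D e)" using e(2) by (simp add: topspace_disk_Un)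
        show ?thesis
          using R'[OF e(1) yD] F(2)[OF _ yD] e R cells_unionI[of e "Bk k" y] by (auto simp: u_def P_def)
      qed
      show "R' x t = (t, x)" if "x \<in> cells_union B" "t \<in> {0..1}" for x t
      proof -
        have "x \<in> cells_union (Bk k)" using that(1) by (auto simp: Bk_def cells_union_def)
        then show ?thesis using Q R that by (simp add: Q_def P_def)
      qed
    qed
    with Q show ?thesis by blast
  qed
  obtain RR where RR: "\<And>k. P k (RR k)" "\<And>k. Q k (RR k) (RR (Suc k))"
    using dependent_nat_choice[of P Q] base step by metis
  have RR_eq: "RR (k + j) x t = RR k x t" if x: "x \<in> cells_union (Bk k)" and t: "t \<in> {0..1}" for k j x t
  proof (induction j)
    case (Suc j)
    have "cells_union (Bk k) \<subseteq> cells_union (Bk (k + j))" by (auto simp: cells_union_def Bk_def)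
    then have "RR (Suc (k + j)) x t = RR (k + j) x t" using RR(2)[of "k + j"] x t unfolding Q_def by blast
    then show ?case using Suc by simp
  qed simp
  \<comment> \<open>All stages containing a point give it the same track, so the first one
    serves.\<close>
  define R where "R z = RR (LEAST k. snd z \<in> cells_union (Bk k)) (snd z) (fst z)" for z
  have R: "R (t, x) = RR k x t" if x: "x \<in> cells_union (Bk k)" and t: "t \<in> {0..1}" for k x t
  proof -
    let ?l = "LEAST k. x \<in> cells_union (Bk k)"
    have "x \<in> cells_union (Bk ?l)" by (rule LeastI[of "\<lambda>k. x \<in> cells_union (Bk k)", OF x])
    moreover have "?l \<le> k" by (rule Least_le[of "\<lambda>k. x \<in> cells_union (Bk k)", OF x])
    ultimately show ?thesis using RR_eq[of x ?l t "k - ?l"] t by (simp add: R_def)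
  qed
  have all: "\<exists>k. x \<in> cells_union (Bk k)" if x: "x \<in> topspace T" for x
  proof -
    obtain e y where e: "e \<in> C" "y \<in> open_disk (dm e)" "x = \<phi> e y"
      using x cells_unionE[of x C] cells_union_all by metis
    then show ?thesis using cells_unionI[of e "Bk (Suc (dm e))" y] by (auto simp: Bk_def)
  qed
  have "continuous_map (cyl (TB C)) Z R"
  proof (rule generated_by_continuous_cyl[OF generated_cells[OF cell_closed_all]])
    fix e assume e: "e \<in> C"
    let ?k = "Suc (dm e)"
    have ek: "e \<in> Bk ?k" using e by (simp add: Bk_def)
    have "continuous_map (D e) (TB (Bk ?k)) (\<phi> e)"
      using generated_cells[OF Bk] ek by (simp add: generated_by_def)
    then have "continuous_map (cyl (D e)) (cyl (TB (Bk ?k))) (\<lambda>z. (fst z, \<phi> e (snd z)))"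
      by (intro continuous_map_pairedI continuous_map_fst continuous_map_composeI[OF _ continuous_map_snd])
    then have \<phi>e: "continuous_map (cyl (D e)) (cyl (TB (Bk ?k))) (\<lambda>z. (fst z, \<phi> e (snd z)))" .
    have "continuous_map (cyl (TB (Bk ?k))) Z (\<lambda>z. RR ?k (snd z) (fst z))"
      using RR(1)[of ?k] unfolding P_def by blast
    from continuous_map_composeI[OF this \<phi>e]
    have "continuous_map (cyl (D e)) Z (\<lambda>z. RR ?k (\<phi> e (snd z)) (fst z))" by simp
    then show "continuous_map (cyl (D e)) Z (\<lambda>z. R (fst z, \<phi> e (snd z)))"
    proof (rule continuous_map_eq)
      fix z assume "z \<in> topspace (cyl (D e))"
      then have "fst z \<in> {0..1}" "snd z \<in> topspace (D e)" by auto
      then show "RR ?k (\<phi> e (snd z)) (fst z) = R (fst z, \<phi> e (snd z))"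
        using R[OF char_in_cells_union[OF Bk ek]] by simp
    qed
  qed
  then have RZ: "continuous_map (cyl T) Z R" by (simp add: cells_union_all)
  show ?thesis
    unfolding cofibration_def
  proof (intro conjI exI ballI)
    show "closedin T (cells_union B)" by (rule closedin_cells_union[OF B])
    show "continuous_map (cyl T) (cyl T) R" using RZ by (simp add: Z_def continuous_map_in_subtopology)
    show "R (0, x) = (0, x)" if x: "x \<in> topspace T" for x
    proof -
      obtain k where k: "x \<in> cells_union (Bk k)" using all[OF x] by blast
      have "RR k x 0 = (0, x)" using RR(1)[of k] k unfolding P_def by blast
      then show ?thesis using R[OF k, of 0] by simp
    qed
    show "R (t, x) = (t, x)" if "t \<in> {0..1}" "x \<in> cells_union B" for t x
    proof -
      have "x \<in> cells_union (Bk 0)" using that by (auto simp: Bk_def cells_union_def)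
      moreover have "RR 0 x t = (t, x)" using RR(1)[of 0] that unfolding P_def by blast
      ultimately show ?thesis using R[of x 0 t] that(1) by simp
    qed
    show "fst (R z) = 0 \<or> snd (R z) \<in> cells_union B" if "z \<in> topspace (cyl T)" for z
    proof -
      have "R z \<in> topspace Z" using RZ that by (auto simp: continuous_map_def Pi_iff)
      then show ?thesis by (auto simp: Z_def)
    qed
  qed
qed

end

subsection \<open>The circle and the disk of dimension two\<close>

definition circle_path :: "real \<Rightarrow> nat \<Rightarrow> real" where
  "circle_path t = (\<lambda>i. if i = 0 then cos (2 * pi * t) else if i = 1 then sin (2 * pi * t) else 0)"

definition disk_base :: "nat \<Rightarrow> real" where "disk_base = (\<lambda>i. if i = 0 then 1 else 0)"

abbreviation circle :: "(nat \<Rightarrow> real) topology" where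
  "circle \<equiv> subtopology (disk 2) (boundary_sphere 2)"

lemma dnorm_2: "dnorm 2 y = sqrt ((y 0)\<^sup>2 + (y 1)\<^sup>2)"
  by (simp add: L2_set_def numeral_2_eq_2)

lemma circle_path_boundary: "circle_path t \<in> boundary_sphere 2"
  by (auto simp: boundary_sphere_eq dnorm_2 circle_path_def)

lemma circle_path_0 [simp]: "circle_path 0 = disk_base" and circle_path_1 [simp]: "circle_path 1 = disk_base"
  by (auto simp: circle_path_def disk_base_def fun_eq_iff)

lemma disk_base_boundary: "disk_base \<in> boundary_sphere 2"
  using circle_path_boundary[of 0] by simp

lemma disk_base_disk: "disk_base \<in> topspace (disk 2)"
  using disk_base_boundary by (simp add: topspace_disk_Un)

lemma topspace_circle: "topspace circle = boundary_sphere 2"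
  by (auto simp: topspace_disk_Un)

lemma circle_path_surj: "circle_path ` {0..1} = boundary_sphere 2"
proof (intro equalityI subsetI)
  fix y assume y: "y \<in> boundary_sphere 2"
  then have "(y 0)\<^sup>2 + (y 1)\<^sup>2 = 1" by (simp add: boundary_sphere_eq dnorm_2)
  then obtain t where t: "0 \<le> t" "t < 2 * pi" "y 0 = cos t" "y 1 = sin t"
    using sincos_total_2pi by metis
  have "circle_path (t / (2 * pi)) i = y i" for i
    using y t by (cases "i = 0"; cases "i = 1") (auto simp: circle_path_def boundary_sphere_eq)
  then have "y = circle_path (t / (2 * pi))" by (simp add: fun_eq_iff)
  moreover have "t / (2 * pi) \<in> {0..1}" using t by (simp add: divide_simps)
  ultimately show "y \<in> circle_path ` {0..1}" by blast
qed (auto simp: circle_path_boundary)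

lemma circle_path_eq:
  assumes "circle_path s = circle_path t" "s \<in> {0..1}" "t \<in> {0..1}"
  shows "s = t \<or> (s = 0 \<and> t = 1) \<or> (s = 1 \<and> t = 0)"
proof -
  have "cos (2 * pi * s) = cos (2 * pi * t)" "sin (2 * pi * s) = sin (2 * pi * t)"
    using fun_cong[OF assms(1), of 0] fun_cong[OF assms(1), of 1] by (simp_all add: circle_path_def)
  then obtain k :: int where k: "2 * pi * s = 2 * pi * t + 2 * pi * of_int k"
    using sin_cos_eq_iff[of "2 * pi * s" "2 * pi * t"] by (auto simp: Ints_def)
  then have "2 * pi * (s - t - of_int k) = 0" by (simp add: algebra_simps)
  then have st: "s = t + of_int k" by simp
  then have "real_of_int (-1) \<le> of_int k" "real_of_int k \<le> of_int 1" using assms(2,3) by auto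
  then have "-1 \<le> k" "k \<le> 1" by (simp_all only: of_int_le_iff)
  then consider "k = -1" | "k = 0" | "k = 1" by linarith
  then show ?thesis using st assms(2,3) by cases auto
qed

lemma continuous_map_circle_path: "continuous_map UI (disk 2) circle_path"
proof (rule continuous_map_into_disk)
  show "continuous_map UI euclideanreal (\<lambda>t. circle_path t i)" for i
    by (cases "i = 0"; cases "i = 1") (auto simp: circle_path_def intro!: continuous_intros)
qed (use circle_path_boundary in \<open>simp add: topspace_disk_Un\<close>)

lemma compact_space_UI: "compact_space UI"
  by (simp add: compact_space_subtopology)

lemma compact_space_cyl_UI: "compact_space (cyl UI)"
  by (metis compact_space_UI compact_space_prod_topology)

lemma generated_circle: "generated_by circle {()} (\<lambda>_. UI) (\<lambda>_. circle_path)"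
proof (rule generated_by_quotient)
  show "continuous_map UI circle circle_path"
    using continuous_map_circle_path circle_path_boundary by (simp add: continuous_map_in_subtopology)
  show "circle_path ` topspace UI = topspace circle"
    using circle_path_surj by (simp only: topspace_circle) simp
qed (simp_all add: compact_space_UI Hausdorff_space_subtopology Hausdorff_disk)

text \<open>Inverse to \<open>circle_path\<close> and ambiguous only at the base point, where 0 and
  1 both qualify. Functions that agree at the two ends do not notice the choice, nor the
  jump.\<close>

definition circle_angle :: "(nat \<Rightarrow> real) \<Rightarrow> real" where
  "circle_angle y = (SOME t. t \<in> {0..1} \<and> circle_path t = y)"

lemma circle_angle:
  assumes "y \<in> boundary_sphere 2" shows "circle_angle y \<in> {0..1}" "circle_path (circle_angle y) = y"
proof -
  have "y \<in> circle_path ` {0..1}" using circle_path_surj assms by simp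
  then have "\<exists>t. t \<in> {0..1} \<and> circle_path t = y" by (elim imageE) (intro exI conjI; simp)
  from someI_ex[OF this] show "circle_angle y \<in> {0..1}" "circle_path (circle_angle y) = y"
    unfolding circle_angle_def by blast+
qed

lemma circle_angle_path:
  assumes "t \<in> {0..1}" "h 0 = h 1" shows "h (circle_angle (circle_path t)) = h t"
  using circle_path_eq[of "circle_angle (circle_path t)" t] circle_angle[OF circle_path_boundary] assms by auto

text \<open>The cylinder over the circle is a quotient of the square, so a homotopy of loops through
  loops descends to the circle.\<close>

lemma continuous_map_circle_homotopy:
  assumes h: "continuous_map (cyl UI) X h" and e: "\<And>s. s \<in> {0..1} \<Longrightarrow> h (s, 0) = h (s, 1)"
  shows "continuous_map (cyl circle) X (\<lambda>z. h (fst z, circle_angle (snd z)))"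
proof (rule generated_by_continuous_cyl[OF generated_circle])
  show "continuous_map (cyl UI) X (\<lambda>z. h (fst (fst z, circle_path (snd z)), circle_angle (snd (fst z, circle_path (snd z)))))"
  proof (rule continuous_map_eq[OF h])
    fix z assume "z \<in> topspace (cyl UI)"
    then have "fst z \<in> {0..1}" "snd z \<in> {0..1}" by auto
    then show "h z = h (fst (fst z, circle_path (snd z)), circle_angle (snd (fst z, circle_path (snd z))))"
      using circle_angle_path[of "snd z" "\<lambda>t. h (fst z, t)"] e by simp
  qed
qed

text \<open>Polar coordinates present the disk as a quotient of the square: the side at time 1
  shrinks to the centre and the two ends of the circle parameter are identified. The null-homotopy
  respects both identifications.\<close>

lemma disk_fill:
  assumes "path_hom X x x p (\<lambda>t. x)"
  obtains F where "continuous_map (disk 2) X F" "\<And>t. t \<in> {0..1} \<Longrightarrow> F (circle_path t) = p t"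
proof -
  obtain K where K: "continuous_map (cyl UI) X K" "\<And>t. K (0, t) = p t" "\<And>t. K (1, t) = x"
    "\<And>s. s \<in> {0..1} \<Longrightarrow> K (s, 0) = x" "\<And>s. s \<in> {0..1} \<Longrightarrow> K (s, 1) = x"
    using path_homE[OF assms] by metis
  define q where "q z = (\<lambda>i. (1 - fst z) * circle_path (snd z) i)" for z
  have qn: "dnorm 2 (q z) = 1 - fst z" if "z \<in> {0..1} \<times> {0..1}" for z
    using that circle_path_boundary[of "snd z"] by (auto simp: q_def dnorm_scale boundary_sphere_eq)
  have q: "continuous_map (cyl UI) (disk 2) q"
  proof (rule continuous_map_into_disk)
    have "continuous_map (cyl UI) (disk 2) (\<lambda>z. circle_path (snd z))"
      by (rule continuous_map_composeI[OF continuous_map_circle_path continuous_map_snd])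
    then show "continuous_map (cyl UI) euclideanreal (\<lambda>z. q z i)" for i
      unfolding q_def by (intro continuous_intros continuous_map_fst_cyl continuous_map_coord) auto
    show "q z \<in> topspace (disk 2)" if "z \<in> topspace (cyl UI)" for z
      using that qn[of z] by (auto simp: topspace_disk q_def circle_path_def)
  qed
  have surj: "q ` topspace (cyl UI) = topspace (disk 2)"
  proof (intro equalityI subsetI)
    fix y assume y: "y \<in> topspace (disk 2)"
    show "y \<in> q ` topspace (cyl UI)"
    proof (cases "dnorm 2 y = 0")
      case True
      then have "y i = 0" for i using y by (cases "i < 2") (auto simp: L2_set_eq_0_iff topspace_disk)
      then have "y = q (1, 0)" by (simp add: q_def fun_eq_iff)
      then show ?thesis by (intro image_eqI[of _ _ "(1, 0)"]) auto
    next
      case False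
      then have "(\<lambda>i. y i / dnorm 2 y) \<in> boundary_sphere 2"
        using y by (auto simp: boundary_sphere_eq dnorm_divide topspace_disk)
      then obtain t where t: "t \<in> {0..1}" "circle_path t = (\<lambda>i. y i / dnorm 2 y)"
        using circle_path_surj by (metis imageE)
      have "y = q (1 - dnorm 2 y, t)" using False by (simp add: q_def t(2) fun_eq_iff)
      moreover have "(1 - dnorm 2 y, t) \<in> topspace (cyl UI)" using t y by (simp add: topspace_disk)
      ultimately show ?thesis by blast
    qed
  qed (use q in \<open>auto simp: continuous_map_def Pi_iff\<close>)
  have "generated_by (disk 2) {()} (\<lambda>_. cyl UI) (\<lambda>_. q)"
    using surj by (intro generated_by_quotient q compact_space_cyl_UI Hausdorff_disk)
  then obtain F where F: "continuous_map (disk 2) X F" "\<And>i z. i \<in> {()} \<Longrightarrow> z \<in> topspace (cyl UI) \<Longrightarrow> F (q z) = K z"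
  proof (rule generated_by_glue[where u = "\<lambda>_. K" and Z = X])
    fix y z :: "real \<times> real" assume yz: "y \<in> topspace (cyl UI)" "z \<in> topspace (cyl UI)" "q y = q z"
    obtain s t s' t' where e: "y = (s, t)" "z = (s', t')" by fastforce
    have "s = s'" using qn[of y] qn[of z] yz by (auto simp: e)
    show "K y = K z"
    proof (cases "s = 1")
      case True
      then show ?thesis using K(3) \<open>s = s'\<close> by (simp add: e)
    next
      case False
      then have "circle_path t = circle_path t'"
        using yz(3) \<open>s = s'\<close> by (auto simp: e q_def fun_eq_iff)
      then show ?thesis
        using circle_path_eq[of t t'] yz(1,2) K(4,5) \<open>s = s'\<close> by (auto simp: e)
    qed
  qed (use K(1) in auto)
  show ?thesis
  proof (rule that[OF F(1)])
    fix t :: real assume t: "t \<in> {0..1}"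
    have "q (0, t) = circle_path t" by (simp add: q_def)
    then show "F (circle_path t) = p t" using F(2)[of "()" "(0, t)"] t K(2) by simp
  qed
qed

subsection \<open>The wedge with disks\<close>

lemma topspace_disjoint_sum: "topspace (disjoint_sum X Y) = topspace X <+> topspace Y"
proof -
  have "openin (disjoint_sum X Y) U \<Longrightarrow> U \<subseteq> topspace X <+> topspace Y" for U
  proof
    fix s assume U: "openin (disjoint_sum X Y) U" and s: "s \<in> U"
    have "Inl -` U \<subseteq> topspace X" "Inr -` U \<subseteq> topspace Y"
      using U openin_subset unfolding openin_disjoint_sum by metis+
    then show "s \<in> topspace X <+> topspace Y"
      using s by (cases s) auto
  qed
  moreover have "openin (disjoint_sum X Y) (topspace X <+> topspace Y)"
  proof -
    have "Inl -` (topspace X <+> topspace Y) = topspace X" "Inr -` (topspace X <+> topspace Y) = topspace Y" by auto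
    then show ?thesis by (simp add: openin_disjoint_sum)
  qed
  ultimately show ?thesis by (meson openin_subset openin_topspace subset_antisym)
qed

lemma topspace_collapse: "topspace (collapse X K) = insert None (collapse_map K ` topspace X)"
proof -
  have "{x \<in> topspace X. collapse_map K x \<in> insert None (collapse_map K ` topspace X)} = topspace X" by auto
  then have "openin (collapse X K) (insert None (collapse_map K ` topspace X))"
    by (simp add: openin_collapse)
  moreover have "topspace (collapse X K) \<subseteq> insert None (collapse_map K ` topspace X)"
    using openin_topspace[of "collapse X K"] unfolding openin_collapse by blast
  ultimately show ?thesis by (meson openin_subset subset_antisym)
qed

type_synonym 'a disk_wedge = "('a + (nat \<times> (nat \<Rightarrow> real)) option) option"

locale disk_wedge =
  fixes M :: "'a topology" and pt :: 'a and n :: nat and I :: "'i set"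
    and Y :: "'i \<Rightarrow> (nat \<Rightarrow> real) topology" and \<phi> :: "'i \<Rightarrow> (nat \<Rightarrow> real) \<Rightarrow> 'a"
  assumes pt: "pt \<in> topspace M" and gen: "generated_by M I Y \<phi>"
begin

definition iW :: "'a \<Rightarrow> 'a disk_wedge" where "iW x = collapse_map {Inl pt, Inr None} (Inl x)"

text \<open>The inner collapse forms the wedge of the disks, the outer one identifies its base point
  with that of \<open>M\<close>; after both, the base point of every disk is
  \<open>None\<close>.\<close>

definition kD :: "nat \<Rightarrow> (nat \<Rightarrow> real) \<Rightarrow> 'a disk_wedge" where
  "kD j y = collapse_map {Inl pt, Inr None} (Inr (collapse_map ({..<n} \<times> {disk_base}) (j, y)))"

definition W :: "'a disk_wedge topology" where
  "W = collapse (disjoint_sum M (collapse (sum_topology (\<lambda>i. disk 2) {..<n}) ({..<n} \<times> {disk_base}))) {Inl pt, Inr None}"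

text \<open>Used for two subspaces: with the 1-skeleton of \<open>M\<close> it is the second member
  of the wedge pair, with all of \<open>M\<close> it is the cofibration relative to which maps on
  the wedge are lifted.\<close>

definition KW :: "'a set \<Rightarrow> 'a disk_wedge set" where
  "KW A = iW ` A \<union> (\<Union>j<n. kD j ` boundary_sphere 2)"

lemma iW_eq: "iW x = (if x = pt then None else Some (Inl x))"
  by (simp add: iW_def collapse_map_def)

lemma kD_eq: "j < n \<Longrightarrow> kD j y = (if y = disk_base then None else Some (Inr (Some (j, y))))"
  by (simp add: kD_def collapse_map_def)

lemma collapse_sum_image:
  "collapse_map {Inl pt, Inr None} ` (A <+> insert None (collapse_map ({..<n} \<times> {disk_base}) ` ({..<n} \<times> S)))
     = iW ` A \<union> insert None (\<Union>j<n. kD j ` S)"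
proof -
  have "(\<lambda>p. collapse_map {Inl pt, Inr None} (Inr (collapse_map ({..<n} \<times> {disk_base}) p))) ` ({..<n} \<times> S)
      = (\<Union>j<n. kD j ` S)"
    unfolding kD_def by force
  then show ?thesis
    by (simp add: Plus_def image_Un image_image iW_def) (simp add: collapse_map_def)
qed

lemma wedge_eq:
  assumes "pt \<in> A"
  shows "wedge (M, A, pt) (wedge_power n based_2_disk) = (W, KW A, None)"
proof -
  have "None \<in> KW A" using assms by (auto simp: KW_def iW_eq image_iff)
  then have "insert None (KW A) = KW A" by (rule insert_absorb)
  then show ?thesis
    by (simp add: wedge_def wedge_power_def based_2_disk_def collapse_pair_def W_def collapse_sum_image KW_def
        flip: disk_base_def)
qed

lemma topspace_W: "topspace W = iW ` topspace M \<union> (\<Union>j<n. kD j ` topspace (disk 2))"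
proof -
  have "topspace W = insert None (iW ` topspace M \<union> insert None (\<Union>j<n. kD j ` topspace (disk 2)))"
    unfolding W_def topspace_collapse topspace_disjoint_sum
    using collapse_sum_image[of "topspace M" "topspace (disk 2)"] by (simp add: o_def)
  then show ?thesis using pt by (auto simp: iW_eq image_iff)
qed

text \<open>Both collapses and both kinds of sum are dissolved here, leaving the final topology of
  the inclusions of \<open>M\<close> and of the disks.\<close>

lemma openin_W:
  assumes "U \<subseteq> topspace W"
  shows "openin W U \<longleftrightarrow> openin M {x \<in> topspace M. iW x \<in> U} \<and> (\<forall>j<n. openin (disk 2) {y \<in> topspace (disk 2). kD j y \<in> U})"
proof -
  let ?V = "collapse (sum_topology (\<lambda>i. disk 2) {..<n}) ({..<n} \<times> {disk_base})"
  let ?c = "collapse_map {Inl pt, Inr None}"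
  let ?d = "collapse_map ({..<n} \<times> {disk_base})"
  let ?S = "{s \<in> topspace (disjoint_sum M ?V). ?c s \<in> U}"
  have "openin W U \<longleftrightarrow> openin (disjoint_sum M ?V) ?S"
    using assms unfolding W_def openin_collapse topspace_collapse by simp
  also have "\<dots> \<longleftrightarrow> openin M (Inl -` ?S) \<and> openin ?V (Inr -` ?S)"
    by (rule openin_disjoint_sum)
  also have "Inl -` ?S = {x \<in> topspace M. iW x \<in> U}" by (auto simp: topspace_disjoint_sum iW_def)
  also have "openin ?V (Inr -` ?S) \<longleftrightarrow> openin (sum_topology (\<lambda>i. disk 2) {..<n})
      {p \<in> topspace (sum_topology (\<lambda>i. disk 2) {..<n}). ?d p \<in> Inr -` ?S}"
    unfolding openin_collapse by (auto simp: topspace_disjoint_sum topspace_collapse)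
  also have "{p \<in> topspace (sum_topology (\<lambda>i. disk 2) {..<n}). ?d p \<in> Inr -` ?S} =
      {p \<in> topspace (sum_topology (\<lambda>i. disk 2) {..<n}). kD (fst p) (snd p) \<in> U}"
    by (auto simp: topspace_disjoint_sum topspace_collapse kD_def)
  also have "openin (sum_topology (\<lambda>i. disk 2) {..<n}) \<dots> \<longleftrightarrow> (\<forall>j<n. openin (disk 2) {y \<in> topspace (disk 2). kD j y \<in> U})"
  proof -
    have "{y. (j, y) \<in> {p \<in> topspace (sum_topology (\<lambda>i. disk 2) {..<n}). kD (fst p) (snd p) \<in> U}} = {y \<in> topspace (disk 2). kD j y \<in> U}"
      if "j < n" for j using that by auto
    then show ?thesis unfolding openin_sum_topology by auto
  qed
  finally show ?thesis .
qed

lemma iW_W: "x \<in> topspace M \<Longrightarrow> iW x \<in> topspace W"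
  and kD_W: "j < n \<Longrightarrow> y \<in> topspace (disk 2) \<Longrightarrow> kD j y \<in> topspace W"
  by (auto simp: topspace_W)

lemma continuous_map_iW: "continuous_map M W iW"
  unfolding continuous_map_def
proof (intro conjI allI impI)
  show "openin M {x \<in> topspace M. iW x \<in> U}" if "openin W U" for U
    using openin_W[OF openin_subset[OF that]] that by simp
qed (use iW_W in simp)

lemma continuous_map_kD:
  assumes "j < n" shows "continuous_map (disk 2) W (kD j)"
  unfolding continuous_map_def
proof (intro conjI allI impI)
  show "openin (disk 2) {y \<in> topspace (disk 2). kD j y \<in> U}" if "openin W U" for U
    using openin_W[OF openin_subset[OF that]] that assms by simp
qed (use kD_W assms in simp)

lemma closedin_W:
  assumes S: "S \<subseteq> topspace W" and "closedin M {x \<in> topspace M. iW x \<in> S}"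
    and "\<And>j. j < n \<Longrightarrow> closedin (disk 2) {y \<in> topspace (disk 2). kD j y \<in> S}"
  shows "closedin W S"
proof -
  have "{x \<in> topspace M. iW x \<in> topspace W - S} = topspace M - {x \<in> topspace M. iW x \<in> S}"
    using iW_W by auto
  moreover have "{y \<in> topspace (disk 2). kD j y \<in> topspace W - S} = topspace (disk 2) - {y \<in> topspace (disk 2). kD j y \<in> S}" if "j < n" for j
    using kD_W[OF that] by auto
  ultimately have "openin W (topspace W - S)"
    using assms(2,3) by (subst openin_W) auto
  then show ?thesis using S by (simp add: closedin_def)
qed

lemma continuous_map_gen: "i \<in> I \<Longrightarrow> continuous_map (Y i) M (\<phi> i)"
  using gen by (simp add: generated_by_def)

text \<open>The characteristic maps are needed only to give all generating maps the same domain type.\<close>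

lemma generated_W:
  "generated_by W (I <+> {..<n}) (case_sum Y (\<lambda>_. disk 2)) (case_sum (\<lambda>i y. iW (\<phi> i y)) kD)"
  unfolding generated_by_def
proof (intro conjI ballI allI impI)
  fix i assume "i \<in> I <+> {..<n}"
  then show "continuous_map (case_sum Y (\<lambda>_. disk 2) i) W (case_sum (\<lambda>i y. iW (\<phi> i y)) kD i)"
    using continuous_map_composeI[OF continuous_map_iW continuous_map_gen] continuous_map_kD by auto
next
  have "topspace M = (\<Union>i\<in>I. \<phi> i ` topspace (Y i))" using gen by (simp add: generated_by_def)
  then show "topspace W = (\<Union>i\<in>I <+> {..<n}. case_sum (\<lambda>i y. iW (\<phi> i y)) kD i ` topspace (case_sum Y (\<lambda>_. disk 2) i))"
    by (simp add: topspace_W Plus_def image_UN image_image)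
next
  fix U assume U: "U \<subseteq> topspace W" and op: "\<forall>i\<in>I <+> {..<n}. openin (case_sum Y (\<lambda>_. disk 2) i)
      {y \<in> topspace (case_sum Y (\<lambda>_. disk 2) i). case_sum (\<lambda>i y. iW (\<phi> i y)) kD i y \<in> U}"
  have "openin M {x \<in> topspace M. iW x \<in> U}"
  proof (rule generated_by_openin[OF gen])
    fix i assume i: "i \<in> I"
    then have "openin (Y i) {y \<in> topspace (Y i). iW (\<phi> i y) \<in> U}" using op by force
    moreover have "\<phi> i y \<in> topspace M" if "y \<in> topspace (Y i)" for y
      using continuous_map_gen[OF i] that by (auto simp: continuous_map_def Pi_iff)
    then have "{y \<in> topspace (Y i). \<phi> i y \<in> {x \<in> topspace M. iW x \<in> U}} = {y \<in> topspace (Y i). iW (\<phi> i y) \<in> U}"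
      by auto
    ultimately show "openin (Y i) {y \<in> topspace (Y i). \<phi> i y \<in> {x \<in> topspace M. iW x \<in> U}}" by simp
  qed auto
  moreover have "openin (disk 2) {y \<in> topspace (disk 2). kD j y \<in> U}" if "j < n" for j
    using bspec[OF op InrI, of j] that by simp
  ultimately show "openin W U" using openin_W[OF U] by blast
qed

lemma continuous_map_from_W:
  assumes "continuous_map M Z (\<lambda>x. h (iW x))" "\<And>j. j < n \<Longrightarrow> continuous_map (disk 2) Z (\<lambda>y. h (kD j y))"
  shows "continuous_map W Z h"
  by (rule generated_by_continuous_map[OF generated_W])
    (use assms continuous_map_composeI[OF assms(1) continuous_map_gen] in auto)

lemma continuous_map_from_cyl_W:
  assumes M: "continuous_map (cyl M) Z (\<lambda>z. h (fst z, iW (snd z)))"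
    and D: "\<And>j. j < n \<Longrightarrow> continuous_map (cyl (disk 2)) Z (\<lambda>z. h (fst z, kD j (snd z)))"
  shows "continuous_map (cyl W) Z h"
proof (rule generated_by_continuous_cyl[OF generated_W])
  fix i assume i: "i \<in> I <+> {..<n}"
  show "continuous_map (cyl (case_sum Y (\<lambda>_. disk 2) i)) Z (\<lambda>z. h (fst z, case_sum (\<lambda>i y. iW (\<phi> i y)) kD i (snd z)))"
  proof (cases i)
    case (Inl k)
    then have "k \<in> I" using i by auto
    then have "continuous_map (cyl (Y k)) (cyl M) (\<lambda>z. (fst z, \<phi> k (snd z)))"
      by (intro continuous_map_pairedI continuous_map_fst continuous_map_composeI[OF continuous_map_gen continuous_map_snd])
    from continuous_map_composeI[OF M this] show ?thesis using Inl by simp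
  next
    case (Inr j)
    then show ?thesis using i D[of j] by auto
  qed
qed

text \<open>\<open>Some (Inr None)\<close> is not a point of the wedge, since the base point of the
  inner wedge is collapsed as well; its value is a mere default.\<close>

definition wmap :: "('a \<Rightarrow> 'z) \<Rightarrow> (nat \<Rightarrow> (nat \<Rightarrow> real) \<Rightarrow> 'z) \<Rightarrow> 'a disk_wedge \<Rightarrow> 'z" where
  "wmap u v w = (case w of None \<Rightarrow> u pt | Some (Inl x) \<Rightarrow> u x | Some (Inr None) \<Rightarrow> u pt | Some (Inr (Some (j, y))) \<Rightarrow> v j y)"

lemma wmap_iW: "wmap u v (iW x) = u x"
  by (simp add: wmap_def iW_eq)

lemma wmap_kD: "j < n \<Longrightarrow> v j disk_base = u pt \<Longrightarrow> wmap u v (kD j y) = v j y"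
  by (simp add: wmap_def kD_eq)

lemma iW_pt: "iW pt = None" and kD_base: "j < n \<Longrightarrow> kD j disk_base = None"
  by (simp_all add: iW_eq kD_eq)

lemma in_KW_topspace_M: "j < n \<Longrightarrow> kD j y \<in> KW (topspace M) \<Longrightarrow> y \<in> boundary_sphere 2"
  using disk_base_boundary by (auto simp: KW_def kD_eq iW_eq split: if_splits)

lemma iW_in_KW: "x \<in> A \<Longrightarrow> iW x \<in> KW A" and kD_in_KW: "j < n \<Longrightarrow> y \<in> boundary_sphere 2 \<Longrightarrow> kD j y \<in> KW A"
  by (auto simp: KW_def)

lemma KW_subset: "A \<subseteq> topspace M \<Longrightarrow> KW A \<subseteq> topspace W"
  by (auto simp: KW_def topspace_W topspace_disk_Un)

lemma closedin_KW: "closedin W (KW (topspace M))"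
proof (rule closedin_W[OF KW_subset[OF subset_refl]])
  have "{x \<in> topspace M. iW x \<in> KW (topspace M)} = topspace M" using iW_in_KW by auto
  then show "closedin M {x \<in> topspace M. iW x \<in> KW (topspace M)}" by simp
  fix j assume j: "j < n"
  have "{y \<in> topspace (disk 2). kD j y \<in> KW (topspace M)} = boundary_sphere 2"
    using in_KW_topspace_M[OF j] kD_in_KW[OF j] by (auto simp: topspace_disk_Un)
  then show "closedin (disk 2) {y \<in> topspace (disk 2). kD j y \<in> KW (topspace M)}"
    using cofibration_closedin[OF cofibration_disk] by simp
qed

text \<open>On \<open>M\<close> nothing moves, and on each disk \<open>disk_retract\<close> is used.
  The pieces fit at the base point because it lies on the boundary circle, over which the retraction
  is the identity.\<close>

lemma cofibration_KW: "cofibration W (KW (topspace M))"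
  unfolding cofibration_def
proof (intro conjI exI ballI)
  show "closedin W (KW (topspace M))" by (rule closedin_KW)
  define R where "R z = wmap (\<lambda>x. \<lambda>t\<in>{0..1}. (t, iW x))
    (\<lambda>j y. \<lambda>t\<in>{0..1}. (fst (disk_retract 2 (t, y)), kD j (snd (disk_retract 2 (t, y))))) (snd z) (fst z)" for z
  have RM: "R (t, iW x) = (t, iW x)" if "t \<in> {0..1}" for t x
    using that by (simp add: R_def wmap_iW)
  have RD: "R (t, kD j y) = (fst (disk_retract 2 (t, y)), kD j (snd (disk_retract 2 (t, y))))" if "t \<in> {0..1}" "j < n" for t j y
    using that disk_retract_boundary[OF _ disk_base_boundary] unfolding R_def fst_conv snd_conv
    by (subst wmap_kD) (auto simp: kD_base iW_pt fun_eq_iff)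
  show "continuous_map (cyl W) (cyl W) R"
  proof (rule continuous_map_from_cyl_W)
    have "continuous_map (cyl M) (cyl W) (\<lambda>z. (fst z, iW (snd z)))"
      by (intro continuous_map_pairedI continuous_map_fst continuous_map_composeI[OF continuous_map_iW continuous_map_snd])
    then show "continuous_map (cyl M) (cyl W) (\<lambda>z. R (fst z, iW (snd z)))"
      by (rule continuous_map_eq) (use RM in auto)
    fix j assume j: "j < n"
    have "continuous_map (cyl (disk 2)) (cyl W) (\<lambda>z. (fst (disk_retract 2 z), kD j (snd (disk_retract 2 z))))"
      by (intro continuous_map_pairedI continuous_map_composeI[OF continuous_map_fst continuous_map_disk_retract]
          continuous_map_composeI[OF continuous_map_kD[OF j]] continuous_map_composeI[OF continuous_map_snd continuous_map_disk_retract])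
    then show "continuous_map (cyl (disk 2)) (cyl W) (\<lambda>z. R (fst z, kD j (snd z)))"
      by (rule continuous_map_eq) (use RD j in auto)
  qed
  show "R (0, w) = (0, w)" if "w \<in> topspace W" for w
    using that by (auto simp: topspace_W RM RD disk_retract_0)
  show "R (t, w) = (t, w)" if "t \<in> {0..1}" "w \<in> KW (topspace M)" for t w
    using that by (auto simp: KW_def RM RD disk_retract_boundary)
  show "fst (R z) = 0 \<or> snd (R z) \<in> KW (topspace M)" if "z \<in> topspace (cyl W)" for z
  proof -
    obtain t w where z: "z = (t, w)" by fastforce
    have t: "t \<in> {0..1}" "w \<in> topspace W" using that z by auto
    from t(2) consider x where "x \<in> topspace M" "w = iW x" | j y where "j < n" "y \<in> topspace (disk 2)" "w = kD j y"
      by (auto simp: topspace_W)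
    then show ?thesis
    proof cases
      case 1
      then show ?thesis using RM t z iW_in_KW by simp
    next
      case 2
      then show ?thesis using RD[OF t(1)] z disk_retract_cases(3)[OF t(1) 2(2)] kD_in_KW by auto
    qed
  qed
qed

text \<open>The disks contract linearly to their base point, which leaves \<open>M\<close>
  fixed.\<close>

lemma deformation_W:
  obtains \<rho> E where "continuous_map W M \<rho>" "continuous_map (cyl W) W E"
    "\<And>w. w \<in> topspace W \<Longrightarrow> E (0, w) = iW (\<rho> w)" "\<And>w. w \<in> topspace W \<Longrightarrow> E (1, w) = w"
    "\<And>t x. t \<in> {0..1} \<Longrightarrow> E (t, iW x) = iW x" "\<And>x. \<rho> (iW x) = x"
proof -
  define \<rho> where "\<rho> = wmap (\<lambda>x. x) (\<lambda>j y. pt)"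
  define E where "E z = wmap (\<lambda>x t. iW x) (\<lambda>j y t. kD j (\<lambda>i. (1 - t) * disk_base i + t * y i)) (snd z) (fst z)" for z
  have \<rho>M: "\<rho> (iW x) = x" and \<rho>D: "j < n \<Longrightarrow> \<rho> (kD j y) = pt" for x j y
    by (simp_all add: \<rho>_def wmap_iW wmap_kD)
  have EM: "E (t, iW x) = iW x" for t x by (simp add: E_def wmap_iW)
  have ED: "E (t, kD j y) = kD j (\<lambda>i. (1 - t) * disk_base i + t * y i)" if "j < n" for t j y
    unfolding E_def fst_conv snd_conv using that by (subst wmap_kD) (auto simp: kD_base iW_pt fun_eq_iff simp flip: distrib_right)
  have "continuous_map W M \<rho>"
    by (rule continuous_map_from_W) (simp_all add: \<rho>M \<rho>D pt continuous_map_ident)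
  moreover have "continuous_map (cyl W) W E"
  proof (rule continuous_map_from_cyl_W)
    show "continuous_map (cyl M) W (\<lambda>z. E (fst z, iW (snd z)))"
      unfolding EM by (rule continuous_map_composeI[OF continuous_map_iW continuous_map_snd])
    fix j assume j: "j < n"
    have "continuous_map (cyl (disk 2)) (disk 2) (\<lambda>z i. (1 - fst z) * disk_base i + fst z * snd z i)"
    proof (rule continuous_map_into_disk)
      show "continuous_map (cyl (disk 2)) euclideanreal (\<lambda>z. (1 - fst z) * disk_base i + fst z * snd z i)" for i
        by (intro continuous_intros continuous_map_fst_cyl continuous_map_coord[OF continuous_map_snd]) auto
      show "(\<lambda>i. (1 - fst z) * disk_base i + fst z * snd z i) \<in> topspace (disk 2)" if "z \<in> topspace (cyl (disk 2))" for z
        using that disk_base_disk by (intro disk_convex) auto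
    qed
    then show "continuous_map (cyl (disk 2)) W (\<lambda>z. E (fst z, kD j (snd z)))"
      unfolding ED[OF j] by (rule continuous_map_composeI[OF continuous_map_kD[OF j]])
  qed
  moreover have "E (0, w) = iW (\<rho> w)" "E (1, w) = w" if "w \<in> topspace W" for w
    using that by (auto simp: topspace_W EM ED \<rho>M \<rho>D kD_base iW_pt)
  ultimately show ?thesis using that EM \<rho>M by blast
qed

text \<open>Here, too, the circles have to be subspaces of disks for the sake of the domain types.\<close>

lemma continuous_map_from_cyl_KW:
  assumes M: "continuous_map (cyl M) Z (\<lambda>z. h (fst z, iW (snd z)))"
    and D: "\<And>j. j < n \<Longrightarrow> continuous_map (cyl circle) Z (\<lambda>z. h (fst z, kD j (snd z)))"
  shows "continuous_map (cyl (subtopology W (KW (topspace M)))) Z h"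
proof -
  let ?K = "KW (topspace M)"
  have KW: "?K \<subseteq> topspace W" by (rule KW_subset) simp
  have top: "topspace (subtopology W ?K) = ?K" using KW by auto
  have "generated_by (subtopology W ?K) (I <+> {..<n}) (case_sum Y (\<lambda>_. circle)) (case_sum (\<lambda>i y. iW (\<phi> i y)) kD)"
    unfolding generated_by_def
  proof (intro conjI ballI allI impI)
    have gM: "topspace M = (\<Union>i\<in>I. \<phi> i ` topspace (Y i))" using gen by (simp add: generated_by_def)
    have iK: "continuous_map M (subtopology W ?K) iW"
      using continuous_map_iW iW_in_KW by (auto simp: continuous_map_in_subtopology)
    have kK: "continuous_map circle (subtopology W ?K) (kD j)" if "j < n" for j
      using continuous_map_from_subtopology[OF continuous_map_kD[OF that]] kD_in_KW[OF that]
      by (auto simp: continuous_map_in_subtopology)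
    fix i assume "i \<in> I <+> {..<n}"
    then show "continuous_map (case_sum Y (\<lambda>_. circle) i) (subtopology W ?K) (case_sum (\<lambda>i y. iW (\<phi> i y)) kD i)"
      using continuous_map_composeI[OF iK continuous_map_gen] kK by auto
  next
    have gM: "topspace M = (\<Union>i\<in>I. \<phi> i ` topspace (Y i))" using gen by (simp add: generated_by_def)
    show "topspace (subtopology W ?K) = (\<Union>i\<in>I <+> {..<n}. case_sum (\<lambda>i y. iW (\<phi> i y)) kD i ` topspace (case_sum Y (\<lambda>_. circle) i))"
      unfolding top by (simp add: KW_def gM Plus_def image_UN image_image topspace_circle del: topspace_subtopology)
  next
    fix U assume U: "U \<subseteq> topspace (subtopology W ?K)" and op: "\<forall>i\<in>I <+> {..<n}. openin (case_sum Y (\<lambda>_. circle) i)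
        {y \<in> topspace (case_sum Y (\<lambda>_. circle) i). case_sum (\<lambda>i y. iW (\<phi> i y)) kD i y \<in> U}"
    have UK: "U \<subseteq> ?K" using U top by simp
    have opM: "openin M {x \<in> topspace M. iW x \<in> U}"
    proof (rule generated_by_openin[OF gen])
      fix i assume i: "i \<in> I"
      then have "openin (Y i) {y \<in> topspace (Y i). iW (\<phi> i y) \<in> U}" using op by force
      moreover have "\<phi> i y \<in> topspace M" if "y \<in> topspace (Y i)" for y
        using continuous_map_gen[OF i] that by (auto simp: continuous_map_def Pi_iff)
      then have "{y \<in> topspace (Y i). \<phi> i y \<in> {x \<in> topspace M. iW x \<in> U}} = {y \<in> topspace (Y i). iW (\<phi> i y) \<in> U}"
        by auto
      ultimately show "openin (Y i) {y \<in> topspace (Y i). \<phi> i y \<in> {x \<in> topspace M. iW x \<in> U}}" by simp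
    qed auto
    have "closedin W (?K - U)"
    proof (rule closedin_W)
      have "{x \<in> topspace M. iW x \<in> ?K - U} = topspace M - {x \<in> topspace M. iW x \<in> U}"
        using iW_in_KW by auto
      then show "closedin M {x \<in> topspace M. iW x \<in> ?K - U}" using opM by auto
      fix j assume j: "j < n"
      have "openin circle {y \<in> topspace circle. kD j y \<in> U}" using bspec[OF op InrI, of j] j by simp
      then have "closedin circle (topspace circle - {y \<in> topspace circle. kD j y \<in> U})" by blast
      moreover have "topspace circle - {y \<in> topspace circle. kD j y \<in> U} = {y \<in> topspace (disk 2). kD j y \<in> ?K - U}"
        unfolding topspace_circle using in_KW_topspace_M[OF j] kD_in_KW[OF j] by (auto simp: topspace_disk_Un)
      ultimately show "closedin (disk 2) {y \<in> topspace (disk 2). kD j y \<in> ?K - U}"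
        using closedin_trans_full[OF _ cofibration_closedin[OF cofibration_disk[of 2]]] by simp
    qed (use KW in auto)
    then have "closedin (subtopology W ?K) (?K - U)" by (simp add: closedin_subset_topspace)
    then have "openin (subtopology W ?K) (topspace (subtopology W ?K) - (?K - U))" by blast
    moreover have "topspace (subtopology W ?K) - (?K - U) = U" unfolding top using UK by blast
    ultimately show "openin (subtopology W ?K) U" by simp
  qed
  then show ?thesis
  proof (rule generated_by_continuous_cyl)
    fix i assume i: "i \<in> I <+> {..<n}"
    show "continuous_map (cyl (case_sum Y (\<lambda>_. circle) i)) Z (\<lambda>z. h (fst z, case_sum (\<lambda>i y. iW (\<phi> i y)) kD i (snd z)))"
    proof (cases i)
      case (Inl k)
      then have "k \<in> I" using i by auto
      then have "continuous_map (cyl (Y k)) (cyl M) (\<lambda>z. (fst z, \<phi> k (snd z)))"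
        by (intro continuous_map_pairedI continuous_map_fst continuous_map_composeI[OF continuous_map_gen continuous_map_snd])
      from continuous_map_composeI[OF M this] show ?thesis using Inl by simp
    next
      case (Inr j)
      then show ?thesis using i D[of j] by auto
    qed
  qed
qed

end

subsection \<open>Loops in the retract\<close>

lemma edge_parameter:
  assumes "t \<in> {0..1}" shows "(\<lambda>i. if i = 0 then 2 * t - 1 else 0) \<in> topspace (disk (Suc 0))"
  using assms by (auto simp: topspace_disk L2_set_def abs_le_iff)

lemma (in cw_complex_space) edge_joins:
  assumes A: "cell_closed A" and e: "e \<in> A" "dm e = 1"
  shows "joins (TB A) (edge_path X e 0) (edge_path X e 1) (edge_path X e)"
    "edge_path X e 0 \<in> vertices A" "edge_path X e 1 \<in> vertices A"
proof -
  have "continuous_map (D e) (TB A) (\<phi> e)"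
    using generated_cells[OF A] e(1) unfolding generated_by_def by blast
  moreover have "continuous_map UI (D e) (\<lambda>t i. if i = 0 then 2 * t - 1 else 0)"
  proof (rule continuous_map_into_disk)
    show "continuous_map UI euclideanreal (\<lambda>t. if i = 0 then 2 * t - 1 else 0)" for i :: nat
      by (cases "i = 0") (auto intro!: continuous_intros)
  qed (use edge_parameter e in simp)
  ultimately have "continuous_map UI (TB A) (edge_path X e)"
    using continuous_map_composeI unfolding edge_path_def[abs_def] by blast
  then show "joins (TB A) (edge_path X e 0) (edge_path X e 1) (edge_path X e)"
    by (simp add: joins_def pathin_def)
  have "(\<lambda>i. if i = 0 then - 1 else 0) \<in> boundary_sphere (dm e)" "(\<lambda>i. if i = 0 then 1 else 0) \<in> boundary_sphere (dm e)"
    using boundary_1 e by auto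
  from this[THEN boundary_vertex[OF A e]]
  show "edge_path X e 0 \<in> vertices A" "edge_path X e 1 \<in> vertices A"
    by (simp_all add: edge_path_def cong: if_cong)
qed

text \<open>A closed cell is the image of a convex disk, so a path component contains it entirely or
  misses it. By the weak topology the component and its complement are both closed.\<close>

lemma (in cw_complex_space) path_connected:
  assumes conn: "connected_space T" and x: "x \<in> topspace T" and y: "y \<in> topspace T"
  obtains p where "joins T x y p"
proof -
  define P where "P = {y \<in> topspace T. \<exists>p. joins T x y p}"
  have cell: "z \<in> P" if e: "e \<in> C" and y: "y \<in> closed_cell X e" "y \<in> P" and z: "z \<in> closed_cell X e" for e y z
  proof -
    obtain u v where u: "u \<in> topspace (D e)" "y = \<phi> e u" and v: "v \<in> topspace (D e)" "z = \<phi> e v"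
      using y z by (auto simp: closed_cell_def)
    obtain p where p: "joins T x y p" using y(2) by (auto simp: P_def)
    have "joins (D e) u v (\<lambda>t i. (1 - t) * u i + t * v i)"
      unfolding joins_def pathin_def
    proof (intro conjI continuous_map_into_disk)
      show "continuous_map UI euclideanreal (\<lambda>t. (1 - t) * u i + t * v i)" for i
        by (intro continuous_intros) auto
      show "(\<lambda>i. (1 - t) * u i + t * v i) \<in> topspace (disk (dm e))" if "t \<in> topspace UI" for t
        using that u v by (intro disk_convex) auto
    qed auto
    from joins_loop_join[OF p joins_image[OF this continuous_char[OF e], folded u(2) v(2)]]
    show ?thesis using joins_endpoints(2)[OF joins_image[OF \<open>joins (D e) u v _\<close> continuous_char[OF e]]] v(2)
      by (auto simp: P_def)
  qed
  have "closedin T P"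
  proof (rule weak_topology)
    fix e assume e: "e \<in> C"
    have "P \<inter> closed_cell X e = {} \<or> P \<inter> closed_cell X e = closed_cell X e" using cell[OF e] by blast
    then show "closedin T (P \<inter> closed_cell X e)" using closedin_closed_cell[OF e] by auto
  qed (auto simp: P_def)
  moreover have "closedin T (topspace T - P)"
  proof (rule weak_topology)
    fix e assume e: "e \<in> C"
    have "closed_cell X e \<subseteq> topspace T" using closedin_closed_cell[OF e] closedin_subset by blast
    then have "(topspace T - P) \<inter> closed_cell X e = {} \<or> (topspace T - P) \<inter> closed_cell X e = closed_cell X e"
      using cell[OF e] by blast
    then show "closedin T ((topspace T - P) \<inter> closed_cell X e)" using closedin_closed_cell[OF e] by auto
  qed auto
  then have "openin T P" by (simp add: openin_closedin_eq P_def)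
  ultimately have "P = {} \<or> P = topspace T" using conn connected_space_clopen_in by blast
  moreover have "x \<in> P" using x joins_const by (force simp: P_def)
  ultimately show ?thesis using y that by (auto simp: P_def)
qed

text \<open>\<open>X\<close> is the complex \<open>N\<close>, and \<open>M\<close> is given by the
  set \<open>B\<close> of its cells. Below, \<open>S1\<close> and \<open>B1\<close> are the cells of
  the two 1-skeleta.\<close>

locale retract_data = cw_complex_space X for X :: "('a, 'c) cw" +
  fixes B :: "'c set" and e0 :: 'c and pt :: 'a
  assumes B: "cell_closed B" and conn: "connected_space T"
    and he: "homotopy_equivalence_map (TB B) T (\<lambda>x. x)"
    and B_0: "{e \<in> B. dm e = 0} = {e0}" and pt: "pt = \<phi> e0 (\<lambda>i. 0)"
begin

definition "S1 = {e \<in> C. dm e \<le> 1}"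
definition "B1 = {e \<in> B. dm e \<le> 1}"
abbreviation "T1 \<equiv> TB S1"

lemma BC: "B \<subseteq> C" using B cell_closed_subset by blast

lemma S1: "cell_closed S1" and B1: "cell_closed B1"
  unfolding S1_def B1_def by (rule cell_closed_skeleton[OF cell_closed_all], rule cell_closed_skeleton[OF B])

lemma S1C: "S1 \<subseteq> C" by (auto simp: S1_def)

lemma B1_sub: "B1 \<subseteq> S1" "B1 \<subseteq> B"
  using BC by (auto simp: S1_def B1_def)

lemma vertices_B: "vertices B = {pt}" "vertices B1 = {pt}"
proof -
  have "e \<in> {e \<in> B. dm e = 0} \<longleftrightarrow> e = e0" for e unfolding B_0 by simp
  then have *: "e \<in> B \<and> dm e = 0 \<longleftrightarrow> e = e0" for e by simp
  moreover have "e \<in> B1 \<and> dm e = 0 \<longleftrightarrow> e = e0" for e using *[of e] by (auto simp: B1_def)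
  ultimately show "vertices B = {pt}" "vertices B1 = {pt}" unfolding vertices_def pt by auto
qed

lemma vertices_S1: "vertices C = vertices S1" by (auto simp: vertices_def S1_def)

lemma pt_vertex: "pt \<in> vertices S1"
proof -
  have "pt \<in> vertices B1" using vertices_B(2) by simp
  then show ?thesis using B1_sub(1) unfolding vertices_def by blast
qed

lemma pt_in: "pt \<in> cells_union B1" "pt \<in> cells_union S1" "pt \<in> cells_union B"
  using vertices_B vertices_subset[of B1] vertices_subset[of B] vertices_subset[of S1] pt_vertex by auto

lemma pt_top: "pt \<in> topspace (TB B1)" "pt \<in> topspace T1" "pt \<in> topspace (TB B)" "pt \<in> topspace T"
  using pt_in cells_union_subset[OF BC] by auto

text \<open>Path induction with a predicate on end points only: each edge joins its ends inside the
  1-skeleton, hence so do the ends of any path between vertices.\<close>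

lemma skeleton_connected:
  assumes v: "v \<in> vertices S1" obtains p where "joins T1 pt v p"
proof -
  have vT: "v \<in> topspace T" using v vertices_subset cells_union_subset[OF S1C] by blast
  obtain p where p: "joins T pt v p" by (rule path_connected[OF conn pt_top(4) vT])
  have pC: "joins (TB C) pt v p" using p by (simp add: cells_union_all)
  interpret Q: path_predicate X C "\<lambda>p. \<exists>q. joins T1 (p 0) (p 1) q"
  proof unfold_locales
    show "\<exists>q'. joins T1 (q 0) (q 1) q'" if "path_hom (TB C) v w p q" "\<exists>q. joins T1 (p 0) (p 1) q" for v w p q
      using that path_hom_joins[OF that(1)] by (simp add: joins_def)
    show "\<exists>q. joins T1 v v q" if "v \<in> vertices C" for v
    proof -
      have "v \<in> topspace T1" using that vertices_S1 vertices_subset topspace_TB[OF S1C] by blast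
      from joins_const[OF this] show ?thesis by blast
    qed
    show "\<exists>q. joins T1 (edge_path X e 0) (edge_path X e 1) q" if "e \<in> C" "dm e = 1" for e
      using edge_joins(1)[OF S1, of e] that by (auto simp: S1_def)
    show "\<exists>q. joins T1 (p (1 - 0)) (p (1 - 1)) q" if *: "\<exists>q. joins T1 (p 0) (p 1) q" for p :: "real \<Rightarrow> 'a"
    proof -
      obtain q where "joins T1 (p 0) (p 1) q" using * by blast
      from joins_rev[OF this] show ?thesis by (intro exI[of _ "rev_path q"]) simp
    qed
    show "\<exists>r. joins T1 (loop_join p q 0) (loop_join p q 1) r"
      if j: "joins (TB C) u v p" "joins (TB C) v w q" and *: "\<exists>r. joins T1 (p 0) (p 1) r" "\<exists>r. joins T1 (q 0) (q 1) r" for u v w p q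
    proof -
      obtain r r' where "joins T1 (p 0) (p 1) r" "joins T1 (q 0) (q 1) r'" using * by blast
      moreover have "p 1 = q 0" using j by (simp add: joins_def)
      ultimately have "joins T1 (p 0) (q 1) (loop_join r r')" using joins_loop_join by metis
      then show ?thesis by (auto simp: loop_join_def)
    qed
  qed (rule cell_closed_all)
  have "\<exists>q. joins T1 (p 0) (p 1) q"
    using Q.path_predicate_holds[OF _ _ pC] pt_vertex v vertices_S1 by blast
  then show ?thesis using p that by (auto simp: joins_def)
qed

text \<open>Cellular approximation for loops, by path induction. As \<open>M\<close> has a single
  vertex, its edges are loops at the base point and can be concatenated freely.\<close>

lemma loop_into_skeleton:
  assumes p: "joins (TB B) pt pt p"
  obtains w where "joins (TB B1) pt pt w" "path_hom (TB B) pt pt p w"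
proof -
  interpret Q: path_predicate X B "\<lambda>p. \<exists>w. joins (TB B1) pt pt w \<and> path_hom (TB B) pt pt p w"
  proof unfold_locales
    show "\<exists>w. joins (TB B1) pt pt w \<and> path_hom (TB B) pt pt q w"
      if "v \<in> vertices B" "w \<in> vertices B" "path_hom (TB B) v w p q" "\<exists>w. joins (TB B1) pt pt w \<and> path_hom (TB B) pt pt p w" for v w p q
    proof -
      have "path_hom (TB B) pt pt p q" using that(1-3) vertices_B(1) by simp
      from path_hom_trans[OF path_hom_sym[OF this]] that(4) show ?thesis by blast
    qed
    show "\<exists>w. joins (TB B1) pt pt w \<and> path_hom (TB B) pt pt (\<lambda>t. v) w" if "v \<in> vertices B" for v
    proof -
      have "joins (TB B1) pt pt (\<lambda>t. pt)" "path_hom (TB B) pt pt (\<lambda>t. pt) (\<lambda>t. pt)"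
        by (rule joins_const[OF pt_top(1)], rule path_hom_refl[OF joins_const[OF pt_top(3)]])
      moreover have "v = pt" using that vertices_B by simp
      ultimately show ?thesis by blast
    qed
    show "\<exists>w. joins (TB B1) pt pt w \<and> path_hom (TB B) pt pt (edge_path X e) w" if "e \<in> B" "dm e = 1" for e
    proof -
      have "e \<in> B1" using that by (simp add: B1_def)
      then have j: "joins (TB B1) pt pt (edge_path X e)" using edge_joins[OF B1 _ that(2)] vertices_B by auto
      have "path_hom (TB B) pt pt (edge_path X e) (edge_path X e)"
        by (rule path_hom_refl[OF joins_TB_mono[OF j B1_sub(2)]])
      with j show ?thesis by blast
    qed
    show "\<exists>w. joins (TB B1) pt pt w \<and> path_hom (TB B) pt pt (\<lambda>t. p (1 - t)) w"
      if *: "\<exists>w. joins (TB B1) pt pt w \<and> path_hom (TB B) pt pt p w" for p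
    proof -
      obtain w where w: "joins (TB B1) pt pt w" "path_hom (TB B) pt pt p w" using * by blast
      from joins_rev[OF w(1)] path_hom_rev[OF w(2)] show ?thesis by blast
    qed
    show "\<exists>w. joins (TB B1) pt pt w \<and> path_hom (TB B) pt pt (loop_join p q) w"
      if *: "\<exists>w. joins (TB B1) pt pt w \<and> path_hom (TB B) pt pt p w" "\<exists>w. joins (TB B1) pt pt w \<and> path_hom (TB B) pt pt q w" for p q
    proof -
      obtain w w' where w: "joins (TB B1) pt pt w" "path_hom (TB B) pt pt p w" "joins (TB B1) pt pt w'" "path_hom (TB B) pt pt q w'"
        using * by blast
      from joins_loop_join[OF w(1,3)] path_hom_join[OF w(2,4)] show ?thesis by blast
    qed
  qed (rule B)
  show ?thesis using Q.path_predicate_holds[OF _ _ p] vertices_B that by blast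
qed

lemma deformation_retract:
  obtains \<rho> K where "continuous_map T (TB B) \<rho>" "continuous_map (cyl T) T K"
    "\<And>x. x \<in> topspace T \<Longrightarrow> K (0, x) = \<rho> x" "\<And>x. x \<in> topspace T \<Longrightarrow> K (1, x) = x"
    "\<And>t x. t \<in> {0..1} \<Longrightarrow> x \<in> cells_union B \<Longrightarrow> K (t, x) = x" "\<And>x. x \<in> cells_union B \<Longrightarrow> \<rho> x = x"
  by (rule homotopy_equivalence_deformation_retract[OF cofibration_cells_union[OF B] he]) blast

text \<open>The retraction moves the loop into \<open>M\<close> through loops at \<open>pt\<close>,
  because the deformation fixes \<open>M\<close> pointwise; from there
  \<open>loop_into_skeleton\<close> takes over.\<close>

lemma loop_into_retract_skeleton:
  assumes p: "joins T pt pt p"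
  obtains w where "joins (TB B1) pt pt w" "path_hom T pt pt p w"
proof -
  obtain \<rho> K where \<rho>: "continuous_map T (TB B) \<rho>" and K: "continuous_map (cyl T) T K"
    "\<And>x. x \<in> topspace T \<Longrightarrow> K (0, x) = \<rho> x" "\<And>x. x \<in> topspace T \<Longrightarrow> K (1, x) = x"
    "\<And>t x. t \<in> {0..1} \<Longrightarrow> x \<in> cells_union B \<Longrightarrow> K (t, x) = x" and \<rho>B: "\<And>x. x \<in> cells_union B \<Longrightarrow> \<rho> x = x"
    by (rule deformation_retract) blast
  have "joins (TB B) pt pt (\<lambda>t. \<rho> (p t))" using joins_image[OF p \<rho>] \<rho>B pt_in by simp
  then obtain w where w: "joins (TB B1) pt pt w" "path_hom (TB B) pt pt (\<lambda>t. \<rho> (p t)) w"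
    by (rule loop_into_skeleton)
  have "path_hom T pt pt (\<lambda>t. \<rho> (p t)) p"
  proof (rule path_homI)
    have "continuous_map (cyl UI) (cyl T) (\<lambda>z. (fst z, p (snd z)))"
      by (intro continuous_map_pairedI continuous_map_fst continuous_map_composeI[OF joins_continuous[OF p] continuous_map_snd])
    from continuous_map_composeI[OF K(1) this]
    show "continuous_map (cyl UI) T (\<lambda>z. K (fst z, p (snd z)))" .
    have "p 0 = pt" "p 1 = pt" using p by (simp_all add: joins_def)
    then show "K (fst (s, 0), p (snd (s, 0)))  = pt" "K (fst (s, 1), p (snd (s, 1))) = pt" if "s \<in> {0..1}" for s :: real
      using K(4) that pt_in by auto
  qed (use K joins_in_topspace[OF p] in auto)
  then have "path_hom T pt pt p (\<lambda>t. \<rho> (p t))" by (rule path_hom_sym)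
  then show ?thesis by (rule that[OF w(1) path_hom_trans[OF _ path_hom_TB[OF w(2)]]])
qed

end

subsection \<open>Homotopies of based pairs\<close>

lemma based_pair_map_compose:
  "based_pair_map P Q h \<Longrightarrow> based_pair_map Q R k \<Longrightarrow> based_pair_map P R (k \<circ> h)"
  by (auto simp: based_pair_map_def intro: continuous_map_compose split: prod.splits)

lemma based_pair_homotopicI:
  assumes H: "continuous_map (cyl X) Y H"
    and "\<And>z. z \<in> topspace X \<Longrightarrow> H (0, z) = p z" "\<And>z. z \<in> topspace X \<Longrightarrow> H (1, z) = q z"
    and "\<And>t z. t \<in> {0..1} \<Longrightarrow> z \<in> A \<Longrightarrow> H (t, z) \<in> B" "\<And>t. t \<in> {0..1} \<Longrightarrow> H (t, x) = y"
    and A: "A \<subseteq> topspace X" "x \<in> A"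
  shows "based_pair_homotopic (X, A, x) (Y, B, y) p q"
  unfolding based_pair_homotopic_def fst_conv
proof (subst homotopic_with)
  fix h k :: "'a \<Rightarrow> 'b" assume eq: "\<And>z. z \<in> topspace X \<Longrightarrow> h z = k z"
  have "continuous_map X Y h \<longleftrightarrow> continuous_map X Y k" using eq continuous_map_eq by metis
  moreover have "h ` A = k ` A" using eq A by (intro image_cong) auto
  moreover have "h x = k x" using eq A by blast
  ultimately show "based_pair_map (X, A, x) (Y, B, y) h = based_pair_map (X, A, x) (Y, B, y) k"
    by (simp add: based_pair_map_def)
next
  have "based_pair_map (X, A, x) (Y, B, y) (\<lambda>z. H (t, z))" if "t \<in> {0..1}" for t
    using continuous_map_time[OF H that] assms(4,5) that by (auto simp: based_pair_map_def)
  then show "\<exists>h. continuous_map (cyl X) Y h \<and> (\<forall>z\<in>topspace X. h (0, z) = p z) \<and> (\<forall>z\<in>topspace X. h (1, z) = q z) \<and>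
      (\<forall>t\<in>{0..1}. based_pair_map (X, A, x) (Y, B, y) (\<lambda>z. h (t, z)))"
    using assms by (intro exI[of _ H]) auto
qed

text \<open>\<open>g f \<simeq> g f g f' \<simeq> g f' \<simeq> 1\<close>\<close>

lemma based_pair_homotopy_equivalentI:
  assumes g: "based_pair_map P Q g" and f: "based_pair_map Q P f" and f': "based_pair_map Q P f'"
    and fg: "based_pair_homotopic P P (f \<circ> g) id" and gf': "based_pair_homotopic Q Q (g \<circ> f') id"
  shows "based_pair_homotopy_equivalent P Q"
proof -
  have cont: "continuous_map (fst P) (fst Q) g" "continuous_map (fst Q) (fst P) f" "continuous_map (fst Q) (fst P) f'"
    using g f f' by (auto simp: based_pair_map_def split: prod.splits)
  note comp = based_pair_map_compose
  have "homotopic_with (based_pair_map Q Q) (fst Q) (fst Q) (g \<circ> f \<circ> (g \<circ> f')) (g \<circ> f \<circ> id)"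
    by (rule homotopic_with_compose_continuous_map_left[OF gf'[unfolded based_pair_homotopic_def]
          continuous_map_compose[OF cont(2,1)]]) (rule comp[OF _ comp[OF f g]])
  moreover have "homotopic_with (based_pair_map P Q) (fst P) (fst Q) (g \<circ> (f \<circ> g)) (g \<circ> id)"
    by (rule homotopic_with_compose_continuous_map_left[OF fg[unfolded based_pair_homotopic_def] cont(1)]) (rule comp[OF _ g])
  then have "homotopic_with (based_pair_map Q Q) (fst Q) (fst Q) (g \<circ> (f \<circ> g) \<circ> f') (g \<circ> id \<circ> f')"
    by (rule homotopic_with_compose_continuous_map_right[OF _ cont(3)]) (rule comp[OF f'])
  ultimately have "based_pair_homotopic Q Q (g \<circ> f) (g \<circ> f')"
    unfolding based_pair_homotopic_def by (simp add: o_assoc) (metis homotopic_with_trans homotopic_with_sym)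
  then have "based_pair_homotopic Q Q (g \<circ> f) id"
    using gf' unfolding based_pair_homotopic_def by (rule homotopic_with_trans)
  then show ?thesis
    using g f fg unfolding based_pair_homotopy_equivalent_def by blast
qed

subsection \<open>Comparing the fundamental groups of the 1-skeleta\<close>

text \<open>All choices are fixed here: representatives \<open>\<gamma> j\<close> of the generators,
  loops \<open>w j\<close> in the 1-skeleton of \<open>M\<close> correcting them, disks
  \<open>F j\<close> in \<open>N\<close> bounded by the corrected loops, and paths
  \<open>gam\<close> from the base point to the vertices of \<open>N\<close>, which take the place
  of a maximal tree.\<close>

locale wedge_data = retract_data X B e0 pt for X :: "('a, 'c) cw" and B e0 pt +
  fixes m n :: nat and d :: "nat \<Rightarrow> 'c" and c :: "nat \<Rightarrow> (real \<Rightarrow> 'a) set"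
    and \<gamma> w :: "nat \<Rightarrow> real \<Rightarrow> 'a" and F :: "nat \<Rightarrow> (nat \<Rightarrow> real) \<Rightarrow> 'a" and gam :: "'a \<Rightarrow> real \<Rightarrow> 'a"
  assumes d: "d ` {..<m} = {e \<in> B. dm e = 1}"
    and \<gamma>: "\<And>j. j < n \<Longrightarrow> joins T1 pt pt (\<gamma> j)" and c: "\<And>j. j < n \<Longrightarrow> c j = loop_class T1 pt (\<gamma> j)"
    and w: "\<And>j. j < n \<Longrightarrow> joins (TB B1) pt pt (w j)"
    and F: "\<And>j. j < n \<Longrightarrow> continuous_map (disk 2) T (F j)"
    and F_circle: "\<And>j t. j < n \<Longrightarrow> t \<in> {0..1} \<Longrightarrow> F j (circle_path t) = loop_join (\<gamma> j) (rev_path (w j)) t"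
    and gam: "\<And>v. v \<in> vertices S1 \<Longrightarrow> joins T1 pt v (gam v)" and gam_pt: "gam pt = (\<lambda>t. pt)"
    and free: "free_group_on (fundamental_group T1 pt) ({..<m} <+> {..<n})
      (case_sum (\<lambda>i. loop_class T1 pt (edge_path X (d i))) c)"
begin

sublocale wd: disk_wedge "TB B" pt n B D \<phi>
  by unfold_locales (rule pt_top(3), rule generated_cells[OF B])

abbreviation "KA \<equiv> wd.KW (cells_union B1)"
abbreviation "KT \<equiv> subtopology wd.W KA"
abbreviation "G \<equiv> fundamental_group T1 pt"
abbreviation "H \<equiv> fundamental_group KT None"

definition \<gamma>' :: "nat \<Rightarrow> real \<Rightarrow> 'a" where "\<gamma>' j = loop_join (\<gamma> j) (rev_path (w j))"
definition \<kappa> :: "nat \<Rightarrow> real \<Rightarrow> 'a disk_wedge" where "\<kappa> j t = wd.kD j (circle_path t)"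
definition \<iota> :: "(real \<Rightarrow> 'a) \<Rightarrow> real \<Rightarrow> 'a disk_wedge" where "\<iota> p t = wd.iW (p t)"
definition f :: "'a disk_wedge \<Rightarrow> 'a" where "f = wd.wmap (\<lambda>x. x) F"

lemma topspace_TB_B: "topspace (TB B) = cells_union B" by (rule topspace_TB[OF BC])

lemma w_T1: "j < n \<Longrightarrow> joins T1 pt pt (w j)"
  using joins_TB_mono[OF w B1_sub(1)] .

lemma \<gamma>': "j < n \<Longrightarrow> joins T1 pt pt (\<gamma>' j)"
  unfolding \<gamma>'_def by (rule joins_loop_join[OF \<gamma> joins_rev[OF w_T1]])

lemma F_base: "j < n \<Longrightarrow> F j disk_base = pt"
  using F_circle[of j 0] \<gamma>[of j] by (simp add: loop_join_def joins_def)

lemma f_iW: "f (wd.iW x) = x" and f_kD: "j < n \<Longrightarrow> f (wd.kD j y) = F j y"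
  by (simp_all add: f_def wd.wmap_iW wd.wmap_kD F_base)

lemma f_None: "f None = pt" using f_iW[of pt] by (simp add: wd.iW_pt)

lemma continuous_map_f: "continuous_map wd.W T f"
proof (rule wd.continuous_map_from_W)
  show "continuous_map (TB B) T (\<lambda>x. f (wd.iW x))"
    by (simp add: f_iW continuous_map_from_subtopology continuous_map_ident)
  show "continuous_map (disk 2) T (\<lambda>y. f (wd.kD j y))" if "j < n" for j
    using F[OF that] by (simp add: f_kD that)
qed

lemma B1_B: "cells_union B1 \<subseteq> cells_union B" and B1_S1: "cells_union B1 \<subseteq> cells_union S1"
  using B1_sub by (auto simp: cells_union_def)

lemma KA_sub: "KA \<subseteq> wd.KW (topspace (TB B))" "KA \<subseteq> topspace wd.W"
proof -
  show "KA \<subseteq> wd.KW (topspace (TB B))" using B1_B unfolding topspace_TB_B by (auto simp: wd.KW_def)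
  show "KA \<subseteq> topspace wd.W" by (rule wd.KW_subset) (use B1_B topspace_TB_B in blast)
qed

lemma topspace_KT: "topspace KT = KA" using KA_sub(2) by auto

lemma None_KA: "None \<in> KA" using wd.iW_in_KW[OF pt_in(1)] by (simp add: wd.iW_pt)

lemma f_KA: "k \<in> KA \<Longrightarrow> f k \<in> cells_union S1"
proof -
  have "F j y \<in> cells_union S1" if j: "j < n" and y: "y \<in> boundary_sphere 2" for j y
    using F_circle[OF j circle_angle(1)[OF y]] circle_angle(2)[OF y]
      joins_in_topspace[OF \<gamma>'[OF j, unfolded \<gamma>'_def] circle_angle(1)[OF y]] by simp
  then show "k \<in> KA \<Longrightarrow> f k \<in> cells_union S1"
    using B1_S1 by (auto simp: wd.KW_def f_iW f_kD)
qed

lemma continuous_map_f_KT: "continuous_map KT T1 f"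
  using continuous_map_from_subtopology[OF continuous_map_f] f_KA KA_sub by (auto simp: continuous_map_in_subtopology)

lemma joins_\<kappa>: "j < n \<Longrightarrow> joins KT None None (\<kappa> j)"
  using continuous_map_composeI[OF wd.continuous_map_kD continuous_map_circle_path] wd.kD_in_KW circle_path_boundary
  by (auto simp: joins_def pathin_def continuous_map_in_subtopology \<kappa>_def[abs_def] wd.kD_base)

lemma continuous_map_iW_KT: "continuous_map (TB B1) KT wd.iW"
proof -
  have "continuous_map (TB B1) (TB B) (\<lambda>x. x)"
    using B1_B by (auto simp: continuous_map_in_subtopology continuous_map_from_subtopology continuous_map_ident)
  from continuous_map_composeI[OF wd.continuous_map_iW this] show ?thesis
    using wd.iW_in_KW by (auto simp: continuous_map_in_subtopology)
qed

lemma joins_\<iota>: "joins (TB B1) pt pt p \<Longrightarrow> joins KT None None (\<iota> p)"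
  using joins_image[OF _ continuous_map_iW_KT, of pt pt p] by (simp add: \<iota>_def[abs_def] wd.iW_pt)

lemma path_hom_\<iota>: "path_hom (TB B1) pt pt p q \<Longrightarrow> path_hom KT None None (\<iota> p) (\<iota> q)"
  using path_hom_image[OF _ continuous_map_iW_KT, of pt pt p q] by (simp add: \<iota>_def[abs_def] wd.iW_pt)

lemma \<iota>_join: "\<iota> (loop_join p q) = loop_join (\<iota> p) (\<iota> q)" and \<iota>_rev: "\<iota> (rev_path p) = rev_path (\<iota> p)"
  by (auto simp: \<iota>_def[abs_def] loop_join_def)

lemma edge_B1:
  assumes "e \<in> B" "dm e = 1" shows "joins (TB B1) pt pt (edge_path X e)"
proof -
  have "e \<in> B1" using assms by (simp add: B1_def)
  then show ?thesis using edge_joins[OF B1 _ assms(2)] vertices_B by auto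
qed

lemma d_edge: "i < m \<Longrightarrow> joins (TB B1) pt pt (edge_path X (d i))"
  using d by (intro edge_B1) auto

lemma group_G: "group G" and group_H: "group H"
  using group_fundamental_group[OF pt_top(2)] group_fundamental_group[of None KT] topspace_KT None_KA by auto

text \<open>The homomorphism meant to be induced by the inverse map. Its value on
  \<open>\<gamma> j\<close> is dictated by the wish that the corrected loop
  \<open>\<gamma>' j\<close> correspond to the circle \<open>\<kappa> j\<close>.\<close>

definition \<theta> :: "(real \<Rightarrow> 'a) set \<Rightarrow> (real \<Rightarrow> 'a disk_wedge) set" where
  "\<theta> = (SOME \<theta>. \<theta> \<in> hom G H \<and> (\<forall>i<m. \<theta> (loop_class T1 pt (edge_path X (d i))) = loop_class KT None (\<iota> (edge_path X (d i)))) \<and>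
     (\<forall>j<n. \<theta> (loop_class T1 pt (\<gamma> j)) = loop_class KT None (loop_join (\<kappa> j) (\<iota> (w j)))))"

lemma \<theta>: "\<theta> \<in> hom G H" "\<And>i. i < m \<Longrightarrow> \<theta> (loop_class T1 pt (edge_path X (d i))) = loop_class KT None (\<iota> (edge_path X (d i)))"
  "\<And>j. j < n \<Longrightarrow> \<theta> (loop_class T1 pt (\<gamma> j)) = loop_class KT None (loop_join (\<kappa> j) (\<iota> (w j)))"
proof -
  let ?b = "case_sum (\<lambda>i. loop_class KT None (\<iota> (edge_path X (d i)))) (\<lambda>j. loop_class KT None (loop_join (\<kappa> j) (\<iota> (w j))))"
  have b': "?b \<in> {..<m} <+> {..<n} \<rightarrow> carrier H"
    using joins_\<iota>[OF d_edge] joins_loop_join[OF joins_\<kappa> joins_\<iota>[OF w]] by (auto intro!: loop_class_in_carrier)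
  obtain t where t: "t \<in> hom G H" "\<And>s. s \<in> {..<m} <+> {..<n} \<Longrightarrow> t (case_sum (\<lambda>i. loop_class T1 pt (edge_path X (d i))) c s) = ?b s"
    by (rule free_group_on_hom[OF free group_H b']) blast
  have "\<exists>\<theta>. \<theta> \<in> hom G H \<and> (\<forall>i<m. \<theta> (loop_class T1 pt (edge_path X (d i))) = loop_class KT None (\<iota> (edge_path X (d i)))) \<and>
     (\<forall>j<n. \<theta> (loop_class T1 pt (\<gamma> j)) = loop_class KT None (loop_join (\<kappa> j) (\<iota> (w j))))"
  proof (intro exI[of _ t] conjI allI impI t(1))
    show "t (loop_class T1 pt (edge_path X (d i))) = loop_class KT None (\<iota> (edge_path X (d i)))" if "i < m" for i
      using t(2)[OF InlI, of i] that by simp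
    show "t (loop_class T1 pt (\<gamma> j)) = loop_class KT None (loop_join (\<kappa> j) (\<iota> (w j)))" if "j < n" for j
      using t(2)[OF InrI, of j] that c[of j] by simp
  qed
  from someI_ex[OF this, folded \<theta>_def]
  show "\<theta> \<in> hom G H" "\<And>i. i < m \<Longrightarrow> \<theta> (loop_class T1 pt (edge_path X (d i))) = loop_class KT None (\<iota> (edge_path X (d i)))"
    "\<And>j. j < n \<Longrightarrow> \<theta> (loop_class T1 pt (\<gamma> j)) = loop_class KT None (loop_join (\<kappa> j) (\<iota> (w j)))"
    by blast+
qed

text \<open>The graph of \<open>\<theta>\<close> on representatives, so that the geometric
  constructions can handle loops instead of classes.\<close>

definition corr :: "(real \<Rightarrow> 'a) \<Rightarrow> (real \<Rightarrow> 'a disk_wedge) \<Rightarrow> bool" where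
  "corr p q \<longleftrightarrow> joins T1 pt pt p \<and> joins KT None None q \<and> \<theta> (loop_class T1 pt p) = loop_class KT None q"

lemma corr_hom:
  assumes "corr p q" "path_hom T1 pt pt p p'" "path_hom KT None None q q'"
  shows "corr p' q'"
  using assms loop_class_eqI[OF assms(2)] loop_class_eqI[OF assms(3)] path_hom_joins(2)[OF assms(2)] path_hom_joins(2)[OF assms(3)]
  by (simp add: corr_def)

lemma corr_unique:
  assumes "corr p q" "corr p q'" shows "path_hom KT None None q q'"
  using assms by (auto simp: corr_def intro: loop_class_eqD)

lemma corr_ex:
  assumes "joins T1 pt pt p" obtains q where "corr p q"
proof -
  have "\<theta> (loop_class T1 pt p) \<in> carrier H"
    using \<theta>(1) loop_class_in_carrier[OF assms] by (rule hom_in_carrier)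
  then show ?thesis using assms that by (auto simp: carrier_fundamental_group corr_def)
qed

lemma corr_const: "corr (\<lambda>t. pt) (\<lambda>t. None)"
proof -
  interpret group_hom G H \<theta> using group_G group_H \<theta>(1) by (simp add: group_hom_def group_hom_axioms_def)
  have "None \<in> topspace KT" unfolding topspace_KT by (rule None_KA)
  then show ?thesis
    using hom_one joins_const[OF pt_top(2)] joins_const[of None KT]
    by (simp add: corr_def one_fundamental_group del: topspace_subtopology)
qed

lemma corr_join: "corr p q \<Longrightarrow> corr p' q' \<Longrightarrow> corr (loop_join p p') (loop_join q q')"
proof -
  assume a: "corr p q" "corr p' q'"
  then have j: "joins T1 pt pt p" "joins T1 pt pt p'" "joins KT None None q" "joins KT None None q'"
    by (simp_all add: corr_def)
  have "\<theta> (loop_class T1 pt p \<otimes>\<^bsub>G\<^esub> loop_class T1 pt p') = \<theta> (loop_class T1 pt p) \<otimes>\<^bsub>H\<^esub> \<theta> (loop_class T1 pt p')"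
    using \<theta>(1) j by (intro hom_mult loop_class_in_carrier)
  then show ?thesis
    using a j by (simp add: corr_def mult_fundamental_group joins_loop_join[of _ _ pt] joins_loop_join[of _ _ None])
qed

lemma corr_rev: "corr p q \<Longrightarrow> corr (rev_path p) (rev_path q)"
proof -
  assume a: "corr p q"
  then have j: "joins T1 pt pt p" "joins KT None None q" by (simp_all add: corr_def)
  interpret group_hom G H \<theta> using group_G group_H \<theta>(1) by (simp add: group_hom_def group_hom_axioms_def)
  show ?thesis
    using hom_inv[OF loop_class_in_carrier[OF j(1)]] a j by (simp add: corr_def inv_fundamental_group joins_rev)
qed

lemma corr_\<gamma>: "j < n \<Longrightarrow> corr (\<gamma> j) (loop_join (\<kappa> j) (\<iota> (w j)))"
  using \<gamma> \<theta>(3) joins_loop_join[OF joins_\<kappa> joins_\<iota>[OF w]] by (simp add: corr_def)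

lemma corr_edge:
  assumes "e \<in> B" "dm e = 1" shows "corr (edge_path X e) (\<iota> (edge_path X e))"
proof -
  have "e \<in> d ` {..<m}" using assms d by simp
  then obtain i where "i < m" "e = d i" by auto
  then show ?thesis
    using \<theta>(2) joins_TB_mono[OF edge_B1[OF assms] B1_sub(1)] joins_\<iota>[OF edge_B1[OF assms]] by (simp add: corr_def)
qed

text \<open>By definition \<open>\<theta>\<close> agrees with the inclusion on the edges of
  \<open>M\<close>. The loops \<open>w j\<close> are arbitrary, however, so path induction has to
  extend this to all loops in the 1-skeleton of \<open>M\<close>.\<close>

lemma corr_\<iota>:
  assumes p: "joins (TB B1) pt pt p" shows "corr p (\<iota> p)"
proof -
  interpret Q: path_predicate X B1 "\<lambda>p. corr p (\<iota> p)"
  proof unfold_locales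
    show "corr q (\<iota> q)" if "v \<in> vertices B1" "v' \<in> vertices B1" "path_hom (TB B1) v v' p q" "corr p (\<iota> p)" for v v' p q
    proof -
      have h: "path_hom (TB B1) pt pt p q" using that vertices_B(2) by simp
      show ?thesis by (rule corr_hom[OF that(4) path_hom_TB_mono[OF h B1_sub(1)] path_hom_\<iota>[OF h]])
    qed
    show "corr (\<lambda>t. v) (\<iota> (\<lambda>t. v))" if "v \<in> vertices B1" for v
    proof -
      have "v = pt" using that vertices_B(2) by simp
      then show ?thesis using corr_const by (simp add: \<iota>_def[abs_def] wd.iW_pt)
    qed
    show "corr (edge_path X e) (\<iota> (edge_path X e))" if "e \<in> B1" "dm e = 1" for e
      using corr_edge that B1_sub by blast
    show "corr (rev_path p) (\<iota> (rev_path p))" if "corr p (\<iota> p)" for p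
      using corr_rev[OF that] by (simp add: \<iota>_rev)
    show "corr (loop_join p q) (\<iota> (loop_join p q))" if "corr p (\<iota> p)" "corr q (\<iota> q)" for p q
      using corr_join[OF that] by (simp add: \<iota>_join)
  qed (rule B1)
  show ?thesis using Q.path_predicate_holds[OF _ _ p] vertices_B by simp
qed

text \<open>By \<open>corr_\<iota>\<close> the reverse of \<open>w j\<close> corresponds to itself
  and cancels the factor \<open>w j\<close> in the value of \<open>\<theta>\<close>, which leaves
  the bare circle.\<close>

lemma corr_\<gamma>': "j < n \<Longrightarrow> corr (\<gamma>' j) (\<kappa> j)"
proof -
  assume j: "j < n"
  note k = joins_\<kappa>[OF j] and i = joins_\<iota>[OF w[OF j]]
  have "path_hom KT None None (loop_join (loop_join (\<kappa> j) (\<iota> (w j))) (rev_path (\<iota> (w j)))) (\<kappa> j)"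
    by (rule path_hom_sym[OF path_hom_cancel_right[OF path_hom_refl[OF joins_loop_join[OF k i]] k i]])
  moreover have "corr (\<gamma>' j) (loop_join (loop_join (\<kappa> j) (\<iota> (w j))) (rev_path (\<iota> (w j))))"
    unfolding \<gamma>'_def by (rule corr_join[OF corr_\<gamma>[OF j] corr_rev[OF corr_\<iota>[OF w[OF j]]]])
  ultimately show ?thesis using corr_hom[OF _ path_hom_refl[OF \<gamma>'[OF j]]] by blast
qed

lemma path_hom_f: "path_hom KT None None q q' \<Longrightarrow> path_hom T1 pt pt (\<lambda>t. f (q t)) (\<lambda>t. f (q' t))"
  using path_hom_image[OF _ continuous_map_f_KT, of None None q q'] by (simp add: f_None)

lemma joins_f: "joins KT None None q \<Longrightarrow> joins T1 pt pt (\<lambda>t. f (q t))"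
  using joins_image[OF _ continuous_map_f_KT, of None None q] by (simp add: f_None)

lemma f_\<gamma>: "j < n \<Longrightarrow> path_hom T1 pt pt (\<lambda>t. f (loop_join (\<kappa> j) (\<iota> (w j)) t)) (\<gamma> j)"
proof -
  assume j: "j < n"
  have "path_hom T1 pt pt (\<lambda>t. f (\<kappa> j t)) (\<gamma>' j)"
    by (rule path_hom_eq[OF joins_f[OF joins_\<kappa>[OF j]]]) (simp add: \<kappa>_def f_kD j F_circle \<gamma>'_def)
  moreover have "(\<lambda>t. f (\<iota> (w j) t)) = w j" by (simp add: \<iota>_def f_iW)
  ultimately have "path_hom T1 pt pt (loop_join (\<lambda>t. f (\<kappa> j t)) (\<lambda>t. f (\<iota> (w j) t))) (loop_join (\<gamma>' j) (w j))"
    using path_hom_join[OF _ path_hom_refl[OF w_T1[OF j]]] by simp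
  also have "path_hom T1 pt pt (loop_join (\<gamma>' j) (w j)) (\<gamma> j)"
    using path_hom_sym[OF path_hom_cancel_right[OF path_hom_refl[OF \<gamma>'[OF j, unfolded \<gamma>'_def]] \<gamma>[OF j] joins_rev[OF w_T1[OF j]]]]
    by (simp add: \<gamma>'_def)
  finally show ?thesis by (simp add: loop_join_image)
qed

text \<open>\<open>f\<close> undoes \<open>\<theta>\<close>, which by freeness is checked on the
  generators: on edges of \<open>M\<close> it is immediate, and on \<open>\<gamma> j\<close> the
  factor \<open>w j\<close> cancels.\<close>

lemma corr_f:
  assumes "corr p q" shows "path_hom T1 pt pt (\<lambda>t. f (q t)) p"
proof -
  have "loop_class T1 pt p \<in> carrier G" using assms by (auto simp: corr_def intro: loop_class_in_carrier)
  \<comment> \<open>Only existence of suitable representatives is proved by induction; the given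
    pair is compared with them afterwards, since \<open>\<theta>\<close> determines \<open>q\<close>
    up to homotopy.\<close>
  from free this have "\<exists>p' q'. loop_class T1 pt p = loop_class T1 pt p' \<and> corr p' q' \<and> path_hom T1 pt pt (\<lambda>t. f (q' t)) p'"
  proof (induction rule: free_group_on_induct)
    case one
    have "path_hom T1 pt pt (\<lambda>t. f None) (\<lambda>t. pt)" using path_hom_refl[OF joins_const[OF pt_top(2)]] by (simp add: f_None)
    then show ?case
      by (intro exI[of _ "\<lambda>t. pt"] exI[of _ "\<lambda>t. None"] conjI one_fundamental_group corr_const)
  next
    case (gen s)
    then consider i where "i < m" "s = Inl i" | j where "j < n" "s = Inr j" by auto
    then show ?case
    proof cases
      case 1
      then have e: "d i \<in> B" "dm (d i) = 1" using d by auto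
      have "(\<lambda>t. f (\<iota> (edge_path X (d i)) t)) = edge_path X (d i)" by (simp add: \<iota>_def f_iW)
      then have "path_hom T1 pt pt (\<lambda>t. f (\<iota> (edge_path X (d i)) t)) (edge_path X (d i))"
        using corr_edge[OF e] by (simp add: corr_def path_hom_refl)
      then show ?thesis using corr_edge[OF e] 1 by auto
    next
      case 2
      then show ?thesis using corr_\<gamma>[OF 2(1)] f_\<gamma>[OF 2(1)] c[OF 2(1)] by auto
    qed
  next
    case (inv x)
    then obtain p q where pq: "x = loop_class T1 pt p" "corr p q" "path_hom T1 pt pt (\<lambda>t. f (q t)) p" by blast
    have "inv\<^bsub>G\<^esub> x = loop_class T1 pt (rev_path p)" using pq by (simp add: corr_def inv_fundamental_group)
    then show ?case using corr_rev[OF pq(2)] path_hom_rev[OF pq(3)] by blast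
  next
    case (mult x y)
    then obtain p q p' q' where pq: "x = loop_class T1 pt p" "corr p q" "path_hom T1 pt pt (\<lambda>t. f (q t)) p"
      and pq': "y = loop_class T1 pt p'" "corr p' q'" "path_hom T1 pt pt (\<lambda>t. f (q' t)) p'" by blast
    have "x \<otimes>\<^bsub>G\<^esub> y = loop_class T1 pt (loop_join p p')"
      using pq pq' by (simp add: corr_def mult_fundamental_group)
    moreover have "path_hom T1 pt pt (\<lambda>t. f (loop_join q q' t)) (loop_join p p')"
      using path_hom_join[OF pq(3) pq'(3)] by (simp add: loop_join_image)
    ultimately show ?case using corr_join[OF pq(2) pq'(2)] by blast
  qed
  then obtain p' q' where pq: "loop_class T1 pt p = loop_class T1 pt p'" "corr p' q'" "path_hom T1 pt pt (\<lambda>t. f (q' t)) p'" by blast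
  have "joins T1 pt pt p'" using pq(2) by (simp add: corr_def)
  then have pp: "path_hom T1 pt pt p p'" by (rule loop_class_eqD[OF pq(1)])
  have "path_hom KT None None q q'"
    using corr_unique[OF corr_hom[OF assms pp path_hom_refl] pq(2)] assms by (simp add: corr_def)
  from path_hom_trans[OF path_hom_trans[OF path_hom_f[OF this] pq(3)] path_hom_sym[OF pp]]
  show ?thesis .
qed

section \<open>Edges of the 1-skeleton of \<open>N\<close> with arbitrary vertices\<close>

definition conjugate :: "(real \<Rightarrow> 'a) \<Rightarrow> real \<Rightarrow> 'a" where
  "conjugate p = loop_join (loop_join (gam (p 0)) p) (rev_path (gam (p 1)))"

text \<open>An edge of \<open>M\<close> keeps its own path instead of some chosen representative, so
  that the inverse map is exactly the inclusion on \<open>M\<close>, not merely up to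
  homotopy.\<close>

definition edge_loop :: "'c \<Rightarrow> real \<Rightarrow> 'a disk_wedge" where
  "edge_loop e = (if e \<in> B then \<iota> (edge_path X e) else (SOME q. corr (conjugate (edge_path X e)) q))"

lemma conjugate_joins:
  "v \<in> vertices S1 \<Longrightarrow> v' \<in> vertices S1 \<Longrightarrow> joins T1 v v' p \<Longrightarrow> joins T1 pt pt (conjugate p)"
  using joins_conjugate[OF gam gam, of v v' p] by (auto simp: conjugate_def joins_def)

lemma conjugate_loop:
  assumes "joins T1 pt pt p" shows "path_hom T1 pt pt (conjugate p) p"
proof -
  have "path_hom T1 pt pt (loop_join (loop_join (\<lambda>t. pt) p) (\<lambda>t. pt)) p"
    by (rule path_hom_trans[OF path_hom_const_right[OF joins_loop_join[OF joins_const[OF pt_top(2)] assms]] path_hom_const_left[OF assms]])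
  then show ?thesis using assms by (simp add: conjugate_def joins_def gam_pt)
qed

lemma corr_edge_loop:
  assumes e: "e \<in> S1" "dm e = 1" shows "corr (conjugate (edge_path X e)) (edge_loop e)"
proof (cases "e \<in> B")
  case True
  have j: "joins T1 pt pt (edge_path X e)" using joins_TB_mono[OF edge_B1[OF True e(2)] B1_sub(1)] .
  have "corr (edge_path X e) (\<iota> (edge_path X e))" by (rule corr_edge[OF True e(2)])
  then show ?thesis
    using corr_hom[OF _ path_hom_sym[OF conjugate_loop[OF j]] path_hom_refl] True by (simp add: edge_loop_def corr_def)
next
  case False
  note ej = edge_joins[OF S1 e]
  obtain q where "corr (conjugate (edge_path X e)) q"
    by (rule corr_ex[OF conjugate_joins[OF ej(2,3,1)]])
  then show ?thesis using someI[of "corr (conjugate (edge_path X e))"] False by (simp add: edge_loop_def)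
qed

text \<open>By \<open>corr_f\<close> the image of the edge loop under \<open>f\<close> is homotopic
  to the edge conjugated by the paths \<open>gam\<close>. Moving the last of these to the other side
  gives two ways around a square, which \<open>square_fill\<close> fills.\<close>

lemma edge_square:
  assumes e: "e \<in> S1" "dm e = 1"
  obtains R where "continuous_map (cyl UI) T1 R"
    "\<And>t. t \<in> {0..1} \<Longrightarrow> R (0, t) = f (edge_loop e t)" "\<And>t. t \<in> {0..1} \<Longrightarrow> R (1, t) = edge_path X e t"
    "\<And>s. s \<in> {0..1} \<Longrightarrow> R (s, 0) = gam (edge_path X e 0) s" "\<And>s. s \<in> {0..1} \<Longrightarrow> R (s, 1) = gam (edge_path X e 1) s"
proof -
  let ?p = "edge_path X e"
  note ej = edge_joins[OF S1 e]
  note g = gam[OF ej(2)] gam[OF ej(3)]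
  have co: "corr (conjugate ?p) (edge_loop e)" by (rule corr_edge_loop[OF e])
  have jl: "joins T1 pt pt (\<lambda>t. f (edge_loop e t))" using joins_f co by (simp add: corr_def)
  have gp: "joins T1 pt (?p 1) (loop_join (gam (?p 0)) ?p)" by (rule joins_loop_join[OF g(1) ej(1)])
  have "path_hom T1 pt (?p 1) (loop_join (\<lambda>t. f (edge_loop e t)) (gam (?p 1))) (loop_join (conjugate ?p) (gam (?p 1)))"
    by (rule path_hom_join[OF corr_f[OF co] path_hom_refl[OF g(2)]])
  also have "path_hom T1 pt (?p 1) \<dots> (loop_join (gam (?p 0)) ?p)"
    using path_hom_sym[OF path_hom_cancel_right[OF path_hom_refl[OF joins_loop_join[OF gp joins_rev[OF g(2)]]] gp joins_rev[OF g(2)]]]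
    by (simp add: conjugate_def)
  finally show ?thesis
    by (rule square_fill[OF _ jl g(2) g(1) ej(1)]) (rule that; assumption)
qed

end

subsection \<open>The homotopy inverse\<close>

text \<open>The expression \<open>(y 0 + 1) / 2\<close> inverts the parametrisation
  \<open>2 * t - 1\<close> of an edge.\<close>

lemma edge_path_char:
  assumes "y \<in> topspace (disk (Suc 0))"
  shows "edge_path X e ((y 0 + 1) / 2) = cw_char X e y"
proof -
  have "(\<lambda>i. if i = 0 then 2 * ((y 0 + 1) / 2) - 1 else 0) = y"
    using assms by (auto simp: fun_eq_iff topspace_disk Suc_le_eq field_simps)
  then show ?thesis by (simp add: edge_path_def)
qed

lemma edge_coordinate:
  assumes "y \<in> topspace (disk (Suc 0))" shows "(y 0 + 1) / 2 \<in> {0..1}"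
  using assms by (auto simp: topspace_disk L2_set_def abs_le_iff)

context wedge_data
begin

text \<open>\<open>M\<close> together with the 1-skeleton of \<open>N\<close>: here the inverse map
  and its homotopy are prescribed before they are extended over \<open>N\<close>.\<close>

definition "BS = B \<union> S1"

lemma BS: "cell_closed BS" unfolding BS_def by (rule cell_closed_Un[OF B S1])

lemma cells_union_BS: "cells_union BS = cells_union B \<union> cells_union S1"
  by (simp add: BS_def cells_union_Un)

lemma BS_not_B: "e \<in> BS \<Longrightarrow> e \<notin> B \<Longrightarrow> dm e = 0 \<or> dm e = Suc 0"
  by (auto simp: BS_def S1_def)

lemma edge_ends:
  assumes e: "e \<in> S1" "dm e = Suc 0" and y: "y \<in> boundary_sphere (dm e)" and z: "z \<in> open_disk (dm g)" "dm g < dm e" "g \<in> C" "\<phi> e y = \<phi> g z"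
  shows "z = (\<lambda>i. 0)" "dm g = 0" "(y 0 + 1) / 2 = 0 \<or> (y 0 + 1) / 2 = 1"
    "edge_path X e ((y 0 + 1) / 2) = \<phi> g z" "\<phi> g z \<in> vertices S1"
proof -
  show g: "dm g = 0" using e z by simp
  then show z0: "z = (\<lambda>i. 0)" using z by (simp add: disk_0)
  show "(y 0 + 1) / 2 = 0 \<or> (y 0 + 1) / 2 = 1" using y boundary_1 e by auto
  show "edge_path X e ((y 0 + 1) / 2) = \<phi> g z"
    using edge_path_char[of y X e] y e z by (simp add: topspace_disk_Un)
  show "\<phi> g z \<in> vertices S1" using g z0 z(3) by (auto simp: vertices_def S1_def)
qed

lemma vertex_of_B:
  assumes "g \<in> B" "dm g = 0" shows "\<phi> g (\<lambda>i. 0) = pt"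
  using assms vertices_B(1) by (auto simp: vertices_def)

lemma edge_loop_joins:
  assumes "e \<in> S1" "dm e = Suc 0" shows "joins KT None None (edge_loop e)"
  using corr_edge_loop[of e] assms by (simp add: corr_def)

lemma edge_coordinate_continuous: "continuous_map (disk (Suc 0)) UI (\<lambda>y. (y 0 + 1) / 2)"
  using edge_coordinate by (intro continuous_map_UI continuous_intros continuous_map_disk_coord) auto

text \<open>All vertices of \<open>N\<close> go to the wedge point, and each edge outside
  \<open>M\<close> runs along its edge loop. This fits together because edge loops begin and end at
  the wedge point.\<close>

lemma skeleton_map:
  obtains a where "continuous_map (TB BS) wd.W a" "\<And>x. x \<in> cells_union B \<Longrightarrow> a x = wd.iW x"
    "\<And>x. x \<in> cells_union S1 \<Longrightarrow> a x \<in> KA" "\<And>v. v \<in> vertices S1 \<Longrightarrow> a v = None"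
    "\<And>e y. e \<in> S1 \<Longrightarrow> dm e = Suc 0 \<Longrightarrow> y \<in> topspace (D e) \<Longrightarrow> a (\<phi> e y) = edge_loop e ((y 0 + 1) / 2)"
proof -
  define u where "u e y = (if e \<in> B then wd.iW (\<phi> e y) else if dm e = 0 then None else edge_loop e ((y 0 + 1) / 2))" for e y
  have compat: "u e y = u g z"
    if h: "e \<in> BS" "g \<in> BS" "y \<in> boundary_sphere (dm e)" "z \<in> open_disk (dm g)" "dm g < dm e" "\<phi> e y = \<phi> g z" for e y g z
  proof -
    have gC: "g \<in> C" using h BS cell_closed_subset by blast
    show ?thesis
    proof (cases "e \<in> B")
      case True
      have "\<phi> e y \<in> cells_union B" using char_in_cells_union[OF B True, of y] h(3) by (simp add: topspace_disk_Un)
      then have "g \<in> B" using cells_union_mem[OF BC gC h(4)] h(6) by simp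
      then show ?thesis using True h(6) by (simp add: u_def)
    next
      case False
      then have e: "e \<in> S1" "dm e = Suc 0" using h BS_not_B[of e] by (auto simp: BS_def)
      note ee = edge_ends[OF e h(3-5) gC h(6)]
      have "u e y = None"
        using edge_loop_joins[OF e] ee(3) False e by (auto simp: u_def joins_def)
      moreover have "u g z = None"
        using ee(1,2) vertex_of_B[of g] by (simp add: u_def wd.iW_pt)
      ultimately show ?thesis by simp
    qed
  qed
  obtain a where a: "\<And>e y. e \<in> BS \<Longrightarrow> y \<in> topspace (D e) \<Longrightarrow> a (\<phi> e y) = u e y"
  proof (rule cells_glue[OF BS, of u])
    fix h assume "\<And>e y. e \<in> BS \<Longrightarrow> y \<in> topspace (D e) \<Longrightarrow> h (\<phi> e y) = u e y"
    then show thesis by (rule that)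
  qed (rule compat; assumption)
  have ao: "a (\<phi> e y) = u e y" if "e \<in> BS" "y \<in> open_disk (dm e)" for e y
    using a[OF that(1)] that(2) by (simp add: topspace_disk_Un)
  show ?thesis
  proof (rule that)
    show "continuous_map (TB BS) wd.W a"
    proof (rule generated_by_continuous_map[OF generated_cells[OF BS]])
      fix e assume e: "e \<in> BS"
      have "continuous_map (D e) wd.W (u e)"
      proof (cases "e \<in> B")
        case True
        then have "continuous_map (D e) wd.W (\<lambda>y. wd.iW (\<phi> e y))"
          using continuous_map_composeI[OF wd.continuous_map_iW wd.continuous_map_gen] by blast
        then show ?thesis using True by (simp add: u_def[abs_def])
      next
        case False
        consider "dm e = 0" | "dm e = Suc 0" "e \<in> S1" using BS_not_B[OF e False] e False by (auto simp: BS_def)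
        then show ?thesis
        proof cases
          case 1
          have "None \<in> topspace wd.W" using None_KA KA_sub by blast
          then show ?thesis using False 1 by (simp add: u_def[abs_def])
        next
          case 2
          have "continuous_map UI wd.W (edge_loop e)"
            using joins_continuous[OF edge_loop_joins[OF 2(2,1)]] continuous_map_in_subtopology by blast
          from continuous_map_composeI[OF this edge_coordinate_continuous]
          show ?thesis using False 2 by (simp add: u_def[abs_def])
        qed
      qed
      then show "continuous_map (D e) wd.W (\<lambda>y. a (\<phi> e y))"
        by (rule continuous_map_eq) (use a[OF e] in auto)
    qed
    show aB: "a x = wd.iW x" if "x \<in> cells_union B" for x
      using that by (rule cells_unionE) (use ao in \<open>auto simp: u_def BS_def\<close>)
    show "a (\<phi> e y) = edge_loop e ((y 0 + 1) / 2)" if e: "e \<in> S1" "dm e = Suc 0" and y: "y \<in> topspace (D e)" for e y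
    proof (cases "e \<in> B")
      case True
      then show ?thesis using a[of e y] e y edge_path_char[of y X e] by (simp add: u_def BS_def edge_loop_def \<iota>_def)
    next
      case False
      then show ?thesis using a[of e y] e y by (simp add: u_def BS_def)
    qed
    show "a v = None" if "v \<in> vertices S1" for v
    proof -
      obtain g where g: "g \<in> S1" "dm g = 0" "v = \<phi> g (\<lambda>i. 0)" using \<open>v \<in> _\<close> by (auto simp: vertices_def)
      have "a v = u g (\<lambda>i. 0)" using ao[of g "\<lambda>i. 0"] g by (simp add: BS_def disk_0)
      then show ?thesis using g vertex_of_B[of g] by (simp add: u_def wd.iW_pt)
    qed
    show "a x \<in> KA" if x: "x \<in> cells_union S1" for x
    proof -
      obtain e y where e: "e \<in> S1" "y \<in> open_disk (dm e)" "x = \<phi> e y" by (rule cells_unionE[OF x])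
      have ax: "a x = u e y" using ao[of e y] e by (simp add: BS_def)
      show ?thesis
      proof (cases "e \<in> B")
        case True
        then have "x \<in> cells_union B1" unfolding e(3) using e by (intro cells_unionI) (auto simp: B1_def S1_def)
        then show ?thesis using ax True e wd.iW_in_KW by (simp add: u_def)
      next
        case False
        then consider "dm e = 0" | "dm e = Suc 0" using BS_not_B[of e] e by (auto simp: BS_def)
        then show ?thesis
        proof cases
          case 1
          then show ?thesis using ax False None_KA by (simp add: u_def)
        next
          case 2
          have "y \<in> topspace (disk (Suc 0))" using e(2) 2 by (simp add: topspace_disk_Un)
          then have "edge_loop e ((y 0 + 1) / 2) \<in> KA"
            using joins_in_topspace[OF edge_loop_joins[OF e(1) 2] edge_coordinate] topspace_KT by blast
          then show ?thesis using ax False 2 by (simp add: u_def)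
        qed
      qed
    qed
  qed
qed

text \<open>Each vertex travels along \<open>gam\<close> and each edge outside \<open>M\<close>
  sweeps out its \<open>edge_square\<close>, whose sides are these same paths. \<open>M\<close>
  stays fixed, consistently at \<open>pt\<close>, where \<open>gam\<close> is constant.\<close>

lemma skeleton_homotopy:
  assumes a: "\<And>x. x \<in> cells_union B \<Longrightarrow> a x = wd.iW x" "\<And>v. v \<in> vertices S1 \<Longrightarrow> a v = None"
    "\<And>e y. e \<in> S1 \<Longrightarrow> dm e = Suc 0 \<Longrightarrow> y \<in> topspace (D e) \<Longrightarrow> a (\<phi> e y) = edge_loop e ((y 0 + 1) / 2)"
  obtains h where "continuous_map (cyl (TB BS)) T h"
    "\<And>x. x \<in> cells_union BS \<Longrightarrow> h (0, x) = f (a x)" "\<And>x. x \<in> cells_union BS \<Longrightarrow> h (1, x) = x"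
    "\<And>s x. s \<in> {0..1} \<Longrightarrow> x \<in> cells_union S1 \<Longrightarrow> h (s, x) \<in> cells_union S1"
    "\<And>s x. s \<in> {0..1} \<Longrightarrow> x \<in> cells_union B \<Longrightarrow> h (s, x) = x"
proof -
  have "\<forall>e\<in>{e \<in> S1. dm e = 1}. \<exists>R. continuous_map (cyl UI) T1 R \<and>
    (\<forall>t\<in>{0..1}. R (0, t) = f (edge_loop e t)) \<and> (\<forall>t\<in>{0..1}. R (1, t) = edge_path X e t) \<and>
    (\<forall>s\<in>{0..1}. R (s, 0) = gam (edge_path X e 0) s) \<and> (\<forall>s\<in>{0..1}. R (s, 1) = gam (edge_path X e 1) s)"
  proof
    fix e assume "e \<in> {e \<in> S1. dm e = 1}"
    then have e: "e \<in> S1" "dm e = 1" by auto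
    show "\<exists>R. continuous_map (cyl UI) T1 R \<and>
      (\<forall>t\<in>{0..1}. R (0, t) = f (edge_loop e t)) \<and> (\<forall>t\<in>{0..1}. R (1, t) = edge_path X e t) \<and>
      (\<forall>s\<in>{0..1}. R (s, 0) = gam (edge_path X e 0) s) \<and> (\<forall>s\<in>{0..1}. R (s, 1) = gam (edge_path X e 1) s)"
      by (rule edge_square[OF e]) blast
  qed
  from bchoice[OF this] obtain R where R: "\<And>e. e \<in> S1 \<Longrightarrow> dm e = 1 \<Longrightarrow> continuous_map (cyl UI) T1 (R e)"
    "\<And>e t. e \<in> S1 \<Longrightarrow> dm e = 1 \<Longrightarrow> t \<in> {0..1} \<Longrightarrow> R e (0, t) = f (edge_loop e t)"
    "\<And>e t. e \<in> S1 \<Longrightarrow> dm e = 1 \<Longrightarrow> t \<in> {0..1} \<Longrightarrow> R e (1, t) = edge_path X e t"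
    "\<And>e s. e \<in> S1 \<Longrightarrow> dm e = 1 \<Longrightarrow> s \<in> {0..1} \<Longrightarrow> R e (s, 0) = gam (edge_path X e 0) s"
    "\<And>e s. e \<in> S1 \<Longrightarrow> dm e = 1 \<Longrightarrow> s \<in> {0..1} \<Longrightarrow> R e (s, 1) = gam (edge_path X e 1) s"
    by blast
  define u where "u e y = (\<lambda>s\<in>{0..1}. if e \<in> B then \<phi> e y else if dm e = 0 then gam (\<phi> e y) s else R e (s, (y 0 + 1) / 2))" for e y
  have compat: "u e y = u g z"
    if h: "e \<in> BS" "g \<in> BS" "y \<in> boundary_sphere (dm e)" "z \<in> open_disk (dm g)" "dm g < dm e" "\<phi> e y = \<phi> g z" for e y g z
  proof -
    have gC: "g \<in> C" using h BS cell_closed_subset by blast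
    show ?thesis
    proof (cases "e \<in> B")
      case True
      have "\<phi> e y \<in> cells_union B" using char_in_cells_union[OF B True, of y] h(3) by (simp add: topspace_disk_Un)
      then have "g \<in> B" using cells_union_mem[OF BC gC h(4)] h(6) by simp
      then show ?thesis using True h(6) by (simp add: u_def)
    next
      case False
      then have e: "e \<in> S1" "dm e = Suc 0" using h BS_not_B[of e] by (auto simp: BS_def)
      note ee = edge_ends[OF e h(3-5) gC h(6)]
      have "R e (s, (y 0 + 1) / 2) = gam (\<phi> g z) s" if "s \<in> {0..1}" for s
        using R(4,5)[of e s] e that ee(3,4) by auto
      then have "u e y = (\<lambda>s\<in>{0..1}. gam (\<phi> g z) s)"
        using False e by (simp add: u_def cong: restrict_cong)
      moreover have "u g z = (\<lambda>s\<in>{0..1}. gam (\<phi> g z) s)"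
        using ee(1,2) vertex_of_B[of g] gam_pt by (auto simp: u_def)
      ultimately show ?thesis by simp
    qed
  qed
  obtain k where k: "\<And>e y. e \<in> BS \<Longrightarrow> y \<in> topspace (D e) \<Longrightarrow> k (\<phi> e y) = u e y"
  proof (rule cells_glue[OF BS, of u])
    fix h assume "\<And>e y. e \<in> BS \<Longrightarrow> y \<in> topspace (D e) \<Longrightarrow> h (\<phi> e y) = u e y"
    then show thesis by (rule that)
  qed (rule compat; assumption)
  have ko: "k (\<phi> e y) s = u e y s" if "e \<in> BS" "y \<in> open_disk (dm e)" for e y s
    using k[OF that(1)] that(2) by (simp add: topspace_disk_Un)
  define h where "h z = k (snd z) (fst z)" for z
  have kB: "k x s = x" if x: "x \<in> cells_union B" and s: "s \<in> {0..1}" for x s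
  proof -
    obtain e y where e: "e \<in> B" "y \<in> open_disk (dm e)" "x = \<phi> e y" by (rule cells_unionE[OF x])
    then show ?thesis using ko[of e y s] s by (simp add: BS_def u_def)
  qed
  have vals: "k x 0 = f (a x) \<and> k x 1 = x \<and> (x \<in> cells_union S1 \<longrightarrow> (\<forall>s\<in>{0..1}. k x s \<in> cells_union S1))"
    if x: "x \<in> cells_union BS" for x
  proof (cases "x \<in> cells_union B")
    case True
    then show ?thesis using kB a(1) f_iW by simp
  next
    case False
    obtain e y where e: "e \<in> BS" "y \<in> open_disk (dm e)" "x = \<phi> e y" by (rule cells_unionE[OF x])
    have eB: "e \<notin> B" using False e cells_unionI by blast
    have eS: "e \<in> S1" using e eB by (auto simp: BS_def)
    have ku: "k x s = u e y s" for s using ko[OF e(1,2)] e(3) by simp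
    consider "dm e = 0" | "dm e = Suc 0" by (rule disjE[OF BS_not_B[OF e(1) eB]])
    then show ?thesis
    proof cases
      case 1
      then have v: "x \<in> vertices S1" using e eS by (auto simp: vertices_def disk_0)
      have kg: "k x s = gam x s" if "s \<in> {0..1}" for s using that ku eB 1 e(3) by (simp add: u_def)
      have g: "gam x 0 = pt" "gam x 1 = x" using gam[OF v] by (simp_all add: joins_def)
      have gS: "gam x s \<in> cells_union S1" if "s \<in> {0..1}" for s
        using joins_in_topspace[OF gam[OF v] that] topspace_TB[OF S1C] by blast
      show ?thesis using kg g a(2)[OF v] f_None gS by simp
    next
      case 2
      have yD: "y \<in> topspace (disk (Suc 0))" using e(2) 2 by (simp add: topspace_disk_Un)
      note y01 = edge_coordinate[OF yD]
      have kR: "k x s = R e (s, (y 0 + 1) / 2)" if "s \<in> {0..1}" for s using that ku eB 2 by (simp add: u_def)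
      have "a x = edge_loop e ((y 0 + 1) / 2)" using a(3)[OF eS 2, of y] yD 2 e(3) by simp
      then have k0: "k x 0 = f (a x)" using R(2)[OF eS _ y01] 2 kR[of 0] by simp
      have k1: "k x 1 = x" using R(3)[OF eS _ y01] 2 kR[of 1] edge_path_char[OF yD, of X e] e(3) by simp
      have "R e (s, (y 0 + 1) / 2) \<in> topspace T1" if "s \<in> {0..1}" for s
        using R(1)[OF eS] 2 y01 that by (auto simp: continuous_map_def Pi_iff)
      then have "k x s \<in> cells_union S1" if "s \<in> {0..1}" for s
        using kR[OF that] that topspace_TB[OF S1C] by simp
      then show ?thesis using k0 k1 by simp
    qed
  qed
  show ?thesis
  proof (rule that)
    show "continuous_map (cyl (TB BS)) T h"
    proof (rule generated_by_continuous_cyl[OF generated_cells[OF BS]])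
      fix e assume e: "e \<in> BS"
      have eC: "e \<in> C" using e BS cell_closed_subset by blast
      have ch: "continuous_map (cyl (D e)) T (\<lambda>z. \<phi> e (snd z))"
        by (rule continuous_map_composeI[OF continuous_char[OF eC] continuous_map_snd])
      have "continuous_map (cyl (D e)) T (\<lambda>z. u e (snd z) (fst z))"
      proof (cases "e \<in> B")
        case True
        show ?thesis by (rule continuous_map_eq[OF ch]) (use True in \<open>auto simp: u_def\<close>)
      next
        case False
        then have eS: "e \<in> S1" using e by (auto simp: BS_def)
        consider "dm e = 0" | "dm e = Suc 0" by (rule disjE[OF BS_not_B[OF e False]])
        then show ?thesis
        proof cases
          case 1
          then have v: "\<phi> e (\<lambda>i. 0) \<in> vertices S1" using eS by (auto simp: vertices_def)
          have "continuous_map UI T (gam (\<phi> e (\<lambda>i. 0)))"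
            using joins_continuous[OF gam[OF v]] continuous_map_in_subtopology by blast
          from continuous_map_composeI[OF this continuous_map_fst]
          show ?thesis by (rule continuous_map_eq) (use False 1 disk_0(1) in \<open>auto simp: u_def\<close>)
        next
          case 2
          have "continuous_map (cyl UI) T (R e)"
            using R(1)[OF eS] 2 continuous_map_in_subtopology by auto
          moreover have "continuous_map (cyl (disk (Suc 0))) (cyl UI) (\<lambda>z. (fst z, (snd z 0 + 1) / 2))"
            by (intro continuous_map_pairedI continuous_map_fst continuous_map_composeI[OF edge_coordinate_continuous continuous_map_snd])
          ultimately have "continuous_map (cyl (disk (Suc 0))) T (\<lambda>z. R e (fst z, (snd z 0 + 1) / 2))"
            by (rule continuous_map_composeI)
          then show ?thesis unfolding 2 by (rule continuous_map_eq) (use False 2 in \<open>auto simp: u_def\<close>)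
        qed
      qed
      then show "continuous_map (cyl (D e)) T (\<lambda>z. h (fst z, \<phi> e (snd z)))"
      proof (rule continuous_map_eq)
        fix z assume "z \<in> topspace (cyl (D e))"
        then have "snd z \<in> topspace (D e)" by auto
        then show "u e (snd z) (fst z) = h (fst z, \<phi> e (snd z))" by (simp add: h_def k[OF e])
      qed
    qed
  qed (use vals kB in \<open>auto simp: h_def cells_union_BS\<close>)
qed

end

section \<open>The two relative liftings\<close>

context wedge_data
begin

lemma inverse_map:
  obtains g h where "continuous_map T wd.W g" "\<And>x. x \<in> cells_union B \<Longrightarrow> g x = wd.iW x"
    "\<And>x. x \<in> cells_union S1 \<Longrightarrow> g x \<in> KA"
    "continuous_map (cyl T) T h" "\<And>x. x \<in> topspace T \<Longrightarrow> h (0, x) = f (g x)" "\<And>x. x \<in> topspace T \<Longrightarrow> h (1, x) = x"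
    "\<And>t x. t \<in> {0..1} \<Longrightarrow> x \<in> cells_union S1 \<Longrightarrow> h (t, x) \<in> cells_union S1" "\<And>t. t \<in> {0..1} \<Longrightarrow> h (t, pt) = pt"
    "\<And>j. j < n \<Longrightarrow> path_hom KT None None (\<lambda>t. g (\<gamma>' j t)) (\<kappa> j)"
proof -
  obtain a where a: "continuous_map (TB BS) wd.W a" "\<And>x. x \<in> cells_union B \<Longrightarrow> a x = wd.iW x"
    "\<And>x. x \<in> cells_union S1 \<Longrightarrow> a x \<in> KA" "\<And>v. v \<in> vertices S1 \<Longrightarrow> a v = None"
    "\<And>e y. e \<in> S1 \<Longrightarrow> dm e = Suc 0 \<Longrightarrow> y \<in> topspace (D e) \<Longrightarrow> a (\<phi> e y) = edge_loop e ((y 0 + 1) / 2)"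
    by (rule skeleton_map) blast
  obtain k where k: "continuous_map (cyl (TB BS)) T k"
    "\<And>x. x \<in> cells_union BS \<Longrightarrow> k (0, x) = f (a x)" "\<And>x. x \<in> cells_union BS \<Longrightarrow> k (1, x) = x"
    "\<And>s x. s \<in> {0..1} \<Longrightarrow> x \<in> cells_union S1 \<Longrightarrow> k (s, x) \<in> cells_union S1"
    "\<And>s x. s \<in> {0..1} \<Longrightarrow> x \<in> cells_union B \<Longrightarrow> k (s, x) = x"
    by (rule skeleton_homotopy[OF a(2,4,5)]) blast+
  obtain \<rho> K where \<rho>: "continuous_map T (TB B) \<rho>" and K: "continuous_map (cyl T) T K"
    "\<And>x. x \<in> topspace T \<Longrightarrow> K (0, x) = \<rho> x" "\<And>x. x \<in> topspace T \<Longrightarrow> K (1, x) = x"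
    "\<And>t x. t \<in> {0..1} \<Longrightarrow> x \<in> cells_union B \<Longrightarrow> K (t, x) = x" and \<rho>B: "\<And>x. x \<in> cells_union B \<Longrightarrow> \<rho> x = x"
    by (rule deformation_retract) blast
  obtain \<rho>W E where \<rho>W: "continuous_map wd.W (TB B) \<rho>W" and E: "continuous_map (cyl wd.W) wd.W E"
    "\<And>w. w \<in> topspace wd.W \<Longrightarrow> E (0, w) = wd.iW (\<rho>W w)" "\<And>w. w \<in> topspace wd.W \<Longrightarrow> E (1, w) = w"
    by (rule wd.deformation_W) blast
  \<comment> \<open>The identity of \<open>N\<close> is lifted through \<open>f\<close>, starting
    from \<open>a\<close> and the homotopy \<open>k\<close> on the subspace. The new homotopy moves
    a point of the subspace only through positions taken under \<open>k\<close>, which keeps the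
    1-skeleton invariant and \<open>pt\<close> fixed.\<close>
  obtain g h where g: "continuous_map T wd.W g" "\<And>x. x \<in> cells_union BS \<Longrightarrow> g x = a x"
    and h: "continuous_map (cyl T) T h" "\<And>x. x \<in> topspace T \<Longrightarrow> h (0, x) = f (g x)"
      "\<And>x. x \<in> topspace T \<Longrightarrow> h (1, x) = x"
      "\<And>t x. t \<in> {0..1} \<Longrightarrow> x \<in> cells_union BS \<Longrightarrow> \<exists>s\<in>{0..1}. h (t, x) = k (s, x)"
  proof (rule relative_lifting[OF wd.continuous_map_iW continuous_map_f _ \<rho>W E \<rho> K(1), where iN = "\<lambda>x. x"
        and A = "cells_union BS" and X = T and a = a and b = "\<lambda>x. x" and H = k])
    show "cofibration T (cells_union BS)" by (rule cofibration_cells_union[OF BS])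
  qed (use K \<rho>B a(1) k(1-3) topspace_TB_B f_iW continuous_map_ident in \<open>simp_all\<close>)
  have gB: "g x = wd.iW x" if "x \<in> cells_union B" for x using g(2)[of x] a(2)[of x] that cells_union_BS by simp
  have gS: "g x = a x" if "x \<in> cells_union S1" for x using g(2)[of x] that cells_union_BS by simp
  have gKA: "g x \<in> KA" if "x \<in> cells_union S1" for x using gS that a(3) by simp
  have gv: "g v = None" if "v \<in> vertices S1" for v using gS[of v] a(4)[OF that] that vertices_subset by auto
  have gKT: "continuous_map T1 KT g"
    using continuous_map_from_subtopology[OF g(1)] gKA by (auto simp: continuous_map_in_subtopology)
  have ghom: "path_hom KT None None (\<lambda>t. g (p t)) (\<lambda>t. g (q t))" if "v \<in> vertices S1" "v' \<in> vertices S1" "path_hom T1 v v' p q" for v v' p q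
    using path_hom_image[OF that(3) gKT] gv that by simp
  \<comment> \<open>By construction \<open>g\<close> sends an edge to its edge loop; path induction
    concludes that \<open>g\<close> realises \<open>\<theta>\<close> on every path between vertices,
    once closed up by the paths \<open>gam\<close>.\<close>
  interpret Q: path_predicate X S1 "\<lambda>p. corr (conjugate p) (\<lambda>t. g (p t))"
  proof unfold_locales
    show "corr (conjugate q) (\<lambda>t. g (q t))"
      if v: "v \<in> vertices S1" "v' \<in> vertices S1" and pq: "path_hom T1 v v' p q" and p: "corr (conjugate p) (\<lambda>t. g (p t))" for v v' p q
    proof (rule corr_hom[OF p _ ghom[OF v pq]])
      have "p 0 = v" "p 1 = v'" "q 0 = v" "q 1 = v'" using path_hom_joins[OF pq] by (simp_all add: joins_def)
      then show "path_hom T1 pt pt (conjugate p) (conjugate q)"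
        using path_hom_join[OF path_hom_join[OF path_hom_refl[OF gam[OF v(1)]] pq] path_hom_refl[OF joins_rev[OF gam[OF v(2)]]]]
        by (simp add: conjugate_def)
    qed
    show "corr (conjugate (\<lambda>t. v)) (\<lambda>t. g v)" if v: "v \<in> vertices S1" for v
    proof -
      have "path_hom T1 pt pt (\<lambda>t. pt) (conjugate (\<lambda>t. v))"
        using path_hom_sym[OF path_hom_conjugate_const[OF gam[OF v]]] by (simp add: conjugate_def)
      from corr_hom[OF corr_const this path_hom_refl] show ?thesis
        using corr_const gv[OF v] by (simp add: corr_def)
    qed
    show "corr (conjugate (edge_path X e)) (\<lambda>t. g (edge_path X e t))" if e: "e \<in> S1" "dm e = 1" for e
    proof -
      have co: "corr (conjugate (edge_path X e)) (edge_loop e)" by (rule corr_edge_loop[OF e])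
      have "path_hom KT None None (edge_loop e) (\<lambda>t. g (edge_path X e t))"
      proof (rule path_hom_eq)
        show "joins KT None None (edge_loop e)" using co by (simp add: corr_def)
        fix t :: real assume t: "t \<in> {0..1}"
        let ?y = "\<lambda>i::nat. if i = 0 then 2 * t - 1 else 0"
        have "?y \<in> topspace (D e)" using edge_parameter[OF t] e by simp
        moreover have "edge_path X e t \<in> cells_union S1"
          using joins_in_topspace[OF edge_joins(1)[OF S1 e] t] topspace_TB[OF S1C] by blast
        ultimately show "edge_loop e t = g (edge_path X e t)"
          using a(5)[of e ?y] e gS[of "edge_path X e t"] by (simp add: edge_path_def)
      qed
      moreover have "path_hom T1 pt pt (conjugate (edge_path X e)) (conjugate (edge_path X e))"
        using co path_hom_refl by (simp add: corr_def path_hom_refl)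
      ultimately show ?thesis using corr_hom[OF co] by blast
    qed
    show "corr (conjugate (rev_path p)) (\<lambda>t. g (p (1 - t)))"
      if v: "v \<in> vertices S1" "v' \<in> vertices S1" and p: "joins T1 v v' p" "corr (conjugate p) (\<lambda>t. g (p t))" for v v' p
    proof -
      have p01: "p 0 = v" "p 1 = v'" using p(1) by (simp_all add: joins_def)
      have "path_hom T1 pt pt (rev_path (conjugate p)) (conjugate (rev_path p))"
        using path_hom_conjugate_rev[OF gam[OF v(1)] gam[OF v(2)] p(1)] by (simp add: conjugate_def p01)
      from corr_hom[OF corr_rev[OF p(2)] this path_hom_refl] show ?thesis
        using corr_rev[OF p(2)] by (simp add: corr_def)
    qed
    show "corr (conjugate (loop_join p q)) (\<lambda>t. g (loop_join p q t))"
      if v: "u \<in> vertices S1" "v \<in> vertices S1" "v' \<in> vertices S1" and p: "joins T1 u v p" "joins T1 v v' q"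
        and co: "corr (conjugate p) (\<lambda>t. g (p t))" "corr (conjugate q) (\<lambda>t. g (q t))" for u v v' p q
    proof -
      have p01: "p 0 = u" "p 1 = v" "q 0 = v" "q 1 = v'" using p by (simp_all add: joins_def)
      have "path_hom T1 pt pt (loop_join (conjugate p) (conjugate q)) (conjugate (loop_join p q))"
        using path_hom_conjugate_join[OF gam[OF v(1)] gam[OF v(2)] gam[OF v(3)] p] p01
        by (simp add: conjugate_def loop_join_def[of p q 0] loop_join_def[of p q 1])
      from corr_hom[OF corr_join[OF co] this path_hom_refl] show ?thesis
        using corr_join[OF co] by (simp add: corr_def loop_join_image)
    qed
  qed (rule S1)
  have gg: "path_hom KT None None (\<lambda>t. g (\<gamma>' j t)) (\<kappa> j)" if j: "j < n" for j
  proof -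
    have "corr (conjugate (\<gamma>' j)) (\<lambda>t. g (\<gamma>' j t))"
      by (rule Q.path_predicate_holds[OF pt_vertex pt_vertex \<gamma>'[OF j]])
    then have "corr (\<gamma>' j) (\<lambda>t. g (\<gamma>' j t))"
      using corr_hom[OF _ conjugate_loop[OF \<gamma>'[OF j]] path_hom_refl] by (simp add: corr_def)
    then show ?thesis using corr_unique corr_\<gamma>'[OF j] by blast
  qed
  show ?thesis
  proof (rule that[OF g(1) gB gKA h(1-3) _ _ gg])
    show "h (t, x) \<in> cells_union S1" if "t \<in> {0..1}" "x \<in> cells_union S1" for t x
      using h(4)[OF that(1), of x] k(4) that cells_union_BS by auto
    show "h (t, pt) = pt" if "t \<in> {0..1}" for t
      using h(4)[OF that, of pt] k(5) pt_in cells_union_BS by auto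
  qed
qed

text \<open>With \<open>g\<close> at hand, the identity of the wedge is lifted through
  \<open>g\<close>. The prescribed lift is \<open>f\<close> on \<open>M\<close> and the circles,
  where \<open>g\<close> after \<open>f\<close> deforms to the inclusion because \<open>g\<close>
  maps \<open>\<gamma>' j\<close> to a loop homotopic to \<open>\<kappa> j\<close>.\<close>

lemma homotopy_equivalence: "based_pair_homotopy_equivalent (T, cells_union S1, pt) (wd.W, KA, None)"
proof -
  obtain g h where g: "continuous_map T wd.W g" "\<And>x. x \<in> cells_union B \<Longrightarrow> g x = wd.iW x"
    "\<And>x. x \<in> cells_union S1 \<Longrightarrow> g x \<in> KA"
    and h: "continuous_map (cyl T) T h" "\<And>x. x \<in> topspace T \<Longrightarrow> h (0, x) = f (g x)" "\<And>x. x \<in> topspace T \<Longrightarrow> h (1, x) = x"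
    "\<And>t x. t \<in> {0..1} \<Longrightarrow> x \<in> cells_union S1 \<Longrightarrow> h (t, x) \<in> cells_union S1" "\<And>t. t \<in> {0..1} \<Longrightarrow> h (t, pt) = pt"
    and g\<gamma>': "\<And>j. j < n \<Longrightarrow> path_hom KT None None (\<lambda>t. g (\<gamma>' j t)) (\<kappa> j)"
    by (rule inverse_map) blast
  obtain \<rho> K where \<rho>: "continuous_map T (TB B) \<rho>" and K: "continuous_map (cyl T) T K"
    "\<And>x. x \<in> topspace T \<Longrightarrow> K (0, x) = \<rho> x" "\<And>x. x \<in> topspace T \<Longrightarrow> K (1, x) = x"
    by (rule deformation_retract) blast
  obtain \<rho>W E where \<rho>W: "continuous_map wd.W (TB B) \<rho>W" and E: "continuous_map (cyl wd.W) wd.W E"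
    "\<And>w. w \<in> topspace wd.W \<Longrightarrow> E (0, w) = wd.iW (\<rho>W w)" "\<And>w. w \<in> topspace wd.W \<Longrightarrow> E (1, w) = w"
    "\<And>t x. t \<in> {0..1} \<Longrightarrow> E (t, wd.iW x) = wd.iW x" and \<rho>Wi: "\<And>x. \<rho>W (wd.iW x) = x"
    by (rule wd.deformation_W) blast
  have "\<forall>j\<in>{..<n}. \<exists>L. continuous_map (cyl UI) KT L \<and> (\<forall>t. L (0, t) = g (\<gamma>' j t)) \<and> (\<forall>t. L (1, t) = \<kappa> j t) \<and>
      (\<forall>s\<in>{0..1}. L (s, 0) = None) \<and> (\<forall>s\<in>{0..1}. L (s, 1) = None)"
  proof
    fix j assume "j \<in> {..<n}"
    then have "path_hom KT None None (\<lambda>t. g (\<gamma>' j t)) (\<kappa> j)" using g\<gamma>' by simp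
    then show "\<exists>L. continuous_map (cyl UI) KT L \<and> (\<forall>t. L (0, t) = g (\<gamma>' j t)) \<and> (\<forall>t. L (1, t) = \<kappa> j t) \<and>
      (\<forall>s\<in>{0..1}. L (s, 0) = None) \<and> (\<forall>s\<in>{0..1}. L (s, 1) = None)"
      by (rule path_homE) blast
  qed
  from bchoice[OF this] obtain L where "\<forall>j\<in>{..<n}. continuous_map (cyl UI) KT (L j) \<and> (\<forall>t. L j (0, t) = g (\<gamma>' j t)) \<and>
      (\<forall>t. L j (1, t) = \<kappa> j t) \<and> (\<forall>s\<in>{0..1}. L j (s, 0) = None) \<and> (\<forall>s\<in>{0..1}. L j (s, 1) = None)" ..
  then have L: "\<And>j. j < n \<Longrightarrow> continuous_map (cyl UI) KT (L j)"
    "\<And>j t. j < n \<Longrightarrow> L j (0, t) = g (\<gamma>' j t)" "\<And>j t. j < n \<Longrightarrow> L j (1, t) = \<kappa> j t"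
    "\<And>j s. j < n \<Longrightarrow> s \<in> {0..1} \<Longrightarrow> L j (s, 0) = None" "\<And>j s. j < n \<Longrightarrow> s \<in> {0..1} \<Longrightarrow> L j (s, 1) = None"
    by simp_all
  \<comment> \<open>Constant in time on \<open>M\<close>; on circle \<open>j\<close> it is the
    homotopy \<open>L j\<close> read through the angle. At the base point both prescriptions give
    \<open>None\<close>.\<close>
  define J where "J z = wd.wmap (\<lambda>x. \<lambda>s\<in>{0..1}. wd.iW x) (\<lambda>j y. \<lambda>s\<in>{0..1}. L j (s, circle_angle y)) (snd z) (fst z)" for z
  have Ji: "J (s, wd.iW x) = wd.iW x" if "s \<in> {0..1}" for s x
    using that by (simp add: J_def wd.wmap_iW)
  have Jk: "J (s, wd.kD j y) = L j (s, circle_angle y)" if s: "s \<in> {0..1}" and j: "j < n" for s j y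
  proof -
    have "L j (s, circle_angle disk_base) = None" if "s \<in> {0..1}" for s
      using circle_angle_path[of 0 "\<lambda>t. L j (s, t)"] L(4,5)[OF j that] by simp
    then have "(\<lambda>s\<in>{0..1}. L j (s, circle_angle disk_base)) = (\<lambda>s\<in>{0..1}. wd.iW pt)"
      by (auto simp: fun_eq_iff wd.iW_pt)
    then have "wd.wmap (\<lambda>x. \<lambda>s\<in>{0..1}. wd.iW x) (\<lambda>j y. \<lambda>s\<in>{0..1}. L j (s, circle_angle y)) (wd.kD j y)
        = (\<lambda>s\<in>{0..1}. L j (s, circle_angle y))"
      by (rule wd.wmap_kD[OF j])
    then show ?thesis using s by (simp add: J_def)
  qed
  let ?KW = "wd.KW (topspace (TB B))"
  have J: "continuous_map (cyl (subtopology wd.W ?KW)) wd.W J"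
  proof (rule wd.continuous_map_from_cyl_KW)
    show "continuous_map (cyl (TB B)) wd.W (\<lambda>z. J (fst z, wd.iW (snd z)))"
      by (rule continuous_map_eq[OF continuous_map_composeI[OF wd.continuous_map_iW continuous_map_snd]]) (auto simp: Ji)
    fix j assume j: "j < n"
    have "continuous_map (cyl UI) wd.W (L j)" using L(1)[OF j] continuous_map_in_subtopology by blast
    then have "continuous_map (cyl circle) wd.W (\<lambda>z. L j (fst z, circle_angle (snd z)))"
      by (rule continuous_map_circle_homotopy) (simp add: L(4,5)[OF j])
    then show "continuous_map (cyl circle) wd.W (\<lambda>z. J (fst z, wd.kD j (snd z)))"
      by (rule continuous_map_eq) (auto simp: Jk j)
  qed
  have KWE: "(\<exists>x\<in>cells_union B. k = wd.iW x) \<or> (\<exists>j<n. \<exists>y\<in>boundary_sphere 2. k = wd.kD j y)" if "k \<in> ?KW" for k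
    using that topspace_TB_B by (auto simp: wd.KW_def)
  have f\<gamma>': "f (wd.kD j y) = \<gamma>' j (circle_angle y)" if "j < n" "y \<in> boundary_sphere 2" for j y
    using F_circle[OF that(1) circle_angle(1)[OF that(2)]] circle_angle(2)[OF that(2)] that(1) by (simp add: f_kD \<gamma>'_def)
  have J0: "J (0, k) = g (f k)" if k: "k \<in> ?KW" for k
    using KWE[OF k] by (auto simp: Ji Jk f_iW g(2) L(2) f\<gamma>')
  have J1: "J (1, k) = k" if k: "k \<in> ?KW" for k
    using KWE[OF k] by (auto simp: Ji Jk L(3) \<kappa>_def circle_angle(2))
  \<comment> \<open>In \<open>relative_lifting\<close> the wedge and \<open>N\<close> have exchanged
    their roles: \<open>g\<close> now takes the place of \<open>f\<close>, and each space brings its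
    own deformation onto \<open>M\<close>.\<close>
  obtain f' h' where f': "continuous_map wd.W T f'" "\<And>k. k \<in> ?KW \<Longrightarrow> f' k = f k"
    and h': "continuous_map (cyl wd.W) wd.W h'" "\<And>w. w \<in> topspace wd.W \<Longrightarrow> h' (0, w) = g (f' w)"
      "\<And>w. w \<in> topspace wd.W \<Longrightarrow> h' (1, w) = w"
      "\<And>t k. t \<in> {0..1} \<Longrightarrow> k \<in> ?KW \<Longrightarrow> \<exists>s\<in>{0..1}. h' (t, k) = J (s, k)"
  proof (rule relative_lifting[OF _ g(1) _ \<rho> K \<rho>W E(1), where iN = wd.iW
        and A = ?KW and X = wd.W and a = f and b = "\<lambda>x. x" and H = J])
    show "cofibration wd.W ?KW" by (rule wd.cofibration_KW)
    show "continuous_map (subtopology wd.W ?KW) T f" by (rule continuous_map_from_subtopology[OF continuous_map_f])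
    show "continuous_map (TB B) T (\<lambda>x. x)" by (intro continuous_map_from_subtopology continuous_map_ident)
    show "continuous_map (cyl (subtopology wd.W ?KW)) wd.W J" by (rule J)
  qed (use E \<rho>Wi J0 J1 g(2) topspace_TB_B continuous_map_ident in simp_all)
  have KWA: "KA \<subseteq> ?KW" by (rule KA_sub(1))
  have gpt: "g pt = None" using g(2)[OF pt_in(3)] by (simp add: wd.iW_pt)
  have JKA: "J (s, k) \<in> KA" if s: "s \<in> {0..1}" and k: "k \<in> KA" for s k
  proof -
    consider x where "x \<in> cells_union B1" "k = wd.iW x" | j y where "j < n" "y \<in> boundary_sphere 2" "k = wd.kD j y"
      using k by (auto simp: wd.KW_def)
    then show ?thesis
    proof cases
      case 1
      then show ?thesis using s Ji wd.iW_in_KW by simp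
    next
      case 2
      have "L j (s, circle_angle y) \<in> topspace KT"
        using L(1)[OF 2(1)] circle_angle(1)[OF 2(2)] s by (auto simp: continuous_map_def Pi_iff)
      then show ?thesis using 2 s Jk topspace_KT by simp
    qed
  qed
  have JNone: "J (s, None) = None" if "s \<in> {0..1}" for s
    using Ji[OF that, of pt] by (simp add: wd.iW_pt)
  show ?thesis
  proof (rule based_pair_homotopy_equivalentI)
    show "based_pair_map (T, cells_union S1, pt) (wd.W, KA, None) g"
      using g gpt by (auto simp: based_pair_map_def)
    show "based_pair_map (wd.W, KA, None) (T, cells_union S1, pt) f"
      using continuous_map_f f_KA f_None by (auto simp: based_pair_map_def)
    show "based_pair_map (wd.W, KA, None) (T, cells_union S1, pt) f'"
      using f' KWA f_KA f_None None_KA by (auto simp: based_pair_map_def subset_iff)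
    show "based_pair_homotopic (T, cells_union S1, pt) (T, cells_union S1, pt) (f \<circ> g) id"
      by (rule based_pair_homotopicI[OF h(1)]) (use h pt_in cells_union_subset[OF S1C] in auto)
    show "based_pair_homotopic (wd.W, KA, None) (wd.W, KA, None) (g \<circ> f') id"
    proof (rule based_pair_homotopicI[OF h'(1)])
      show "h' (t, k) \<in> KA" if t: "t \<in> {0..1}" and k: "k \<in> KA" for t k
      proof -
        obtain s where "s \<in> {0..1}" "h' (t, k) = J (s, k)"
          using h'(4)[OF t subsetD[OF KWA k]] by blast
        then show ?thesis using JKA k by simp
      qed
      show "h' (t, None) = None" if "t \<in> {0..1}" for t
        using h'(4)[OF that subsetD[OF KWA None_KA]] JNone by auto
    qed (use h' KA_sub None_KA in auto)
  qed
qed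

end

text \<open>Freeness is assumed for the edge paths of \<open>M\<close>, whereas the construction
  uses those of \<open>N\<close>. The characteristic maps agree only on the disks, so the families
  of classes have to be exchanged index by index.\<close>

lemma free_group_on_cong:
  assumes eq: "\<And>s. s \<in> S \<Longrightarrow> b s = b' s" and free: "free_group_on G S b"
  shows "free_group_on G S b'"
proof -
  have v: "word_value G b u = word_value G b' u" if "u \<in> carrier (free_group S)" for u
  proof -
    have "u \<in> lists (UNIV \<times> S)" using that by (simp add: free_group_def)
    then show ?thesis
    proof (induction u)
      case (Cons x u)
      then have "letter_value G b x = letter_value G b' x" using eq by (auto simp: letter_value_def)
      then show ?case using Cons.IH by (simp add: word_value_def)
    qed (simp add: word_value_def)
  qed
  have closed: "x \<otimes>\<^bsub>free_group S\<^esub> y \<in> carrier (free_group S)"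
    if "x \<in> carrier (free_group S)" "y \<in> carrier (free_group S)" for x y
    using that reduce_word_in_carrier[of "x @ y" S] by (auto simp: free_group_def)
  have G: "group G" and b: "b \<in> S \<rightarrow> carrier G" and iso: "word_value G b \<in> iso (free_group S) G"
    using free by (auto simp: free_group_on_def)
  have "word_value G b' \<in> hom (free_group S) G"
    using iso v closed by (auto simp: iso_def hom_def Pi_iff)
  moreover have "bij_betw (word_value G b') (carrier (free_group S)) (carrier G)"
    using iso v bij_betw_cong[of "carrier (free_group S)" "word_value G b" "word_value G b'"] by (simp add: iso_def)
  ultimately show ?thesis
    using G b eq by (auto simp: free_group_on_def iso_def Pi_iff)
qed

theorem theorem11:
  fixes N M :: "('a, 'c) cw" and e0 :: 'c and pt :: 'a
    and m n :: nat and d :: "nat \<Rightarrow> 'c" and c :: "nat \<Rightarrow> (real \<Rightarrow> 'a) set"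
  assumes "cw_complex N" and "cw_complex M" and "subcomplex M N"
    and "connected_space (cw_space N)" and "connected_space (cw_space M)"
    and "homotopy_equivalence_map (cw_space M) (cw_space N) (\<lambda>x. x)"
    and "cells_of_dim M 0 = {e0}" and "pt = cw_char M e0 (\<lambda>i. 0)"
    and "bij_betw d {..<m} (cells_of_dim M 1)"
    and "c ` {..<n} \<subseteq> carrier (fundamental_group (subtopology (cw_space N) (skeleton N 1)) pt)"
    and "free_group_on (fundamental_group (subtopology (cw_space N) (skeleton N 1)) pt)
           ({..<m} <+> {..<n})
           (case_sum
             (\<lambda>i. loop_class (subtopology (cw_space N) (skeleton N 1)) pt (edge_path M (d i)))
             c)"
  shows "based_pair_homotopy_equivalent
           (cw_space N, skeleton N 1, pt)
           (wedge (cw_space M, skeleton M 1, pt) (wedge_power n based_2_disk))"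
proof -
  interpret N: cw_complex_space N by unfold_locales (rule assms(1))
  let ?B = "cw_cells M"
  have BN: "?B \<subseteq> cw_cells N" and dim: "\<And>e. e \<in> ?B \<Longrightarrow> cw_dim M e = cw_dim N e"
    and char: "\<And>e x. e \<in> ?B \<Longrightarrow> x \<in> topspace (disk (cw_dim N e)) \<Longrightarrow> cw_char M e x = cw_char N e x"
    and cc: "\<And>e. e \<in> ?B \<Longrightarrow> closed_cell N e \<subseteq> N.cells_union ?B"
    and sp: "cw_space M = N.TB ?B"
    using assms(3) by (auto simp: subcomplex_def N.cells_union_def)
  have oc: "open_cell M e = open_cell N e" if "e \<in> ?B" for e
    unfolding open_cell_def using char[OF that] dim[OF that] by (auto simp: topspace_disk_Un intro!: image_cong)
  have B: "N.cell_closed ?B" using BN cc by (simp add: N.cell_closed_def)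
  have e0: "{e \<in> ?B. cw_dim N e = 0} = {e0}"
  proof -
    have "{e \<in> ?B. cw_dim N e = 0} = {e \<in> ?B. cw_dim M e = 0}" using dim by auto
    then show ?thesis using assms(7) by (simp add: cells_of_dim_def)
  qed
  then have "e0 \<in> {e \<in> ?B. cw_dim N e = 0}" by simp
  then have pt: "pt = cw_char N e0 (\<lambda>i. 0)"
    unfolding assms(8) by (intro char) (auto simp: disk_0)
  interpret R: retract_data N ?B e0 pt
    by unfold_locales (use B assms(4) assms(6)[unfolded sp] e0 pt in auto)
  have skN: "skeleton N 1 = N.cells_union R.S1"
    by (simp add: skeleton_def N.cells_union_def R.S1_def)
  have "{e \<in> ?B. cw_dim M e \<le> 1} = R.B1" using dim by (auto simp: R.B1_def)
  then have skM: "skeleton M 1 = N.cells_union R.B1"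
    unfolding skeleton_def N.cells_union_def using oc by (auto simp: R.B1_def)
  have d: "d ` {..<m} = {e \<in> ?B. cw_dim N e = 1}"
    using assms(9) dim by (auto simp: bij_betw_def cells_of_dim_def)
  have edge: "loop_class R.T1 pt (edge_path M e) = loop_class R.T1 pt (edge_path N e)"
    if e: "e \<in> ?B" "cw_dim N e = 1" for e
  proof (rule loop_class_eqI, rule path_hom_sym, rule path_hom_eq)
    have eS: "e \<in> R.B1" using e by (simp add: R.B1_def)
    show "joins R.T1 pt pt (edge_path N e)"
      using N.edge_joins[OF R.B1 eS e(2)] R.vertices_B N.joins_TB_mono[OF _ R.B1_sub(1)] by auto
    show "edge_path N e t = edge_path M e t" if "t \<in> {0..1}" for t
      using char[OF e(1)] edge_parameter[OF that] e(2) by (simp add: edge_path_def)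
  qed
  have free: "free_group_on (fundamental_group R.T1 pt) ({..<m} <+> {..<n})
      (case_sum (\<lambda>i. loop_class R.T1 pt (edge_path N (d i))) c)"
  proof (rule free_group_on_cong[OF _ assms(11)[unfolded skN]])
    fix s assume s: "s \<in> {..<m} <+> {..<n}"
    have "d i \<in> {e \<in> ?B. cw_dim N e = 1}" if "i < m" for i using d that by blast
    then have "loop_class R.T1 pt (edge_path M (d i)) = loop_class R.T1 pt (edge_path N (d i))" if "i < m" for i
      using edge that by simp
    then show "case_sum (\<lambda>i. loop_class R.T1 pt (edge_path M (d i))) c s =
        case_sum (\<lambda>i. loop_class R.T1 pt (edge_path N (d i))) c s"
      using s by (cases s) auto
  qed
  have "\<forall>j\<in>{..<n}. \<exists>\<gamma>. joins R.T1 pt pt \<gamma> \<and> c j = loop_class R.T1 pt \<gamma>"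
    using assms(10)[unfolded skN] by (auto simp: carrier_fundamental_group)
  from bchoice[OF this] obtain \<gamma> where \<gamma>: "\<forall>j\<in>{..<n}. joins R.T1 pt pt (\<gamma> j) \<and> c j = loop_class R.T1 pt (\<gamma> j)" ..
  have \<gamma>T: "joins N.T pt pt (\<gamma> j)" if "j < n" for j
    using \<gamma> that by (simp add: joins_subtopology)
  have "\<forall>j\<in>{..<n}. \<exists>w. joins (N.TB R.B1) pt pt w \<and> path_hom N.T pt pt (\<gamma> j) w"
  proof
    fix j assume "j \<in> {..<n}"
    then show "\<exists>w. joins (N.TB R.B1) pt pt w \<and> path_hom N.T pt pt (\<gamma> j) w"
      using R.loop_into_retract_skeleton[OF \<gamma>T] by (metis lessThan_iff)
  qed
  from bchoice[OF this] obtain w where w: "\<forall>j\<in>{..<n}. joins (N.TB R.B1) pt pt (w j) \<and> path_hom N.T pt pt (\<gamma> j) (w j)" ..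
  have "\<forall>j\<in>{..<n}. \<exists>F. continuous_map (disk 2) N.T F \<and>
      (\<forall>t\<in>{0..1}. F (circle_path t) = loop_join (\<gamma> j) (rev_path (w j)) t)"
  proof
    fix j assume "j \<in> {..<n}"
    then have wj: "path_hom N.T pt pt (\<gamma> j) (w j)" using w by blast
    note j = path_hom_joins(2)[OF wj]
    \<comment> \<open>\<open>\<gamma> j\<close> and \<open>w j\<close> are homotopic in
      \<open>N\<close>, so this loop contracts there and bounds a disk.\<close>
    have "path_hom N.T pt pt (loop_join (\<gamma> j) (rev_path (w j))) (\<lambda>t. pt)"
      by (rule path_hom_trans[OF path_hom_join[OF wj path_hom_refl[OF joins_rev[OF j]]] path_hom_inverse_right[OF j]])
    then show "\<exists>F. continuous_map (disk 2) N.T F \<and>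
      (\<forall>t\<in>{0..1}. F (circle_path t) = loop_join (\<gamma> j) (rev_path (w j)) t)"
      by (rule disk_fill) blast
  qed
  from bchoice[OF this] obtain F where F: "\<forall>j\<in>{..<n}. continuous_map (disk 2) N.T (F j) \<and>
      (\<forall>t\<in>{0..1}. F j (circle_path t) = loop_join (\<gamma> j) (rev_path (w j)) t)" ..
  have "\<forall>v\<in>N.vertices R.S1. \<exists>p. joins R.T1 pt v p"
  proof
    fix v assume "v \<in> N.vertices R.S1"
    then show "\<exists>p. joins R.T1 pt v p" by (rule R.skeleton_connected) blast
  qed
  from bchoice[OF this] obtain p where p: "\<forall>v\<in>N.vertices R.S1. joins R.T1 pt v (p v)" ..
  \<comment> \<open>Constant at the base point, so that conjugation leaves loops at
    \<open>pt\<close> unchanged up to homotopy and the homotopy on the 1-skeleton fixes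
    \<open>pt\<close>.\<close>
  define gam where "gam v = (if v = pt then (\<lambda>t. pt) else p v)" for v
  interpret wedge_data N ?B e0 pt m n d c \<gamma> w F gam
    by unfold_locales (use d \<gamma> w F p free joins_const[OF R.pt_top(2)] in \<open>auto simp: gam_def\<close>)
  have "wedge (cw_space M, skeleton M 1, pt) (wedge_power n based_2_disk) = (wd.W, KA, None)"
    unfolding sp skM by (rule wd.wedge_eq[OF R.pt_in(1)])
  then show ?thesis
    unfolding skN by (simp only: homotopy_equivalence)
qed

end
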